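(* Let $X$ be a uniformly convex real Banach space whose norm is $C^1$ on $X\setminus\{0\}$, let $1<\alpha<\eta<\beta$, and let $N,A,B\in C^1(X)$ be even functionals that are $\eta$-homogeneous, $\alpha$-homogeneous and $\beta$-homogeneous, respectively. For $\lambda\in\mathbb{R}$ put $$\Phi_\lambda(u)=\frac1\eta N(u)-\frac\lambda\alpha A(u)-\frac1\beta B(u),\quad u\in X.$$ Assume that there exist $C,C'>0$ such that $C'\|u\|^\eta\ge N(u)\ge C^{-1}\|u\|^\eta$, $|A(u)|\le C\|u\|^\alpha$ and $|B(u)|\le C\|u\|^\beta$ for all $u\in X$. Assume that whenever $(\lambda_n)\subset\mathbb{R}$ and $(u_n)\subset X$ are bounded sequences such that $(\Phi_{\lambda_n}(u_n))$ is bounded and $\Phi_{\lambda_n}'(u_n)\to0$, then $(u_n)$ has a convergent subsequence. Let $\mathcal{C}_A=\{u\in X:A(u)>0\}$ and $\mathcal{C}_B=\{u\in X:B(u)>0\}$, and assume that if $(u_n)\subset\mathcal{C}_A$ is a bounded sequence with $A(u_n)\to0$ then $B(u_n)\to0$. Then there exists $c^*<0$ such that: i) For any $1\le k\le\gamma(\mathcal{C}_A)$ and $c\in(c^*,0)$ there exist $\lambda_{c,k}^+>0$ and $v_{c,k}\in\mathcal{C}_A$ such that $\Phi_{\lambda_{c,k}^+}(v_{c,k})=c$ and $\Phi_{\lambda_{c,k}^+}'(v_{c,k})=0$. ii) For any $1\le k\le\gamma(\mathcal{C}_A)$ the map $c\mapsto\lambda_{c,k}^+$ is continuous and decreasing in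 $(c^*,0)$, and satisfies $\lim_{c\to0^-}\lambda_{c,k}^+=0$. iii) If $\gamma(\mathcal{C}_A)=\infty$ then $(\lambda_{c,k}^+)$ is a nondecreasing unbounded sequence, i.e. $0<\lambda_{c,k}^+\le\lambda_{c,k+1}^+\to\infty$ as $k\to\infty$, for any $c\in(c^*,0)$. iv) If $\gamma(\mathcal{C}_A)=\infty$ then for each $\lambda>0$ there exist sequences $(v_n)\subset\mathcal{C}_A$, $(c_n)\subset(c^*,0)$ and $(k_n)\subset\mathbb{N}$ such that $c_n\to0$, $k_n\to\infty$, and $\lambda=\lambda_{c_n,k_n}^+$, $\Phi_{\lambda_{c_n,k_n}^+}(v_n)=c_n$, $\Phi_{\lambda_{c_n,k_n}^+}'(v_n)=0$ for every $n$. Moreover $v_n\to0$ in $X$, so $(\lambda,0)$ is a bifurcation point for any $\lambda>0$. v) For any $1\le k\le\gamma(\mathcal{C}_A\cap\mathcal{C}_B)$ and $c>c^*$ there exist $\lambda_{c,k}^-\in\mathbb{R}$ and $u_{c,k}\in\mathcal{C}_A\cap\mathcal{C}_B$ such that $\Phi_{\lambda_{c,k}^-}(u_{c,k})=c$ and $\Phi_{\lambda_{c,k}^-}'(u_{c,k})=0$. Moreover $\lambda_{c,k}^+<\lambda_{c,k}^-$ for all $c\in(c^*,0)$. vi) For any $1\le k\le\gamma(\mathcal{C}_A\cap\mathcal{C}_B)$ the map $c\mapsto\lambda_{c,k}^-$ is continuous and decreasing in $(c^*,\infty)$, and satisfies $\lim_{c\to\infty}\lambda_{c,k}^-=-\infty$.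 vii) If $\gamma(\mathcal{C}_A\cap\mathcal{C}_B)=\infty$ then $(\lambda_{c,k}^-)$ is a nondecreasing unbounded sequence, i.e. $0<\lambda_{c,k}^-\le\lambda_{c,k+1}^-\to\infty$ as $k\to\infty$, for any $c\in(c^*,c^{**})$, where $c^{**}>0$ is the constant defined in the context. viii) If $\gamma(\mathcal{C}_A\cap\mathcal{C}_B)=\infty$ then for each $\lambda\in\mathbb{R}$ there exist sequences $(u_n)\subset\mathcal{C}_A\cap\mathcal{C}_B$, $(c_n)\subset(c^*,\infty)$ and $(k_n)\subset\mathbb{N}$ such that $c_n\to\infty$, $k_n\to\infty$, and $\lambda=\lambda_{c_n,k_n}^-$, $\Phi_{\lambda_{c_n,k_n}^-}(u_n)=c_n$, $\Phi_{\lambda_{c_n,k_n}^-}'(u_n)=0$ for every $n$. Moreover $\|u_n\|\to\infty$, so $(\lambda,\infty)$ is a bifurcation point for any $\lambda\in\mathbb{R}$. (The families $(\lambda^{\pm}_{c,k})$ in the other items are the ones whose existence is asserted in i) and v).)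
   Context: $F$ is $q$-homogeneous if $F(tu)=t^qF(u)$ for all $t>0$, $u\in X$. "Decreasing" means strictly decreasing. The constant $c^{**}$ is $$c^{**}=\inf_{u\in\mathcal{C}_A\cap\mathcal{C}_B}\frac{\beta-\eta}{\eta\beta}\,\frac{N(u)^{\frac{\beta}{\beta-\eta}}}{B(u)^{\frac{\eta}{\beta-\eta}}}>0.$$ For a symmetric open cone $\mathcal{C}\subset X\setminus\{0\}$, $\gamma(\mathcal{C})=\sup\{k\in\mathbb{N}:\text{there is a compact symmetric } M\subset\mathcal{C}\text{ with }\gamma(M)\ge k\}\in\{0,1,2,\dots\}\cup\{\infty\}$, where $\gamma(M)$ is the Krasnoselskii genus: the least $m$ such that there is an odd continuous map $M\to\mathbb{R}^m\setminus\{0\}$ ($\infty$ if none exists). When $\gamma(\mathcal{C})=\infty$, "$1\le k\le\gamma(\mathcal{C})$" means $k\in\mathbb{N}$. $(\lambda,0)$ (respectively $(\lambda,\infty)$) is a bifurcation point if there are $(\lambda_n,u_n)\in\mathbb{R}\times(X\setminus\{0\})$ with $\Phi_{\lambda_n}'(u_n)=0$, $\lambda_n\to\lambda$ and $u_n\to0$ in $X$ (respectively $\|u_n\|\to\infty$). *)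

theory Defs
  imports "HOL-Analysis.Analysis"
begin

definition uniformly_convex_norm :: "'a::real_normed_vector itself \<Rightarrow> bool" where
  "uniformly_convex_norm _ \<longleftrightarrow>
     (\<forall>\<epsilon>>0. \<exists>\<delta>>0. \<forall>x y :: 'a.
        norm x = 1 \<longrightarrow> norm y = 1 \<longrightarrow> \<epsilon> \<le> norm (x - y) \<longrightarrow> norm ((1/2) *\<^sub>R (x + y)) \<le> 1 - \<delta>)"

text \<open>Continuous Frechet differentiability; continuity of the derivative is with respect to the
  operator norm of the dual space. Used for open sets only.\<close>

definition C1_on :: "'a::real_normed_vector set \<Rightarrow> ('a \<Rightarrow> real) \<Rightarrow> bool" where
  "C1_on S F \<longleftrightarrow>
     (\<exists>F' :: 'a \<Rightarrow> 'a \<Rightarrow>\<^sub>L real.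
        (\<forall>u\<in>S. (F has_derivative blinfun_apply (F' u)) (at u)) \<and> continuous_on S F')"

text \<open>The Frechet derivative as an element of the dual space; only meaningful at points where
  the functional is differentiable.\<close>

definition dual_deriv :: "('a::real_normed_vector \<Rightarrow> real) \<Rightarrow> 'a \<Rightarrow> ('a \<Rightarrow>\<^sub>L real)" where
  "dual_deriv F u = Blinfun (frechet_derivative F (at u))"

definition homogeneous :: "real \<Rightarrow> ('a::real_vector \<Rightarrow> real) \<Rightarrow> bool" where
  "homogeneous q F \<longleftrightarrow> (\<forall>t>0. \<forall>u. F (t *\<^sub>R u) = t powr q * F u)"

definition even_functional :: "('a::real_vector \<Rightarrow> real) \<Rightarrow> bool" where
  "even_functional F \<longleftrightarrow> (\<forall>u. F (- u) = F u)"

definition symmetric_set :: "'a::real_vector set \<Rightarrow> bool" where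
  "symmetric_set M \<longleftrightarrow> (\<forall>u\<in>M. - u \<in> M)"

text \<open>Here \<open>Euclidean_space m\<close> models the \<open>m\<close>-dimensional Euclidean space as the real sequences
  vanishing from index \<open>m\<close> on. The infimum of the empty set in \<open>enat\<close> is \<open>\<infinity>\<close>.\<close>

definition genus :: "'a::real_normed_vector set \<Rightarrow> enat" where
  "genus M = Inf {enat m | m. \<exists>h. continuous_map (top_of_set M) (Euclidean_space m) h \<and>
     (\<forall>u\<in>M. h u \<noteq> (\<lambda>_. 0)) \<and> (\<forall>u\<in>M. h (- u) = (\<lambda>i. - h u i))}"

definition cone_genus :: "'a::real_normed_vector set \<Rightarrow> enat" where
  "cone_genus K = Sup {enat k | k. \<exists>M. compact M \<and> symmetric_set M \<and> M \<subseteq> K \<and> enat k \<le> genus M}"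

definition pos_cone :: "('a \<Rightarrow> real) \<Rightarrow> 'a set" where
  "pos_cone F = {u. 0 < F u}"

definition Phi ::
  "real \<Rightarrow> real \<Rightarrow> real \<Rightarrow> ('a \<Rightarrow> real) \<Rightarrow> ('a \<Rightarrow> real) \<Rightarrow> ('a \<Rightarrow> real) \<Rightarrow> real \<Rightarrow> 'a \<Rightarrow> real" where
  "Phi \<eta> \<alpha> \<beta> N A B lam u = (1 / \<eta>) * N u - (lam / \<alpha>) * A u - (1 / \<beta>) * B u"

definition compactness_condition :: "(real \<Rightarrow> 'a::real_normed_vector \<Rightarrow> real) \<Rightarrow> bool" where
  "compactness_condition \<Phi> \<longleftrightarrow>
     (\<forall>(lams :: nat \<Rightarrow> real) (us :: nat \<Rightarrow> 'a).
        bounded (range lams) \<longrightarrow> bounded (range us) \<longrightarrow>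
        bounded (range (\<lambda>n. \<Phi> (lams n) (us n))) \<longrightarrow>
        (\<lambda>n. dual_deriv (\<Phi> (lams n)) (us n)) \<longlonglongrightarrow> 0 \<longrightarrow>
        (\<exists>r :: nat \<Rightarrow> nat. strict_mono r \<and> convergent (us \<circ> r)))"

text \<open>Extended-real valued, so that the infimum over an empty set of \<open>u\<close> is \<open>\<infinity>\<close>.\<close>

definition c_star_star ::
  "real \<Rightarrow> real \<Rightarrow> ('a \<Rightarrow> real) \<Rightarrow> ('a \<Rightarrow> real) \<Rightarrow> ('a \<Rightarrow> real) \<Rightarrow> ereal" where
  "c_star_star \<eta> \<beta> N A B =
     (INF u \<in> pos_cone A \<inter> pos_cone B.
        ereal ((\<beta> - \<eta>) / (\<eta> * \<beta>) * (N u powr (\<beta> / (\<beta> - \<eta>)) / B u powr (\<eta> / (\<beta> - \<eta>)))))"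

definition bifurcation_from_zero ::
  "(real \<Rightarrow> 'a::real_normed_vector \<Rightarrow> real) \<Rightarrow> real \<Rightarrow> bool" where
  "bifurcation_from_zero \<Phi> lam \<longleftrightarrow>
     (\<exists>(lams :: nat \<Rightarrow> real) (us :: nat \<Rightarrow> 'a).
        (\<forall>n. us n \<noteq> 0 \<and> dual_deriv (\<Phi> (lams n)) (us n) = 0) \<and>
        lams \<longlonglongrightarrow> lam \<and> us \<longlonglongrightarrow> 0)"

definition bifurcation_from_infinity ::
  "(real \<Rightarrow> 'a::real_normed_vector \<Rightarrow> real) \<Rightarrow> real \<Rightarrow> bool" where
  "bifurcation_from_infinity \<Phi> lam \<longleftrightarrow>
     (\<exists>(lams :: nat \<Rightarrow> real) (us :: nat \<Rightarrow> 'a).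
        (\<forall>n. us n \<noteq> 0 \<and> dual_deriv (\<Phi> (lams n)) (us n) = 0) \<and>
        lams \<longlonglongrightarrow> lam \<and> filterlim (\<lambda>n. norm (us n)) at_top sequentially)"

end

(* For fixed c the equation Phi_lambda(v) = c is solved for lambda, giving a function lam c v on
   {A > 0} whose critical points v are exactly the critical points of Phi_lambda at level c, with
   lambda = lam c v.  Along every ray lam c has one local minimum (c* < c < 0) and, if B > 0, one
   local maximum (c > c* ); inserting these gives even, 0-homogeneous C^1 functionals on the cones
   {A > 0} and {A > 0, B > 0}, and the lambda_{c,k} are their genus minimax values.

   Instead of a deformation flow on the unit sphere, which is delicate when the norm is only C^1,
   Ekeland's principle is applied to the space of odd continuous maps from one fixed almost optimal
   compact set into the unit sphere: an Ekeland point that contained no almost critical point at its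
   maximal level could be improved by the single step h |-> sgn (h - s W(h)) with an odd descent
   field W.  The radial projection costs nothing because the functional is 0-homogeneous.

   The level c enters lam affinely, so comparing fibre extrema at two levels yields monotonicity and
   local Lipschitz continuity of c |-> lambda_{c,k}. *)
theory Submission
  imports Defs
begin

section \<open>Krasnoselskii genus\<close>

text \<open>The constant c* is forced by uniformity over rays. For a unit vector \<open>u\<close>
  one has \<open>Q (t *\<^sub>R u) < 0\<close> for all \<open>t\<close> up to \<tau>, and
  \<open>cs\<close> bounds \<open>P\<close> from above at every point with \<open>t\<close> at least
  \<tau>/2 and \<open>Q\<close> nonpositive. Hence for \<open>c > cs\<close> the curve
  \<open>P (t *\<^sub>R u)\<close> is below level \<open>c\<close> before it can turn upwards: it
  crosses \<open>c\<close> on the way down before \<tau> if \<open>c < 0\<close>, and on the way up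
  after \<tau> if \<open>B u > 0\<close>. The two crossings stay apart uniformly in
  \<open>u\<close>.

  The cones are open and a minimax procedure could run into their boundary. This is excluded only on
  sublevels: a bound \<open>lam c v \<le> b\<close> at a fibre extremum controls its distance from 0
  and keeps \<open>A\<close>, and on the second cone also \<open>B\<close>, away from 0. For this
  reason closedness, compactness and comparison of levels are all phrased for sublevels.

  The position \<open>T\<close> of the extremum on its ray is only shown to be continuous. The
  extremal value is nevertheless C^1, because moving along the ray has no first-order effect at an
  extremum.\<close>

lemma continuous_map_Euclidean_space_iff:
  "continuous_map (top_of_set M) (Euclidean_space m) h \<longleftrightarrow>
     (\<forall>i. continuous_on M (\<lambda>u. h u i)) \<and> (\<forall>u\<in>M. \<forall>i\<ge>m. h u i = 0)"
  unfolding Euclidean_space_def continuous_map_in_subtopology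
    continuous_map_componentwise_UNIV
  by (auto simp: image_subset_iff)

text \<open>Coordinatewise encoding of an odd map into R^m without the origin, so that coordinates
  can be extended and concatenated one at a time.\<close>

definition odd_nonvanishing :: "'a::real_normed_vector set \<Rightarrow> nat \<Rightarrow> ('a \<Rightarrow> nat \<Rightarrow> real) \<Rightarrow> bool" where
  "odd_nonvanishing M m h \<longleftrightarrow> (\<forall>i. continuous_on M (\<lambda>u. h u i)) \<and> (\<forall>u\<in>M. \<forall>i\<ge>m. h u i = 0) \<and>
     (\<forall>u\<in>M. \<exists>i. h u i \<noteq> 0) \<and> (\<forall>u\<in>M. \<forall>i. h (- u) i = - h u i)"

lemma genus_alt: "genus M = Inf {enat m | m. \<exists>h. odd_nonvanishing M m h}"
  unfolding genus_def odd_nonvanishing_def continuous_map_Euclidean_space_iff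
  by (simp add: fun_eq_iff conj_assoc)

lemma genus_leI: "odd_nonvanishing M m h \<Longrightarrow> genus M \<le> enat m"
  unfolding genus_alt by (rule Inf_lower) blast

text \<open>A finite infimum in \<open>enat\<close> is that of a nonempty set, and well-ordering
  makes it a minimum.\<close>

lemma genus_finiteE:
  assumes "genus M = enat m"
  obtains h where "odd_nonvanishing M m h"
proof -
  let ?S = "{enat m | m. \<exists>h. odd_nonvanishing M m h}"
  have "?S \<noteq> {}"
    using assms unfolding genus_alt by (auto simp: Inf_enat_def split: if_splits)
  then have "Inf ?S \<in> ?S"
    using wellorder_InfI by (metis (no_types, lifting) ex_in_conv)
  then show ?thesis using that assms unfolding genus_alt by auto
qed

lemma genus_empty [simp]: "genus ({} :: 'a::real_normed_vector set) = 0"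
proof -
  have "genus ({} :: 'a set) \<le> enat 0" by (rule genus_leI) (simp add: odd_nonvanishing_def)
  then show ?thesis by (simp add: zero_enat_def[symmetric])
qed

text \<open>An odd nonvanishing map on the image pulls back along \<open>f\<close> with the same
  number of coordinates.\<close>

lemma genus_image_ge:
  assumes "continuous_on M f" and odd: "\<And>u. u \<in> M \<Longrightarrow> f (- u) = - f u"
  shows "genus M \<le> genus (f ` M)"
proof (cases "genus (f ` M)")
  case (enat m)
  then obtain h where h: "odd_nonvanishing (f ` M) m h" by (rule genus_finiteE)
  have "odd_nonvanishing M m (\<lambda>u. h (f u))"
    unfolding odd_nonvanishing_def
  proof (intro conjI)
    show "\<forall>i. continuous_on M (\<lambda>u. h (f u) i)"
      using h assms(1) unfolding odd_nonvanishing_def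
      by (auto intro: continuous_on_compose2[where g="\<lambda>u. h u _"])
  qed (use h odd in \<open>auto simp: odd_nonvanishing_def\<close>)
  then show ?thesis using genus_leI enat by metis
qed auto

text \<open>Subadditivity in the form in which the first summand is the set where a globally defined odd
  map \<open>F\<close> does not vanish; the odd map on the complement is extended by Tietze's theorem.\<close>

lemma genus_le_add_nonvanishing:
  fixes F :: "'a::real_normed_vector \<Rightarrow> nat \<Rightarrow> real"
  assumes M: "compact M" "symmetric_set M"
    and F: "\<And>i. continuous_on UNIV (\<lambda>u. F u i)" "\<And>u i. F (- u) i = - F u i" "\<And>u i. i \<ge> m \<Longrightarrow> F u i = 0"
  shows "genus M \<le> enat m + genus {u \<in> M. \<forall>i. F u i = 0}"
proof (cases "genus {u \<in> M. \<forall>i. F u i = 0}")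
  case (enat j)
  define Z where "Z = {u \<in> M. \<forall>i. F u i = 0}"
  obtain h where h: "odd_nonvanishing Z j h" using genus_finiteE enat Z_def by metis
  have "closed {u. \<forall>i. F u i = 0}"
    by (intro closed_Collect_all closed_Collect_eq F continuous_on_const)
  then have cZ: "closedin (top_of_set M) Z"
    by (auto simp: Z_def closedin_closed)
  have "\<exists>g. continuous_on M g \<and> (\<forall>u\<in>Z. g u = h u i)" for i
  proof -
    have "normal_space (top_of_set M)"
      by (simp add: metrizable_imp_normal_space metrizable_space_subtopology metrizable_space_euclidean)
    moreover have "continuous_map (subtopology (top_of_set M) Z) euclideanreal (\<lambda>u. h u i)"
      using h cZ closedin_imp_subset[OF cZ]
      by (simp add: odd_nonvanishing_def subtopology_subtopology Int_absorb1)
    ultimately obtain g where "continuous_map (top_of_set M) euclideanreal g" "\<And>x. x \<in> Z \<Longrightarrow> g x = h x i"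
      using Tietze_extension_realinterval[of "top_of_set M" Z UNIV "\<lambda>u. h u i"] cZ by auto
    then show ?thesis by auto
  qed
  then obtain g where g: "\<And>i. continuous_on M (g i)" "\<And>i u. u \<in> Z \<Longrightarrow> g i u = h u i" by metis
  have neg: "u \<in> M \<Longrightarrow> - u \<in> M" for u using M by (auto simp: symmetric_set_def)
  \<comment> \<open>The second block is the odd part of the Tietze extension. On \<open>Z\<close>,
    which is symmetric, it agrees with \<open>h\<close> because \<open>h\<close> is already odd
    there, so \<open>H\<close> vanishes neither on \<open>Z\<close> nor off it.\<close>
  define H where "H u i = (if i < m then F u i else if i < m + j
     then (g (i - m) u - g (i - m) (- u)) / 2 else 0)" for u i
  have "odd_nonvanishing M (m + j) H"
    unfolding odd_nonvanishing_def
  proof (intro conjI allI ballI impI)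
    fix i
    have "continuous_on M (\<lambda>u. (g (i - m) u - g (i - m) (- u)) / 2)"
      using neg by (intro continuous_intros g continuous_on_compose2[OF g(1), where f = uminus]) auto
    moreover have "continuous_on M (\<lambda>u. F u i)" using F(1) continuous_on_subset by blast
    ultimately show "continuous_on M (\<lambda>u. H u i)"
      by (cases "i < m"; cases "i < m + j") (simp_all add: H_def)
  next
    fix u assume u: "u \<in> M"
    show "\<exists>i. H u i \<noteq> 0"
    proof (cases "u \<in> Z")
      case False
      then obtain i where "F u i \<noteq> 0" using u by (auto simp: Z_def)
      moreover from this have "i < m" using F(3)[of i u] by linarith
      ultimately show ?thesis by (auto simp: H_def intro!: exI[of _ i])
    next
      case True
      then obtain i where i: "h u i \<noteq> 0" "i < j" using h by (metis linorder_not_less odd_nonvanishing_def)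
      have "- u \<in> Z" using True neg F(2) by (auto simp: Z_def)
      then have "H u (m + i) = h u i"
        using True i g(2) h by (auto simp: H_def odd_nonvanishing_def)
      then show ?thesis using i by metis
    qed
  qed (auto simp: H_def F field_simps)
  then show ?thesis using genus_leI enat by (metis plus_enat_simps(1))
qed auto

text \<open>If no single compact set reached \<open>Suc j\<close>, the supremum would be at most
  \<open>j\<close>; this covers an infinite supremum as well. For \<open>k = 0\<close> the empty set
  serves.\<close>

lemma cone_genusE:
  assumes "enat k \<le> cone_genus K"
  obtains M where "compact M" "symmetric_set M" "M \<subseteq> K" "enat k \<le> genus M"
proof (cases k)
  case 0
  then show ?thesis using that[of "{}"] by (simp add: symmetric_set_def zero_enat_def[symmetric])
next
  case (Suc j)
  have "\<exists>M. compact M \<and> symmetric_set M \<and> M \<subseteq> K \<and> enat k \<le> genus M"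
  proof (rule ccontr)
    assume neg: "\<not> ?thesis"
    have "cone_genus K \<le> enat j"
      unfolding cone_genus_def
    proof (rule Sup_least, safe)
      fix i M assume *: "compact M" "symmetric_set M" "M \<subseteq> K" "enat i \<le> genus M"
      then have "\<not> enat k \<le> genus M" using neg by blast
      then have "\<not> k \<le> i" using *(4) by (meson enat_ord_simps(1) order_trans)
      then show "enat i \<le> enat j" using Suc by simp
    qed
    then show False using assms Suc by (meson Suc_n_not_le_n enat_ord_simps(1) order_trans)
  qed
  then show ?thesis using that by blast
qed

section \<open>Ekeland's variational principle\<close>

text \<open>\<open>d\<close> is only a pseudo-metric, and completeness and lower semicontinuity are
  demanded together and only along Cauchy sequences with decreasing values. That is what a space of
  maps into an open cone can offer: limits stay in the cone as long as the functional stays bounded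
  above.\<close>

lemma ekeland_variational_principle:
  fixes F :: "'b \<Rightarrow> real" and d :: "'b \<Rightarrow> 'b \<Rightarrow> real"
  assumes x0: "x0 \<in> H" and \<sigma>: "0 < \<sigma>"
    and d_nonneg: "\<And>x y. x \<in> H \<Longrightarrow> y \<in> H \<Longrightarrow> 0 \<le> d x y" and d_refl: "\<And>x. x \<in> H \<Longrightarrow> d x x = 0"
    and d_sym: "\<And>x y. x \<in> H \<Longrightarrow> y \<in> H \<Longrightarrow> d x y = d y x"
    and d_tri: "\<And>x y z. x \<in> H \<Longrightarrow> y \<in> H \<Longrightarrow> z \<in> H \<Longrightarrow> d x z \<le> d x y + d y z"
    and bdd: "\<And>x. x \<in> H \<Longrightarrow> m \<le> F x"
    and complete_lsc: "\<And>xs b. range xs \<subseteq> H \<Longrightarrow> decseq (\<lambda>n. F (xs n)) \<Longrightarrow>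
        (\<And>e. e > 0 \<Longrightarrow> \<exists>n0. \<forall>i\<ge>n0. \<forall>j\<ge>n0. d (xs i) (xs j) < e) \<Longrightarrow>
        \<exists>l\<in>H. (\<lambda>n. d l (xs n)) \<longlonglongrightarrow> 0 \<and> (\<forall>n. F l \<le> F (xs n))"
  obtains x where "x \<in> H" "F x + \<sigma> * d x x0 \<le> F x0" "\<And>y. y \<in> H \<Longrightarrow> F x \<le> F y + \<sigma> * d y x"
proof -
  define R where "R x = {y \<in> H. F y + \<sigma> * d y x \<le> F x}" for x
  have R_refl: "x \<in> R x" if "x \<in> H" for x using that d_refl by (simp add: R_def)
  have R_trans: "z \<in> R x" if "y \<in> R x" "z \<in> R y" "x \<in> H" for x y z
  proof -
    have "\<sigma> * d z x \<le> \<sigma> * (d z y + d y x)"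
      using that d_tri \<sigma> by (intro mult_left_mono) (auto simp: R_def)
    then show ?thesis using that by (auto simp: R_def algebra_simps)
  qed
  have bddR: "bdd_below (F ` R x)" for x by (rule bdd_belowI[of _ m]) (auto simp: R_def bdd)
  \<comment> \<open>\<open>R x\<close> is the set below \<open>x\<close> in Ekeland's order. Each
    chosen successor at least halves the excess of \<open>F\<close> over its infimum on
    \<open>R x\<close>.\<close>
  have "\<exists>y\<in>R x. F y \<le> (F x + Inf (F ` R x)) / 2" if x: "x \<in> H" for x
  proof (cases "F x = Inf (F ` R x)")
    case True
    then show ?thesis using R_refl[OF x] by (intro bexI[of _ x]) auto
  next
    case False
    have "Inf (F ` R x) \<le> F x" using R_refl[OF x] bddR by (intro cInf_lower) auto
    then have "Inf (F ` R x) < (F x + Inf (F ` R x)) / 2" using False by simp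
    then have "\<exists>z\<in>F ` R x. z < (F x + Inf (F ` R x)) / 2"
      using R_refl[OF x] bddR by (subst (asm) cInf_less_iff) auto
    then show ?thesis by force
  qed
  then obtain g where g: "\<And>x. x \<in> H \<Longrightarrow> g x \<in> R x"
    "\<And>x. x \<in> H \<Longrightarrow> F (g x) \<le> (F x + Inf (F ` R x)) / 2" by metis
  define xs where "xs n = (g ^^ n) x0" for n
  have xs_Suc: "xs (Suc n) = g (xs n)" for n by (simp add: xs_def)
  have xsH: "xs n \<in> H" for n
  proof (induction n)
    case (Suc n) then show ?case using g(1)[of "xs n"] by (simp add: xs_Suc R_def)
  qed (simp add: xs_def x0)
  have step: "xs (n + i) \<in> R (xs n)" for n i
  proof (induction i)
    case (Suc i)
    then show ?case using R_trans g(1) xsH by (metis add_Suc_right xs_Suc)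
  qed (simp add: R_refl xsH)
  have stepF: "F (xs j) + \<sigma> * d (xs j) (xs i) \<le> F (xs i)" if "i \<le> j" for i j
    using step[of i "j - i"] that by (simp add: R_def)
  have dec: "decseq (\<lambda>n. F (xs n))"
  proof (rule decseq_SucI)
    fix n show "F (xs (Suc n)) \<le> F (xs n)"
      using stepF[of n "Suc n"] \<sigma> d_nonneg[OF xsH xsH, of "Suc n" n]
        mult_nonneg_nonneg[of \<sigma> "d (xs (Suc n)) (xs n)"] by linarith
  qed
  have "Bseq (\<lambda>n. F (xs n))"
    using decseq_bounded[OF dec, of m] bdd[OF xsH] by simp
  then obtain L where L: "(\<lambda>n. F (xs n)) \<longlonglongrightarrow> L"
    using dec Bseq_monoseq_convergent by (metis convergent_def decseq_imp_monoseq)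
  have cau: "\<exists>n0. \<forall>i\<ge>n0. \<forall>j\<ge>n0. d (xs i) (xs j) < e" if "e > 0" for e
  proof -
    have "\<sigma> * e > 0" using that \<sigma> by simp
    then obtain n0 where n0: "\<And>n. n \<ge> n0 \<Longrightarrow> F (xs n) < L + \<sigma> * e"
      using order_tendstoD(2)[OF L, of "L + \<sigma> * e"] by (auto simp: eventually_sequentially)
    have key: "d (xs j) (xs i) < e" if "i \<le> j" "i \<ge> n0" for i j
    proof -
      have "\<sigma> * d (xs j) (xs i) < \<sigma> * e"
        using stepF[OF that(1)] n0[OF that(2)] decseq_ge[OF dec L, of j] by linarith
      then show ?thesis using \<sigma> by simp
    qed
    show ?thesis
    proof (intro exI allI impI)
      fix i j assume "n0 \<le> i" "n0 \<le> j"
      then show "d (xs i) (xs j) < e"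
        using key[of i j] key[of j i] d_sym xsH by (cases "i \<le> j") auto
    qed
  qed
  obtain l where l: "l \<in> H" "(\<lambda>n. d l (xs n)) \<longlonglongrightarrow> 0" "\<And>n. F l \<le> F (xs n)"
    using complete_lsc[OF _ dec cau] xsH by blast
  have lR: "l \<in> R (xs n)" for n
  proof -
    have "F l + \<sigma> * d l (xs n) \<le> F (xs n)"
    proof (rule LIMSEQ_le_const2)
      show "(\<lambda>j. F l + \<sigma> * (d l (xs n) - d l (xs j))) \<longlonglongrightarrow> F l + \<sigma> * d l (xs n)"
        by (rule tendsto_eq_intros l refl | simp)+
      show "\<exists>k. \<forall>j\<ge>k. F l + \<sigma> * (d l (xs n) - d l (xs j)) \<le> F (xs n)"
      proof (intro exI[of _ n] allI impI)
        fix j assume "n \<le> j"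
        have "d l (xs n) - d l (xs j) \<le> d (xs j) (xs n)" using d_tri[of l "xs j" "xs n"] l xsH by simp
        then have "\<sigma> * (d l (xs n) - d l (xs j)) \<le> \<sigma> * d (xs j) (xs n)" using \<sigma> by simp
        then show "F l + \<sigma> * (d l (xs n) - d l (xs j)) \<le> F (xs n)"
          using stepF[OF \<open>n \<le> j\<close>] l(3)[of j] by linarith
      qed
    qed
    then show ?thesis using l by (simp add: R_def)
  qed
  show ?thesis
  proof (rule that)
    show "l \<in> H" by fact
    show "F l + \<sigma> * d l x0 \<le> F x0" using lR[of 0] by (simp add: R_def xs_def)
    fix y assume y: "y \<in> H"
    show "F l \<le> F y + \<sigma> * d y l"
    proof (rule ccontr)
      assume "\<not> ?thesis"
      then have yl: "y \<in> R l" "F y + \<sigma> * d y l < F l" using y by (auto simp: R_def)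
      \<comment> \<open>By transitivity \<open>y\<close> lies below every iterate, so the halving
        rule bounds \<open>F y\<close> from below. In the limit \<open>F y\<close> is at least
        \<open>L\<close>, hence at least \<open>F l\<close>, which contradicts the strict descent in
        \<open>yl\<close>.\<close>
      have "2 * F (xs (Suc n)) - F (xs n) \<le> F y" for n
      proof -
        have "y \<in> R (xs n)" using R_trans[OF lR yl(1) xsH] .
        then have "Inf (F ` R (xs n)) \<le> F y" using bddR by (intro cInf_lower) auto
        then show ?thesis using g(2)[OF xsH[of n]] by (simp add: xs_Suc)
      qed
      moreover have "(\<lambda>n. 2 * F (xs (Suc n)) - F (xs n)) \<longlonglongrightarrow> 2 * L - L"
        by (intro tendsto_intros LIMSEQ_Suc L)
      ultimately have "L \<le> F y" by (intro LIMSEQ_le_const2[of _ L]) auto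
      moreover have "F l \<le> L" using L l(3) by (intro LIMSEQ_le_const[of _ L]) auto
      moreover have "0 \<le> \<sigma> * d y l" using \<sigma> d_nonneg y l by simp
      ultimately show False using yl(2) by linarith
    qed
  qed
qed

section \<open>Genus minimax values\<close>

definition genus_family :: "'a::real_normed_vector set \<Rightarrow> nat \<Rightarrow> 'a set set" where
  "genus_family K k =
     {M. compact M \<and> symmetric_set M \<and> M \<subseteq> K \<inter> sphere 0 1 \<and> enat k \<le> genus M}"

text \<open>With real-valued \<open>Inf\<close> and \<open>Sup\<close> this is meaningful only for a
  nonempty family, \<open>J\<close> bounded below on the unit vectors of \<open>K\<close>, and
  \<open>k \<ge> 1\<close>: for \<open>k = 0\<close> the empty set is admissible and
  \<open>Sup {}\<close> carries no information.\<close>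

definition minimax :: "('a::real_normed_vector \<Rightarrow> real) \<Rightarrow> 'a set \<Rightarrow> nat \<Rightarrow> real" where
  "minimax J K k = Inf ((\<lambda>M. Sup (J ` M)) ` genus_family K k)"

lemma genus_family_antimono: "k \<le> k' \<Longrightarrow> genus_family K k' \<subseteq> genus_family K k"
  unfolding genus_family_def by (auto intro: order_trans[of "enat k" "enat k'"])

lemma genus_family_mono: "K \<subseteq> K' \<Longrightarrow> genus_family K k \<subseteq> genus_family K' k"
  unfolding genus_family_def by auto

lemma genus_family_not_empty: "M \<in> genus_family K k \<Longrightarrow> 1 \<le> k \<Longrightarrow> M \<noteq> {}"
  unfolding genus_family_def by (auto simp: zero_enat_def)

text \<open>The one stability property behind the minimax argument: any odd continuous map may act
  on an admissible set, whether or not it is a deformation of the identity.\<close>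

lemma genus_family_odd_image:
  assumes "compact M" "symmetric_set M" "enat k \<le> genus M"
    and "continuous_on M h" "\<And>u. u \<in> M \<Longrightarrow> h (- u) = - h u" "h ` M \<subseteq> K \<inter> sphere 0 1"
  shows "h ` M \<in> genus_family K k"
  unfolding genus_family_def
proof (intro CollectI conjI compact_continuous_image assms)
  show "symmetric_set (h ` M)"
    using assms(2,5) unfolding symmetric_set_def by (metis (no_types, opaque_lifting) image_iff)
  show "enat k \<le> genus (h ` M)"
    using assms(3) genus_image_ge[OF assms(4,5)] by (rule order_trans)
qed

text \<open>Radial projection \<open>sgn\<close> is odd and continuous off 0 and preserves the cone,
  so it carries a compact set of the cone to the unit sphere without lowering its genus.\<close>

lemma genus_family_nonempty:
  assumes "\<And>u t. u \<in> K \<Longrightarrow> 0 < t \<Longrightarrow> t *\<^sub>R u \<in> K" "0 \<notin> K" "enat k \<le> cone_genus K"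
  shows "genus_family K k \<noteq> {}"
proof -
  obtain M where M: "compact M" "symmetric_set M" "M \<subseteq> K" "enat k \<le> genus M"
    using cone_genusE[OF assms(3)] .
  have "sgn ` M \<in> genus_family K k"
  proof (rule genus_family_odd_image)
    have "0 \<notin> M" using M assms by auto
    then show "continuous_on M sgn" by (auto intro!: continuous_intros)
    show "sgn ` M \<subseteq> K \<inter> sphere 0 1"
    proof safe
      fix u assume "u \<in> M"
      then have "u \<in> K" "u \<noteq> 0" using M assms by auto
      then show "sgn u \<in> K" "sgn u \<in> sphere 0 1"
        using assms(1)[of u "inverse (norm u)"] by (auto simp: sgn_div_norm norm_sgn)
    qed
  qed (use M in \<open>auto simp: sgn_minus\<close>)
  then show ?thesis by auto
qed

lemma genus_family_attains_Sup:
  fixes J :: "'a::real_normed_vector \<Rightarrow> real"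
  assumes "M \<in> genus_family K k" "1 \<le> k" "continuous_on K J"
  shows "\<exists>u\<in>M. J u = Sup (J ` M)" and "\<And>u. u \<in> M \<Longrightarrow> J u \<le> Sup (J ` M)"
proof -
  have M: "compact M" "M \<noteq> {}" "M \<subseteq> K"
    using assms genus_family_not_empty[OF assms(1,2)] by (auto simp: genus_family_def)
  then obtain u where u: "u \<in> M" "\<And>v. v \<in> M \<Longrightarrow> J v \<le> J u"
    using continuous_attains_sup[of M J] continuous_on_subset[OF assms(3)] by auto
  then have "J u = Sup (J ` M)" by (intro cSup_eq_maximum[symmetric]) auto
  then show "\<exists>u\<in>M. J u = Sup (J ` M)" "\<And>u. u \<in> M \<Longrightarrow> J u \<le> Sup (J ` M)" using u by auto
qed

section \<open>Elementary bounds for minimax values\<close>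

lemma minimax_le:
  assumes "M \<in> genus_family K k" "1 \<le> k" "continuous_on K J" "bdd_below (J ` (K \<inter> sphere 0 1))"
  shows "minimax J K k \<le> Sup (J ` M)"
  unfolding minimax_def
proof (rule cInf_lower)
  obtain m where m: "\<And>u. u \<in> K \<inter> sphere 0 1 \<Longrightarrow> m \<le> J u"
    using assms(4) unfolding bdd_below_def by blast
  show "bdd_below ((\<lambda>M. Sup (J ` M)) ` genus_family K k)"
  proof (rule bdd_belowI)
    fix x assume "x \<in> (\<lambda>M. Sup (J ` M)) ` genus_family K k"
    then obtain M where M: "M \<in> genus_family K k" "x = Sup (J ` M)" by auto
    then obtain u where "u \<in> M" "J u = x" using genus_family_attains_Sup(1) assms by metis
    moreover have "u \<in> K \<inter> sphere 0 1" using M \<open>u \<in> M\<close> by (auto simp: genus_family_def)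
    ultimately show "m \<le> x" using m by blast
  qed
qed (use assms in auto)

lemma minimax_less:
  assumes "genus_family K k \<noteq> {}" "1 \<le> k" "continuous_on K J" "minimax J K k < b"
  obtains M where "M \<in> genus_family K k" "\<And>u. u \<in> M \<Longrightarrow> J u < b"
proof -
  obtain M where M: "M \<in> genus_family K k" "Sup (J ` M) < b"
    using cInf_lessD[of "(\<lambda>M. Sup (J ` M)) ` genus_family K k" b] assms unfolding minimax_def by auto
  show ?thesis using that[OF M(1)] genus_family_attains_Sup(2)[OF M(1) assms(2,3)] M(2)
    by (meson order_le_less_trans)
qed

lemma minimax_greatest:
  assumes "genus_family K k \<noteq> {}" "1 \<le> k" "continuous_on K J"
    and "\<And>M. M \<in> genus_family K k \<Longrightarrow> \<exists>u\<in>M. b \<le> J u"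
  shows "b \<le> minimax J K k"
  using minimax_less[OF assms(1-3)] assms(4) by (metis linorder_not_less)

lemma minimax_upper:
  assumes "M \<in> genus_family K k" "1 \<le> k" "continuous_on K J" "bdd_below (J ` (K \<inter> sphere 0 1))"
    and "\<And>u. u \<in> M \<Longrightarrow> J u \<le> b"
  shows "minimax J K k \<le> b"
proof -
  obtain u where "u \<in> M" "J u = Sup (J ` M)" using genus_family_attains_Sup(1)[OF assms(1-3)] by auto
  then show ?thesis using minimax_le[OF assms(1-4)] assms(5) by fastforce
qed

text \<open>Each coordinate is a bump of radius \<open>norm p\<close> around \<open>p\<close> minus
  its mirror image. The balls of that radius around \<open>p\<close> and \<open>- p\<close> are
  disjoint, so the difference is positive on the first ball; finitely many balls cover
  \<open>Z\<close>. The map is defined on the whole space, which makes its zero set available as a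
  replacement for the complement of a neighbourhood of \<open>Z\<close>.\<close>

lemma odd_map_separating_compact:
  fixes Z :: "'a::real_normed_vector set"
  assumes "compact Z" "0 \<notin> Z"
  obtains m and F :: "'a \<Rightarrow> nat \<Rightarrow> real"
  where "\<And>i. continuous_on UNIV (\<lambda>u. F u i)" "\<And>u i. F (- u) i = - F u i"
    "\<And>u i. i \<ge> m \<Longrightarrow> F u i = 0" "\<And>u. u \<in> Z \<Longrightarrow> \<exists>i. F u i \<noteq> 0"
proof -
  have "Z \<subseteq> (\<Union>p\<in>Z. ball p (norm p))" using assms by force
  then obtain D where D: "D \<subseteq> Z" "finite D" "Z \<subseteq> (\<Union>p\<in>D. ball p (norm p))"
    using compactE_image[OF assms(1), of Z "\<lambda>p. ball p (norm p)"] by auto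
  obtain m :: nat and p where p: "D = p ` {i. i < m}"
    using finite_imp_nat_seg_image_inj_on[OF D(2)] by auto
  define F where "F u i = (if i < m then max 0 (norm (p i) - dist u (p i)) -
    max 0 (norm (p i) - dist (- u) (p i)) else 0)" for u i
  show ?thesis
  proof (rule that[of F m])
    show "continuous_on UNIV (\<lambda>u. F u i)" for i
      by (cases "i < m") (simp_all add: F_def, intro continuous_intros)
    fix u assume "u \<in> Z"
    then obtain i where i: "i < m" "dist (p i) u < norm (p i)" using D(3) p by auto
    have "norm (2 *\<^sub>R p i) \<le> dist u (p i) + dist (- u) (p i)"
      unfolding dist_norm by (rule order_trans[OF _ norm_triangle_ineq]) (simp add: scaleR_2 norm_minus_commute)
    then have "F u i > 0" using i by (simp add: F_def dist_commute)
    then show "\<exists>i. F u i \<noteq> 0" by (intro exI[of _ i]) simp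
  qed (auto simp: F_def)
qed

text \<open>\<open>sublevel_closed\<close> says that the boundary of the open cone is invisible at
  bounded levels. The condition \<open>palais_smale\<close> uses the full derivative rather than a
  tangential one; by invariance under scaling \<open>J' u u = 0\<close>, so no multiplier for the
  constraint \<open>norm u = 1\<close> arises.\<close>

locale even_cone_functional =
  fixes K :: "'a::banach set" and J :: "'a \<Rightarrow> real" and J' :: "'a \<Rightarrow> 'a \<Rightarrow>\<^sub>L real"
  assumes open_K: "open K" and zero_notin: "0 \<notin> K"
    and scale_K: "u \<in> K \<Longrightarrow> 0 < t \<Longrightarrow> t *\<^sub>R u \<in> K" and neg_K: "u \<in> K \<Longrightarrow> - u \<in> K"
    and J_scale: "u \<in> K \<Longrightarrow> 0 < t \<Longrightarrow> J (t *\<^sub>R u) = J u" and J_even: "u \<in> K \<Longrightarrow> J (- u) = J u"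
    and J_deriv: "u \<in> K \<Longrightarrow> (J has_derivative blinfun_apply (J' u)) (at u)"
    and J'_cont: "continuous_on K J'"
    and J_lower: "bdd_below (J ` (K \<inter> sphere 0 1))"
    and sublevel_closed: "range us \<subseteq> K \<inter> sphere 0 1 \<Longrightarrow> us \<longlonglongrightarrow> u \<Longrightarrow> (\<And>n. J (us n) \<le> b) \<Longrightarrow> u \<in> K"
    and palais_smale: "range us \<subseteq> K \<inter> sphere 0 1 \<Longrightarrow> bounded (range (\<lambda>n. J (us n))) \<Longrightarrow>
       (\<lambda>n. J' (us n)) \<longlonglongrightarrow> 0 \<Longrightarrow> \<exists>r :: nat \<Rightarrow> nat. strict_mono r \<and> convergent (us \<circ> r)"
begin

section \<open>Critical points of an even scale-invariant functional on a symmetric cone\<close>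

lemma J_cont: "continuous_on K J"
  using J_deriv has_derivative_continuous by (blast intro: continuous_at_imp_continuous_on)

lemma J_tendsto: "us \<longlonglongrightarrow> u \<Longrightarrow> u \<in> K \<Longrightarrow> (\<lambda>n. J (us n)) \<longlonglongrightarrow> J u"
  using J_cont open_K isCont_tendsto_compose[of u J us] by (auto simp: continuous_on_eq_continuous_at)

lemma J'_tendsto: "us \<longlonglongrightarrow> u \<Longrightarrow> u \<in> K \<Longrightarrow> (\<lambda>n. J' (us n)) \<longlonglongrightarrow> J' u"
  using J'_cont open_K isCont_tendsto_compose[of u J' us] by (auto simp: continuous_on_eq_continuous_at)

lemma J'_odd:
  assumes u: "u \<in> K" shows "J' (- u) = - J' u"
proof -
  have "((\<lambda>x. J (- x)) has_derivative (\<lambda>x. J' (- u) (- x))) (at u)"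
    using has_derivative_compose[of uminus uminus u UNIV J] J_deriv[OF neg_K[OF u]]
    by (auto intro: derivative_eq_intros)
  then have "(J has_derivative (\<lambda>x. J' (- u) (- x))) (at u)"
    by (rule has_derivative_transform_within_open[OF _ open_K u]) (simp add: J_even)
  then have "(\<lambda>x. J' (- u) (- x)) = blinfun_apply (J' u)"
    using J_deriv[OF u] has_derivative_unique by blast
  then have "J' (- u) (- x) = J' u x" for x by (rule fun_cong)
  from this[of "- x" for x] show ?thesis
    by (intro blinfun_eqI) (simp add: blinfun.minus_left blinfun.minus_right)
qed

lemma sgn_K: "u \<in> K \<Longrightarrow> sgn u \<in> K \<inter> sphere 0 1"
  using scale_K[of u "inverse (norm u)"] zero_notin
  by (cases "u = 0") (auto simp: sgn_div_norm)

lemma J_sgn: "u \<in> K \<Longrightarrow> J (sgn u) = J u"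
  using J_scale[of u "inverse (norm u)"] zero_notin by (cases "u = 0") (auto simp: sgn_div_norm)

text \<open>Convergent values are bounded, so \<open>palais_smale\<close> gives a limit point and
  \<open>sublevel_closed\<close> keeps it inside the cone, where \<open>J\<close> and
  \<open>J'\<close> are continuous.\<close>

lemma critical_limit:
  assumes us: "range us \<subseteq> K \<inter> sphere 0 1" and J: "(\<lambda>n. J (us n)) \<longlonglongrightarrow> l"
    and J': "(\<lambda>n. J' (us n)) \<longlonglongrightarrow> 0"
  obtains u and r :: "nat \<Rightarrow> nat"
  where "strict_mono r" "(us \<circ> r) \<longlonglongrightarrow> u" "u \<in> K \<inter> sphere 0 1" "J u = l" "J' u = 0"
proof -
  have bdd: "bounded (range (\<lambda>n. J (us n)))" using convergent_imp_bounded[OF J] .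
  obtain r u where r: "strict_mono (r :: nat \<Rightarrow> nat)" "(us \<circ> r) \<longlonglongrightarrow> u"
    using palais_smale[OF us bdd J'] by (auto simp: convergent_def)
  obtain b where b: "\<And>n. J (us n) \<le> b" using bdd unfolding bounded_iff
    by (metis abs_le_D1 rangeI real_norm_def)
  have uK: "u \<in> K"
    by (rule sublevel_closed[OF _ r(2), of b]) (use us b in auto)
  have "norm u = 1"
  proof (rule LIMSEQ_unique)
    show "(\<lambda>n. norm ((us \<circ> r) n)) \<longlonglongrightarrow> norm u" by (intro tendsto_intros r)
    have "norm (us n) = 1" for n using us by (auto simp: image_subset_iff)
    then show "(\<lambda>n. norm ((us \<circ> r) n)) \<longlonglongrightarrow> 1" by simp
  qed
  moreover have "J u = l"
    using LIMSEQ_unique[OF J_tendsto[OF r(2) uK]] LIMSEQ_subseq_LIMSEQ[OF J r(1)] by (simp add: o_def)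
  moreover have "J' u = 0"
    using LIMSEQ_unique[OF J'_tendsto[OF r(2) uK]] LIMSEQ_subseq_LIMSEQ[OF J' r(1)] by (simp add: o_def)
  ultimately show ?thesis using that r uK by auto
qed

text \<open>Nearly norming vectors of \<open>J' p\<close> are glued by finitely many bumps.
  Subtracting the mirrored bump makes the field odd, and since \<open>J'\<close> is odd the mirrored
  terms pair with \<open>J' (- u)\<close>: they contribute only where \<open>- u\<close> lies in a
  ball on which the vector is good.\<close>

lemma odd_descent_field:
  assumes Z: "compact Z" "Z \<subseteq> K" and s: "0 \<le> s" "\<And>u. u \<in> Z \<Longrightarrow> s < norm (J' u)"
  obtains W where "continuous_on UNIV W" "\<And>u. W (- u) = - W u" "\<And>u. norm (W u) \<le> 1"
    "\<And>u. u \<in> Z \<Longrightarrow> s < J' u (W u)"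
proof (cases "Z = {}")
  case True
  then show ?thesis using that[of "\<lambda>_. 0"] by simp
next
  case False
  have "\<exists>w r. 0 < r \<and> norm w \<le> 1 \<and> ball p r \<subseteq> K \<and> (\<forall>u\<in>ball p r. s < J' u w)" if p: "p \<in> Z" for p
  proof -
    obtain x where x: "s * norm x < norm (J' p x)"
      using norm_blinfun_bound[of s "J' p"] s(1) s(2)[OF p] by (meson linorder_not_less)
    then have x0: "x \<noteq> 0" by auto
    define w where "w = (sgn (J' p x) / norm x) *\<^sub>R x"
    have nw: "norm w \<le> 1" using x0 by (simp add: w_def abs_sgn_eq)
    have "J' p w = \<bar>J' p x\<bar> / norm x"
      by (simp add: w_def blinfun.scaleR_right sgn_mult_self_eq abs_sgn[symmetric] mult.commute)
    then have w: "s < J' p w" using x x0 by (simp add: less_divide_eq)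
    have "isCont J' p" using J'_cont open_K p Z by (auto simp: continuous_on_eq_continuous_at)
    then have "isCont (\<lambda>u. J' u w) p" by (intro continuous_intros)
    then have "\<forall>\<^sub>F u in nhds p. s < J' u w"
      using w order_tendstoD(1)[of "\<lambda>u. J' u w" "J' p w" "nhds p" s]
        tendsto_at_iff_tendsto_nhds[of "\<lambda>u. J' u w" p]
      unfolding isCont_def by blast
    moreover have "\<forall>\<^sub>F u in nhds p. u \<in> K"
      using open_K p Z eventually_nhds_in_open by blast
    ultimately have "\<forall>\<^sub>F u in nhds p. s < J' u w \<and> u \<in> K" by eventually_elim simp
    then obtain r where r: "0 < r" "\<And>u. dist u p < r \<Longrightarrow> s < J' u w \<and> u \<in> K"
      unfolding eventually_nhds_metric by auto
    show ?thesis
      by (rule exI[of _ w], rule exI[of _ r]) (use r nw in \<open>auto simp: dist_commute\<close>)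
  qed
  then obtain w r where wr: "\<And>p. p \<in> Z \<Longrightarrow> 0 < r p" "\<And>p. p \<in> Z \<Longrightarrow> norm (w p) \<le> 1"
    "\<And>p. p \<in> Z \<Longrightarrow> ball p (r p) \<subseteq> K" "\<And>p u. p \<in> Z \<Longrightarrow> u \<in> ball p (r p) \<Longrightarrow> s < J' u (w p)"
    by metis
  have "Z \<subseteq> (\<Union>p\<in>Z. ball p (r p))" using wr(1) by force
  then obtain D where D: "D \<subseteq> Z" "finite D" "Z \<subseteq> (\<Union>p\<in>D. ball p (r p))"
    using compactE_image[OF Z(1), of Z "\<lambda>p. ball p (r p)"] by auto
  define \<phi> where "\<phi> p u = max 0 (r p - dist p u)" for p u
  define \<psi> where "\<psi> u = (\<Sum>p\<in>D. \<phi> p u + \<phi> p (- u))" for u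
  define W0 where "W0 u = (\<Sum>p\<in>D. (\<phi> p u - \<phi> p (- u)) *\<^sub>R w p)" for u
  have \<phi>: "0 \<le> \<phi> p u" for p u by (simp add: \<phi>_def)
  have \<phi>_cont: "continuous_on UNIV (\<phi> p)" "continuous_on UNIV (\<lambda>u. \<phi> p (- u))" for p
    by (auto simp: \<phi>_def intro!: continuous_intros)
  have \<psi>_cont: "continuous_on UNIV \<psi>" unfolding \<psi>_def by (intro continuous_intros \<phi>_cont)
  have \<psi>_pos: "0 < \<psi> u" if u: "u \<in> Z" for u
  proof -
    obtain p where p: "p \<in> D" "dist p u < r p" using D(3) u by auto
    then have "0 < \<phi> p u + \<phi> p (- u)" using \<phi>[of p "- u"] by (simp add: \<phi>_def)
    then show ?thesis unfolding \<psi>_def using p D(2) by (intro sum_pos2[of _ p]) (auto simp: \<phi>)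
  qed
  obtain u0 where u0: "u0 \<in> Z" "\<And>u. u \<in> Z \<Longrightarrow> \<psi> u0 \<le> \<psi> u"
    using continuous_attains_inf[OF Z(1) False, of \<psi>] continuous_on_subset[OF \<psi>_cont] by auto
  define \<mu> where "\<mu> = \<psi> u0"
  have \<mu>: "0 < \<mu>" "\<And>u. u \<in> Z \<Longrightarrow> \<mu> \<le> \<psi> u" using u0 \<psi>_pos by (auto simp: \<mu>_def)
  have normW0: "norm (W0 u) \<le> \<psi> u" for u
    unfolding W0_def \<psi>_def
  proof (rule sum_norm_le)
    fix p assume pD: "p \<in> D"
    have "norm (w p) \<le> 1" using wr(2)[of p] D(1) pD by blast
    moreover have "\<bar>\<phi> p u - \<phi> p (- u)\<bar> \<le> \<phi> p u + \<phi> p (- u)" using \<phi>[of p u] \<phi>[of p "- u"] by linarith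
    ultimately show "norm ((\<phi> p u - \<phi> p (- u)) *\<^sub>R w p) \<le> \<phi> p u + \<phi> p (- u)"
      using mult_mono[of "\<bar>\<phi> p u - \<phi> p (- u)\<bar>" "\<phi> p u + \<phi> p (- u)" "norm (w p)" 1] \<phi>[of p u] \<phi>[of p "- u"]
      by simp
  qed
  have descent: "s * \<psi> u < J' u (W0 u)" if u: "u \<in> Z" for u
  proof -
    have uK: "u \<in> K" using u Z by auto
    \<comment> \<open>Outside its ball the bump vanishes, so the inequality holds at every point
      \<open>v\<close>, in particular at both \<open>u\<close> and \<open>- u\<close>.\<close>
    have a: "s * \<phi> p v \<le> \<phi> p v * J' v (w p)" if "p \<in> D" for p v
    proof (cases "dist p v < r p")
      case True
      then have "s < J' v (w p)" using wr(4)[of p v] that D(1) by auto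
      then show ?thesis using \<phi>[of p v] by (subst mult.commute) (simp add: mult_left_mono)
    qed (simp add: \<phi>_def)
    have "J' u (W0 u) = (\<Sum>p\<in>D. \<phi> p u * J' u (w p) + \<phi> p (- u) * J' (- u) (w p))"
      unfolding W0_def J'_odd[OF uK] blinfun.sum_right blinfun.scaleR_right blinfun.minus_left
      by (intro sum.cong refl) (simp add: left_diff_distrib)
    moreover have "s * \<psi> u < \<dots>"
      unfolding \<psi>_def sum_distrib_left
    proof (rule sum_strict_mono_ex1[OF D(2)])
      show "\<forall>p\<in>D. s * (\<phi> p u + \<phi> p (- u)) \<le> \<phi> p u * J' u (w p) + \<phi> p (- u) * J' (- u) (w p)"
        unfolding distrib_left by (intro ballI add_mono a)
      obtain p where p: "p \<in> D" "dist p u < r p" using D(3) u by auto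
      then have "s < J' u (w p)" "0 < \<phi> p u" using wr(4)[of p u] D(1) by (auto simp: \<phi>_def)
      then have "s * \<phi> p u < \<phi> p u * J' u (w p)" by (simp add: mult.commute)
      then show "\<exists>p\<in>D. s * (\<phi> p u + \<phi> p (- u)) < \<phi> p u * J' u (w p) + \<phi> p (- u) * J' (- u) (w p)"
        unfolding distrib_left by (intro bexI[OF _ p(1)] add_less_le_mono a p)
    qed
    ultimately show ?thesis by simp
  qed
  \<comment> \<open>The normalising sum \<open>\<psi>\<close> may vanish away from \<open>Z\<close>.
    Replacing it by \<open>max (\<psi> u) \<mu>\<close> keeps the field continuous everywhere and
    changes nothing on \<open>Z\<close>, where \<open>\<psi>\<close> is at least
    \<open>\<mu>\<close>.\<close>
  define W where "W u = W0 u /\<^sub>R max (\<psi> u) \<mu>" for u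
  have max_pos: "0 < max (\<psi> u) \<mu>" for u using \<mu> by simp
  show ?thesis
  proof
    show "continuous_on UNIV W"
      unfolding W_def W0_def using max_pos
      by (intro continuous_intros \<phi>_cont \<psi>_cont) (metis less_irrefl)
    have "\<psi> (- u) = \<psi> u" for u by (simp add: \<psi>_def add.commute)
    moreover have "W0 (- u) = - W0 u" for u
      by (simp add: W0_def sum_negf[symmetric] scaleR_left_diff_distrib)
    ultimately show "W (- u) = - W u" for u by (simp add: W_def)
    show "norm (W u) \<le> 1" for u
      using normW0[of u] max_pos[of u] by (simp add: W_def field_simps)
    show "s < J' u (W u)" if u: "u \<in> Z" for u
    proof -
      have "max (\<psi> u) \<mu> = \<psi> u" using \<mu> u by simp
      then show ?thesis using descent[OF u] \<psi>_pos[OF u] by (simp add: W_def blinfun.scaleR_right field_simps)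
    qed
  qed
qed


text \<open>The maps range over all odd continuous maps of the fixed set \<open>M\<close> into the
  cone's unit vectors, starting from the identity. The point \<open>v\<close> is the parameter with
  \<open>u = h v\<close>; Ekeland's bound on the distance of \<open>h\<close> from the identity
  keeps \<open>u\<close> close to \<open>M\<close> itself, which is what localises critical points
  in the proof of unboundedness.\<close>

lemma almost_critical_point:
  assumes M: "compact M" "symmetric_set M" "M \<noteq> {}" "M \<subseteq> K \<inter> sphere 0 1"
    and upper: "\<And>u. u \<in> M \<Longrightarrow> J u \<le> l + \<epsilon>"
    and lower: "\<And>h. continuous_on M h \<Longrightarrow> (\<And>u. u \<in> M \<Longrightarrow> h (- u) = - h u) \<Longrightarrow>
          h ` M \<subseteq> K \<inter> sphere 0 1 \<Longrightarrow> \<exists>u\<in>M. l \<le> J (h u)"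
    and \<sigma>: "0 < \<sigma>"
  obtains u v where "u \<in> K \<inter> sphere 0 1" "v \<in> M" "l \<le> J u" "J u \<le> l + \<epsilon>"
    "norm (J' u) \<le> 2 * \<sigma>" "\<sigma> * dist u v \<le> \<epsilon>"
proof -
  \<comment> \<open>Members of \<open>H\<close> are functions on the whole space but are constrained
    and compared only on \<open>M\<close>, hence the pseudo-metric.\<close>
  define H where "H = {h. continuous_on M h \<and> (\<forall>u\<in>M. h (- u) = - h u) \<and> h ` M \<subseteq> K \<inter> sphere 0 1}"
  define F where "F h = Sup ((\<lambda>u. J (h u)) ` M)" for h
  define d where "d h g = Sup ((\<lambda>u. norm (h u - g u)) ` M)" for h g :: "'a \<Rightarrow> 'a"
  have cont_Jh: "continuous_on M (\<lambda>u. J (h u))" if "h \<in> H" for h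
    using that J_cont unfolding H_def by (auto intro!: continuous_on_compose2[of K J M h])
  have F_att: "\<exists>u\<in>M. J (h u) = F h" and F_ge: "\<And>u. u \<in> M \<Longrightarrow> J (h u) \<le> F h" if h: "h \<in> H" for h
  proof -
    obtain u where u: "u \<in> M" "\<And>v. v \<in> M \<Longrightarrow> J (h v) \<le> J (h u)"
      using continuous_attains_sup[OF M(1,3) cont_Jh[OF h]] by auto
    then have "J (h u) = F h" unfolding F_def by (intro cSup_eq_maximum[symmetric]) auto
    then show "\<exists>u\<in>M. J (h u) = F h" "\<And>u. u \<in> M \<Longrightarrow> J (h u) \<le> F h" using u by auto
  qed
  have F_le: "F h \<le> b" if "\<And>u. u \<in> M \<Longrightarrow> J (h u) \<le> b" for h b
    unfolding F_def using that M(3) by (intro cSUP_least) auto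
  have d_ge: "norm (h u - g u) \<le> d h g" if "h \<in> H" "g \<in> H" "u \<in> M" for h g u
  proof -
    have "continuous_on M (\<lambda>u. norm (h u - g u))"
      using that by (intro continuous_intros) (auto simp: H_def)
    then have "bdd_above ((\<lambda>u. norm (h u - g u)) ` M)"
      using M(1) by (simp add: bounded_imp_bdd_above compact_continuous_image compact_imp_bounded)
    then show ?thesis unfolding d_def using that by (intro cSUP_upper)
  qed
  have d_le: "d h g \<le> b" if "\<And>u. u \<in> M \<Longrightarrow> norm (h u - g u) \<le> b" for h g b
    unfolding d_def using that M(3) by (intro cSUP_least) auto
  obtain u0 where u0: "u0 \<in> M" using M(3) by auto
  have idH: "id \<in> H" using M(4) by (auto simp: H_def)
  have lF: "l \<le> F h" if "h \<in> H" for h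
    using lower[of h] F_ge[OF that] that unfolding H_def by (auto intro: order_trans)
  obtain h where h: "h \<in> H" "F h + \<sigma> * d h id \<le> F id" "\<And>g. g \<in> H \<Longrightarrow> F h \<le> F g + \<sigma> * d g h"
  proof (rule ekeland_variational_principle[of id H \<sigma> d l F, OF idH \<sigma>])
    show "0 \<le> d x y" if "x \<in> H" "y \<in> H" for x y
      using d_ge[OF that u0] by (meson norm_ge_zero order_trans)
    show "d x x = 0" for x unfolding d_def using M(3) by simp
    show "d x y = d y x" for x y by (simp add: d_def norm_minus_commute)
    show "d x z \<le> d x y + d y z" if "x \<in> H" "y \<in> H" "z \<in> H" for x y z
    proof (rule d_le)
      fix u assume "u \<in> M"
      then show "norm (x u - z u) \<le> d x y + d y z"
        using d_ge[OF that(1,2)] d_ge[OF that(2,3)] norm_triangle_ineq[of "x u - y u" "y u - z u"]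
        by (force intro: order_trans)
    qed
    show "l \<le> F x" if "x \<in> H" for x using lF that .
  next
    fix xs and b :: real
    assume xs: "range xs \<subseteq> H" and dec: "decseq (\<lambda>n. F (xs n))"
      and cau: "\<And>e. e > 0 \<Longrightarrow> \<exists>n0. \<forall>i\<ge>n0. \<forall>j\<ge>n0. d (xs i) (xs j) < e"
    have xsH: "xs n \<in> H" for n using xs by auto
    have "uniformly_Cauchy_on M xs"
      unfolding uniformly_Cauchy_on_def
    proof (intro allI impI)
      fix e :: real assume "e > 0"
      then obtain n0 where "\<forall>i\<ge>n0. \<forall>j\<ge>n0. d (xs i) (xs j) < e" using cau by blast
      then show "\<exists>N. \<forall>x\<in>M. \<forall>m\<ge>N. \<forall>n\<ge>N. dist (xs m x) (xs n x) < e"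
        using d_ge[OF xsH xsH] unfolding dist_norm by (meson order_le_less_trans)
    qed
    then obtain g where g: "uniform_limit M xs g sequentially"
      using Cauchy_uniformly_convergent uniformly_convergent_on_def by blast
    have pt: "(\<lambda>n. xs n u) \<longlonglongrightarrow> g u" if "u \<in> M" for u
      using tendsto_uniform_limitI[OF g that] .
    \<comment> \<open>A uniform limit could touch the boundary of the cone. The decreasing values
      bound \<open>J\<close> along the sequence, so \<open>sublevel_closed\<close> applies.\<close>
    have gK: "g u \<in> K" if u: "u \<in> M" for u
    proof (rule sublevel_closed[OF _ pt[OF u]])
      show "range (\<lambda>n. xs n u) \<subseteq> K \<inter> sphere 0 1" using xsH u by (auto simp: H_def)
      show "J (xs n u) \<le> F (xs 0)" for n
        using F_ge[OF xsH u, of n] decseqD[OF dec, of 0 n] by simp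
    qed
    have gH: "g \<in> H"
      unfolding H_def
    proof (intro CollectI conjI ballI subsetI)
      show "continuous_on M g"
        by (rule uniform_limit_theorem[OF _ g]) (use xsH in \<open>auto simp: H_def\<close>)
      fix u assume u: "u \<in> M"
      then have "- u \<in> M" using M(2) by (auto simp: symmetric_set_def)
      then have "(\<lambda>n. xs n (- u)) \<longlonglongrightarrow> g (- u)" by (rule pt)
      moreover have "xs n (- u) = - xs n u" for n using xsH[of n] u by (auto simp: H_def)
      ultimately have "(\<lambda>n. - xs n u) \<longlonglongrightarrow> g (- u)" by simp
      then show "g (- u) = - g u" using tendsto_minus[OF pt[OF u]] LIMSEQ_unique by blast
    next
      fix v assume "v \<in> g ` M"
      then obtain u where u: "u \<in> M" "v = g u" by auto
      have "norm (xs n u) = 1" for n using xsH[of n] u by (auto simp: H_def image_subset_iff)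
      then have "norm v = 1" using tendsto_norm[OF pt[OF u(1)]] u(2) by (simp add: LIMSEQ_const_iff)
      then show "v \<in> K \<inter> sphere 0 1" using gK u by auto
    qed
    show "\<exists>l\<in>H. (\<lambda>n. d l (xs n)) \<longlonglongrightarrow> 0 \<and> (\<forall>n. F l \<le> F (xs n))"
    proof (intro bexI[OF _ gH] conjI allI)
      show "(\<lambda>n. d g (xs n)) \<longlonglongrightarrow> 0"
      proof (rule LIMSEQ_I)
        fix e :: real assume "0 < e"
        then have "\<forall>\<^sub>F n in sequentially. \<forall>u\<in>M. dist (xs n u) (g u) < e / 2"
          using uniform_limitD[OF g, of "e / 2"] by simp
        then obtain n0 where n0: "\<And>n u. n \<ge> n0 \<Longrightarrow> u \<in> M \<Longrightarrow> dist (xs n u) (g u) < e / 2"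
          unfolding eventually_sequentially by blast
        show "\<exists>no. \<forall>n\<ge>no. norm (d g (xs n) - 0) < e"
        proof (intro exI[of _ n0] allI impI)
          fix n assume n: "n \<ge> n0"
          have "d g (xs n) \<le> e / 2"
            using n0[OF n] by (intro d_le) (auto simp: dist_norm norm_minus_commute intro: less_imp_le)
          moreover have "0 \<le> d g (xs n)"
            using d_ge[OF gH xsH u0, of n] by (meson norm_ge_zero order_trans)
          ultimately show "norm (d g (xs n) - 0) < e" using \<open>0 < e\<close> by simp
        qed
      qed
      fix n show "F g \<le> F (xs n)"
      proof (rule F_le)
        fix u assume u: "u \<in> M"
        have "(\<lambda>i. J (xs i u)) \<longlonglongrightarrow> J (g u)" by (rule J_tendsto[OF pt[OF u] gK[OF u]])
        moreover have "J (xs i u) \<le> F (xs n)" if "i \<ge> n" for i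
          using F_ge[OF xsH u, of i] decseqD[OF dec that] by simp
        ultimately show "J (g u) \<le> F (xs n)" by (intro LIMSEQ_le_const2) auto
      qed
    qed
  next
    fix x assume x: "x \<in> H" "F x + \<sigma> * d x id \<le> F id" "\<And>y. y \<in> H \<Longrightarrow> F x \<le> F y + \<sigma> * d y x"
    show thesis by (rule that[OF x])
  qed
  define Q where "Q = h ` M"
  have hc: "continuous_on M h" and hodd: "\<And>u. u \<in> M \<Longrightarrow> h (- u) = - h u" and hQ: "Q \<subseteq> K \<inter> sphere 0 1"
    using h(1) by (auto simp: H_def Q_def)
  have cQ: "compact Q" unfolding Q_def using hc M(1) compact_continuous_image by blast
  have JQ: "J u \<le> F h" if "u \<in> Q" for u using F_ge[OF h(1)] that by (auto simp: Q_def)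
  \<comment> \<open>Only the points at the maximal level need to be moved down. A field that
    descends on this compact set alone is enough, since the other points of a maximising sequence
    are ruled out in the limit.\<close>
  define Z where "Z = {u \<in> Q. J u = F h}"
  have ZK: "Z \<subseteq> K" using hQ by (auto simp: Z_def)
  have "\<exists>u\<in>Z. norm (J' u) \<le> 2 * \<sigma>"
  proof (rule ccontr)
    assume "\<not> ?thesis"
    then have big: "\<And>u. u \<in> Z \<Longrightarrow> 2 * \<sigma> < norm (J' u)" by force
    have "continuous_on Q J" using continuous_on_subset[OF J_cont] hQ by blast
    then have "closedin (top_of_set Q) (Q \<inter> J -` {F h})" by (intro continuous_closedin_preimage) auto
    then have "compact (Q \<inter> J -` {F h})" using cQ closedin_compact by blast
    moreover have "Q \<inter> J -` {F h} = Z" by (auto simp: Z_def)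
    ultimately have cZ: "compact Z" by simp
    obtain W where W: "continuous_on UNIV W" "\<And>u. W (- u) = - W u" "\<And>u. norm (W u) \<le> 1"
      "\<And>u. u \<in> Z \<Longrightarrow> 2 * \<sigma> < J' u (W u)"
      using odd_descent_field[OF cZ ZK _ big] \<sigma> by auto
    obtain \<delta> where \<delta>: "0 < \<delta>" "(\<Union>u\<in>Q. cball u \<delta>) \<subseteq> K"
      using compact_subset_open_imp_cball_epsilon_subset[OF cQ open_K] hQ by auto
    \<comment> \<open>Step lengths tending to 0. The bound \<delta> keeps the segments inside the
      cone, and 1/2 keeps the moved unit vectors away from the origin before they are projected
      back.\<close>
    define s where "s n = min \<delta> (1 / 2) / real (Suc n)" for n
    have s: "0 < s n" "s n \<le> \<delta>" "s n \<le> 1 / 2" for n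
    proof -
      show "0 < s n" using \<delta> by (simp add: s_def)
      have "s n \<le> min \<delta> (1 / 2)"
        using \<delta> unfolding s_def by (subst divide_le_eq) (auto simp: mult_le_cancel_left1)
      then show "s n \<le> \<delta>" "s n \<le> 1 / 2" by auto
    qed
    have s0: "s \<longlonglongrightarrow> 0"
      unfolding s_def divide_inverse
      by (rule tendsto_eq_rhs[OF tendsto_mult[OF tendsto_const LIMSEQ_inverse_real_of_nat]]) simp
    have inK: "u - t *\<^sub>R W u \<in> K" if "u \<in> Q" "0 \<le> t" "t \<le> s n" for u t n
    proof -
      have "dist u (u - t *\<^sub>R W u) \<le> \<delta>"
        using that s(2)[of n] W(3)[of u] mult_mono[of t \<delta> "norm (W u)" 1] by (simp add: dist_norm)
      then have "u - t *\<^sub>R W u \<in> cball u \<delta>" unfolding mem_cball .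
      then show ?thesis using \<delta>(2) that(1) by blast
    qed
    define g where "g n x = sgn (h x - s n *\<^sub>R W (h x))" for n x
    have gH: "g n \<in> H" for n
      unfolding H_def
    proof (intro CollectI conjI ballI)
      have "h x - s n *\<^sub>R W (h x) \<in> K" if "x \<in> M" for x
        using inK[of "h x" "s n" n] s(1)[of n] that by (auto simp: Q_def)
      then show "g n ` M \<subseteq> K \<inter> sphere 0 1" unfolding g_def using sgn_K by blast
      have "h x - s n *\<^sub>R W (h x) \<noteq> 0" if "x \<in> M" for x
        using \<open>\<And>x. x \<in> M \<Longrightarrow> h x - s n *\<^sub>R W (h x) \<in> K\<close>[OF that] zero_notin by auto
      then show "continuous_on M (g n)"
        unfolding g_def by (intro continuous_intros hc continuous_on_compose2[OF W(1) hc]) auto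
      show "g n (- u) = - g n u" if "u \<in> M" for u
        using hodd[OF that] by (simp add: g_def W(2) sgn_minus[symmetric])
    qed
    \<comment> \<open>One \<open>s n\<close> is spent on the step and at most another on the
      projection to the sphere. This is the origin of the factor 2 in the threshold
      \<open>2 * \<sigma>\<close>.\<close>
    have dg: "d (g n) h \<le> 2 * s n" for n
    proof (rule d_le)
      fix x assume "x \<in> M"
      then have n1: "norm (h x) = 1" using hQ by (auto simp: Q_def)
      define v where "v = h x - s n *\<^sub>R W (h x)"
      have vh: "norm (v - h x) \<le> s n"
        using W(3)[of "h x"] s(1)[of n] mult_left_mono[of "norm (W (h x))" 1 "s n"] by (simp add: v_def)
      have "\<bar>norm v - 1\<bar> \<le> s n"
        using norm_triangle_ineq3[of v "h x"] vh n1 by simp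
      moreover have "norm (sgn v - v) = \<bar>norm v - 1\<bar>"
      proof (cases "v = 0")
        case True then show ?thesis using calculation s(3)[of n] by simp
      next
        case False
        have "sgn v - v = (1 / norm v - 1) *\<^sub>R v" by (simp add: sgn_div_norm scaleR_left_diff_distrib divide_inverse)
        also have "norm \<dots> = \<bar>(1 / norm v - 1) * norm v\<bar>" by (simp add: abs_mult)
        also have "(1 / norm v - 1) * norm v = 1 - norm v" using False by (simp add: field_simps)
        finally show ?thesis by simp
      qed
      ultimately show "norm (g n x - h x) \<le> 2 * s n"
        using vh norm_triangle_ineq[of "sgn v - v" "v - h x"] by (simp add: g_def v_def)
    qed
    have "\<exists>u\<in>Q. F h - 2 * \<sigma> * s n \<le> J (u - s n *\<^sub>R W u)" for n
    proof -
      obtain x where x: "x \<in> M" "J (g n x) = F (g n)" using F_att[OF gH] by auto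
      have "h x \<in> Q" using x by (auto simp: Q_def)
      then have "J (g n x) = J (h x - s n *\<^sub>R W (h x))"
        unfolding g_def using inK[of "h x" "s n" n] s(1)[of n] by (intro J_sgn) auto
      moreover have "F h \<le> F (g n) + \<sigma> * (2 * s n)"
        using h(3)[OF gH[of n]] dg[of n] \<sigma> by (smt (verit) mult_left_mono)
      ultimately show ?thesis using x \<open>h x \<in> Q\<close> by (intro bexI[of _ "h x"]) (auto simp: algebra_simps)
    qed
    then obtain us where us: "\<And>n. us n \<in> Q" "\<And>n. F h - 2 * \<sigma> * s n \<le> J (us n - s n *\<^sub>R W (us n))"
      by metis
    \<comment> \<open>By Ekeland the value after the step has dropped by at most
      \<open>2 * \<sigma> * s n\<close> from the maximum, so the mean value theorem finds a point on
      the segment with slope at most \<open>2 * \<sigma>\<close>.\<close>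
    have "\<exists>t. 0 < t \<and> t < s n \<and> J' (us n - t *\<^sub>R W (us n)) (W (us n)) \<le> 2 * \<sigma>" for n
    proof -
      let ?u = "us n" let ?w = "W (us n)"
      have der: "((\<lambda>t. J (?u - t *\<^sub>R ?w)) has_real_derivative - J' (?u - t *\<^sub>R ?w) ?w) (at t)"
        if "0 \<le> t" "t \<le> s n" for t
      proof -
        have "((\<lambda>t. J (?u - t *\<^sub>R ?w)) has_derivative (\<lambda>x. J' (?u - t *\<^sub>R ?w) (- (x *\<^sub>R ?w)))) (at t)"
          by (rule has_derivative_compose[of "\<lambda>t. ?u - t *\<^sub>R ?w" "\<lambda>x. - (x *\<^sub>R ?w)" t UNIV J,
                OF _ J_deriv[OF inK[OF us(1) that]]]) (auto intro!: derivative_eq_intros)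
        then show ?thesis
          unfolding has_field_derivative_def
          by (rule has_derivative_eq_rhs) (auto simp: fun_eq_iff blinfun.minus_right blinfun.scaleR_right)
      qed
      obtain t where t: "0 < t" "t < s n"
        "J (?u - s n *\<^sub>R ?w) - J (?u - 0 *\<^sub>R ?w) = (s n - 0) * - J' (?u - t *\<^sub>R ?w) ?w"
        using MVT2[OF s(1)[of n] der] by auto
      have "s n * J' (?u - t *\<^sub>R ?w) ?w \<le> s n * (2 * \<sigma>)"
        using t(3) us(2)[of n] JQ[OF us(1)[of n]] by (simp add: algebra_simps)
      then show ?thesis using t s(1)[of n] by (intro exI[of _ t]) simp
    qed
    then obtain t where t: "\<And>n. 0 < t n" "\<And>n. t n < s n"
      "\<And>n. J' (us n - t n *\<^sub>R W (us n)) (W (us n)) \<le> 2 * \<sigma>" by metis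
    obtain u r where ur: "u \<in> Q" "strict_mono r" "(us \<circ> r) \<longlonglongrightarrow> u"
      using cQ us(1) unfolding compact_def by blast
    have uK: "u \<in> K" using ur hQ by auto
    have t0: "t \<longlonglongrightarrow> 0"
      by (rule tendsto_sandwich[OF _ _ tendsto_const s0]) (use t in \<open>auto intro: always_eventually less_imp_le\<close>)
    have limW: "(\<lambda>n. W (us (r n))) \<longlonglongrightarrow> W u"
      using W(1) ur(3) by (auto simp: continuous_on_eq_continuous_at o_def intro: isCont_tendsto_compose[of u W])
    have lim: "(\<lambda>n. us (r n) - x (r n) *\<^sub>R W (us (r n))) \<longlonglongrightarrow> u" if "x \<longlonglongrightarrow> 0" for x
    proof -
      have "(\<lambda>n. us (r n) - x (r n) *\<^sub>R W (us (r n))) \<longlonglongrightarrow> u - 0 *\<^sub>R W u"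
        using ur(3) LIMSEQ_subseq_LIMSEQ[OF that ur(2)] by (intro tendsto_intros limW) (auto simp: o_def)
      then show ?thesis by simp
    qed
    have "(\<lambda>n. F h - 2 * \<sigma> * s (r n)) \<longlonglongrightarrow> F h - 2 * \<sigma> * 0"
      using LIMSEQ_subseq_LIMSEQ[OF s0 ur(2)] by (intro tendsto_intros) (simp add: o_def)
    \<comment> \<open>As the steps shrink, the maximisers accumulate at a point of the maximal
      level, which therefore lies in \<open>Z\<close>; there the slope bound contradicts the choice
      of \<open>W\<close>.\<close>
    then have "F h \<le> J u"
      using LIMSEQ_le[OF _ J_tendsto[OF lim[OF s0] uK]] us(2) by fastforce
    then have "u \<in> Z" using ur(1) JQ by (force simp: Z_def)
    moreover have "J' u (W u) \<le> 2 * \<sigma>"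
    proof (rule LIMSEQ_le_const2)
      show "(\<lambda>n. J' (us (r n) - t (r n) *\<^sub>R W (us (r n))) (W (us (r n)))) \<longlonglongrightarrow> J' u (W u)"
        by (intro tendsto_intros J'_tendsto[OF lim[OF t0] uK] limW)
    qed (use t in auto)
    ultimately show False using W(4) by force
  qed
  then obtain u where u: "u \<in> Z" "norm (J' u) \<le> 2 * \<sigma>" by auto
  then obtain v where v: "v \<in> M" "u = h v" by (auto simp: Z_def Q_def)
  have Fid: "F id \<le> l + \<epsilon>" by (rule F_le) (simp add: upper)
  have duv: "dist u v \<le> d h id" using d_ge[OF h(1) idH v(1)] v(2) by (simp add: dist_norm)
  then have d0: "0 \<le> d h id" by (meson order_trans zero_le_dist)
  have le: "\<sigma> * dist u v \<le> \<sigma> * d h id" using duv \<sigma> by simp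
  have Ju: "J u = F h" using u by (simp add: Z_def)
  show ?thesis
  proof (rule that)
    show "u \<in> K \<inter> sphere 0 1" using u hQ by (auto simp: Z_def)
    show "v \<in> M" by fact
    show "l \<le> J u" using lF[OF h(1)] Ju by simp
    show "J u \<le> l + \<epsilon>" using Ju h(2) Fid mult_nonneg_nonneg[of \<sigma> "d h id"] d0 \<sigma> by linarith
    show "norm (J' u) \<le> 2 * \<sigma>" by fact
    show "\<sigma> * dist u v \<le> \<epsilon>" using le h(2) Fid lF[OF h(1)] by linarith
  qed
qed

text \<open>Odd images of an admissible set are admissible, so the minimax value is a lower bound as
  required by \<open>almost_critical_point\<close>. Sets optimal up to 1/(n+1) then yield a
  Palais-Smale sequence at that level.\<close>

lemma minimax_critical:
  assumes k: "1 \<le> k" and ne: "genus_family K k \<noteq> {}"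
  obtains u where "u \<in> K \<inter> sphere 0 1" "J u = minimax J K k" "J' u = 0"
proof -
  define l where "l = minimax J K k"
  define \<sigma> where "\<sigma> n = 1 / real (Suc n)" for n
  have \<sigma>: "0 < \<sigma> n" for n by (simp add: \<sigma>_def)
  have "\<exists>u\<in>K \<inter> sphere 0 1. l \<le> J u \<and> J u \<le> l + \<sigma> n \<and> norm (J' u) \<le> 2 * \<sigma> n" for n
  proof -
    obtain M where M: "M \<in> genus_family K k" "\<And>u. u \<in> M \<Longrightarrow> J u < l + \<sigma> n"
      using minimax_less[OF ne k J_cont, of "l + \<sigma> n"] \<sigma>[of n] l_def by auto
    have M': "compact M" "symmetric_set M" "M \<noteq> {}" "M \<subseteq> K \<inter> sphere 0 1" "enat k \<le> genus M"
      using M(1) genus_family_not_empty[OF M(1) k] by (auto simp: genus_family_def)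
    have low: "\<exists>u\<in>M. l \<le> J (h u)"
      if h: "continuous_on M h" "\<And>u. u \<in> M \<Longrightarrow> h (- u) = - h u" "h ` M \<subseteq> K \<inter> sphere 0 1" for h
    proof -
      have f: "h ` M \<in> genus_family K k" using genus_family_odd_image M' h by blast
      show ?thesis
        using genus_family_attains_Sup(1)[OF f k J_cont] minimax_le[OF f k J_cont J_lower] l_def
        by (metis image_iff)
    qed
    show ?thesis
      by (rule almost_critical_point[OF M'(1-4) less_imp_le[OF M(2)] low \<sigma>]) auto
  qed
  then obtain us where us: "\<And>n. us n \<in> K \<inter> sphere 0 1" "\<And>n. l \<le> J (us n)" "\<And>n. J (us n) \<le> l + \<sigma> n"
    "\<And>n. norm (J' (us n)) \<le> 2 * \<sigma> n" by metis
  have \<sigma>0: "\<sigma> \<longlonglongrightarrow> 0" unfolding \<sigma>_def using LIMSEQ_inverse_real_of_nat by (simp add: inverse_eq_divide)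
  have "(\<lambda>n. J (us n)) \<longlonglongrightarrow> l"
    by (rule tendsto_sandwich[OF _ _ tendsto_const tendsto_eq_rhs[OF tendsto_add[OF tendsto_const \<sigma>0]]])
      (use us in \<open>auto intro: always_eventually\<close>)
  moreover have "(\<lambda>n. J' (us n)) \<longlonglongrightarrow> 0"
    by (rule Lim_null_comparison[OF _ tendsto_eq_rhs[OF tendsto_mult[OF tendsto_const \<sigma>0]]])
      (use us in \<open>auto intro: always_eventually\<close>)
  ultimately show ?thesis using critical_limit[of us l] us(1) that unfolding l_def by blast
qed

lemma minimax_mono:
  assumes "1 \<le> k" "k \<le> k'" "genus_family K k' \<noteq> {}"
  shows "minimax J K k \<le> minimax J K k'"
proof (rule minimax_greatest[OF assms(3) _ J_cont])
  fix M assume "M \<in> genus_family K k'"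
  then have f: "M \<in> genus_family K k" using genus_family_antimono[OF assms(2)] by blast
  show "\<exists>u\<in>M. minimax J K k \<le> J u"
    using genus_family_attains_Sup(1)[OF f assms(1) J_cont] minimax_le[OF f assms(1) J_cont J_lower] by metis
qed (use assms in auto)

text \<open>If the values increased to a finite \<open>l\<close>, the critical set \<open>Z\<close>
  at level \<open>l\<close> would be compact, and some odd map \<open>F\<close> with
  \<open>m\<close> coordinates would not vanish on it. Cutting a nearly optimal set of genus at
  least \<open>k + m + 1\<close> down to the zeros of \<open>F\<close> leaves genus at least
  \<open>k + 1\<close>, hence still an admissible set for a level near \<open>l\<close>. Almost
  critical points close to this zero set converge to a point of \<open>Z\<close> where
  \<open>F\<close> vanishes.\<close>

lemma minimax_at_top:
  assumes ne: "\<And>k. genus_family K k \<noteq> {}"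
  shows "filterlim (\<lambda>k. minimax J K k) at_top sequentially"
proof (rule ccontr)
  assume not_top: "\<not> ?thesis"
  \<comment> \<open>The shift by one avoids the index 0, for which the minimax value is not
    meaningful.\<close>
  define a where "a k = minimax J K (Suc k)" for k
  have "incseq a" unfolding a_def by (intro incseq_SucI minimax_mono ne) auto
  have "bdd_above (range a)"
  proof (rule ccontr)
    assume nb: "\<not> ?thesis"
    have "filterlim a at_top sequentially"
      unfolding filterlim_at_top
    proof
      fix b
      obtain n where "b < a n" using nb unfolding bdd_above_def by (auto simp: not_le)
      then show "\<forall>\<^sub>F n in sequentially. b \<le> a n"
        using incseqD[OF \<open>incseq a\<close>] unfolding eventually_sequentially by (meson less_imp_le order_trans)
    qed
    then show False using not_top unfolding a_def by (simp add: filterlim_sequentially_Suc)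
  qed
  then have al: "a \<longlonglongrightarrow> (SUP k. a k)" using \<open>incseq a\<close> LIMSEQ_incseq_SUP by blast
  define l where "l = (SUP k. a k)"
  have a_le: "a k \<le> l" for k unfolding l_def using \<open>bdd_above (range a)\<close> by (intro cSUP_upper) auto
  define Z where "Z = {u \<in> K \<inter> sphere 0 1. J u = l \<and> J' u = 0}"
  have "compact Z"
    unfolding compact_def
  proof (intro allI impI)
    fix us :: "nat \<Rightarrow> 'a" assume "\<forall>n. us n \<in> Z"
    then have us: "range us \<subseteq> K \<inter> sphere 0 1" "(\<lambda>n. J (us n)) \<longlonglongrightarrow> l" "(\<lambda>n. J' (us n)) \<longlonglongrightarrow> 0"
      by (auto simp: Z_def)
    show "\<exists>u\<in>Z. \<exists>r. strict_mono r \<and> (us \<circ> r) \<longlonglongrightarrow> u"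
      by (rule critical_limit[OF us]) (auto simp: Z_def)
  qed
  moreover have "0 \<notin> Z" by (simp add: Z_def)
  ultimately obtain m and F :: "'a \<Rightarrow> nat \<Rightarrow> real"
    where F: "\<And>i. continuous_on UNIV (\<lambda>u. F u i)" "\<And>u i. F (- u) i = - F u i"
      "\<And>u i. i \<ge> m \<Longrightarrow> F u i = 0" "\<And>u. u \<in> Z \<Longrightarrow> \<exists>i. F u i \<noteq> 0"
    by (rule odd_map_separating_compact) blast
  define \<sigma> where "\<sigma> n = 1 / real (Suc n)" for n
  have \<sigma>: "0 < \<sigma> n" for n by (simp add: \<sigma>_def)
  \<comment> \<open>The level error is quadratic in \<open>\<sigma> n\<close>: dividing
    \<open>\<sigma> n * dist u v \<le> 2 * (\<sigma> n)\<^sup>2\<close> by \<open>\<sigma> n\<close>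
    still leaves a distance tending to 0.\<close>
  have "\<exists>u v. u \<in> K \<inter> sphere 0 1 \<and> (\<forall>i. F v i = 0) \<and> l - (\<sigma> n)\<^sup>2 \<le> J u \<and> J u \<le> l + (\<sigma> n)\<^sup>2 \<and>
      norm (J' u) \<le> 2 * \<sigma> n \<and> \<sigma> n * dist u v \<le> 2 * (\<sigma> n)\<^sup>2" for n
  proof -
    have "l - (\<sigma> n)\<^sup>2 < l" using \<sigma>[of n] by simp
    then obtain k where k: "l - (\<sigma> n)\<^sup>2 < a k"
      using order_tendstoD(1)[OF al[folded l_def]] by (metis eventually_sequentially order_refl)
    have "a (k + m) < l + (\<sigma> n)\<^sup>2" using a_le[of "k + m"] \<sigma>[of n] by (simp add: add_pos_pos less_add_same_cancel1 order_le_less_trans)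
    then obtain M where M: "M \<in> genus_family K (Suc (k + m))" "\<And>u. u \<in> M \<Longrightarrow> J u < l + (\<sigma> n)\<^sup>2"
      using minimax_less[OF ne _ J_cont, of "Suc (k + m)"] unfolding a_def by auto
    define M0 where "M0 = {u \<in> M. \<forall>i. F u i = 0}"
    have M': "compact M" "symmetric_set M" "M \<subseteq> K \<inter> sphere 0 1" "enat (Suc (k + m)) \<le> genus M"
      using M(1) by (auto simp: genus_family_def)
    have "closed {u. \<forall>i. F u i = 0}" by (intro closed_Collect_all closed_Collect_eq F continuous_on_const)
    then have "compact (M \<inter> {u. \<forall>i. F u i = 0})" using M'(1) compact_Int_closed by blast
    then have c0: "compact M0" by (simp add: M0_def Collect_conj_eq)
    have s0: "symmetric_set M0" using M'(2) F(2) by (auto simp: M0_def symmetric_set_def)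
    have "enat m + enat (Suc k) \<le> enat m + genus M0"
      using order_trans[OF M'(4) genus_le_add_nonvanishing[OF M'(1,2) F(1-3)]] by (simp add: M0_def add.commute)
    then have g0: "enat (Suc k) \<le> genus M0" by (cases "genus M0") auto
    then have f0: "M0 \<in> genus_family K (Suc k)" using c0 s0 M' by (auto simp: genus_family_def M0_def)
    have low: "\<exists>u\<in>M0. l - (\<sigma> n)\<^sup>2 \<le> J (h u)"
      if h: "continuous_on M0 h" "\<And>u. u \<in> M0 \<Longrightarrow> h (- u) = - h u" "h ` M0 \<subseteq> K \<inter> sphere 0 1" for h
    proof -
      have f: "h ` M0 \<in> genus_family K (Suc k)" using genus_family_odd_image c0 s0 g0 h by blast
      obtain v where v: "v \<in> h ` M0" "J v = Sup (J ` h ` M0)"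
        using genus_family_attains_Sup(1)[OF f _ J_cont] by auto
      have "a k \<le> Sup (J ` h ` M0)" unfolding a_def by (rule minimax_le[OF f _ J_cont J_lower]) simp
      then have "l - (\<sigma> n)\<^sup>2 \<le> J v" using k v(2) by linarith
      then show ?thesis using v(1) by blast
    qed
    have up: "J u \<le> (l - (\<sigma> n)\<^sup>2) + 2 * (\<sigma> n)\<^sup>2" if "u \<in> M0" for u
      using M(2)[of u] that by (auto simp: M0_def)
    have ne0: "M0 \<noteq> {}" using genus_family_not_empty[OF f0] by simp
    obtain u v where "u \<in> K \<inter> sphere 0 1" "v \<in> M0" "l - (\<sigma> n)\<^sup>2 \<le> J u" "J u \<le> (l - (\<sigma> n)\<^sup>2) + 2 * (\<sigma> n)\<^sup>2"
      "norm (J' u) \<le> 2 * \<sigma> n" "\<sigma> n * dist u v \<le> 2 * (\<sigma> n)\<^sup>2"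
      by (rule almost_critical_point[OF c0 s0 ne0 _ up low \<sigma>]) (use M' in \<open>auto simp: M0_def\<close>)
    then show ?thesis by (intro exI[of _ u] exI[of _ v]) (auto simp: M0_def)
  qed
  then obtain us vs where us: "\<And>n. us n \<in> K \<inter> sphere 0 1" "\<And>n i. F (vs n) i = 0"
    "\<And>n. l - (\<sigma> n)\<^sup>2 \<le> J (us n)" "\<And>n. J (us n) \<le> l + (\<sigma> n)\<^sup>2"
    "\<And>n. norm (J' (us n)) \<le> 2 * \<sigma> n" "\<And>n. \<sigma> n * dist (us n) (vs n) \<le> 2 * (\<sigma> n)\<^sup>2" by metis
  have \<sigma>0: "\<sigma> \<longlonglongrightarrow> 0" unfolding \<sigma>_def using LIMSEQ_inverse_real_of_nat by (simp add: inverse_eq_divide)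
  have lim_J: "(\<lambda>n. J (us n)) \<longlonglongrightarrow> l"
  proof (rule tendsto_sandwich)
    show "(\<lambda>n. l - (\<sigma> n)\<^sup>2) \<longlonglongrightarrow> l" "(\<lambda>n. l + (\<sigma> n)\<^sup>2) \<longlonglongrightarrow> l"
      by (auto intro!: tendsto_eq_intros \<sigma>0)
  qed (use us in \<open>auto intro: always_eventually\<close>)
  have lim_J':  "(\<lambda>n. J' (us n)) \<longlonglongrightarrow> 0"
    by (rule Lim_null_comparison[OF _ tendsto_eq_rhs[OF tendsto_mult[OF tendsto_const \<sigma>0]]])
      (use us in \<open>auto intro: always_eventually\<close>)
  have us_K: "range us \<subseteq> K \<inter> sphere 0 1" using us(1) by blast
  obtain u r where u: "strict_mono r" "(us \<circ> r) \<longlonglongrightarrow> u" "u \<in> K \<inter> sphere 0 1" "J u = l" "J' u = 0"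
    by (rule critical_limit[OF us_K lim_J lim_J'])
  have "dist (us n) (vs n) \<le> 2 * \<sigma> n" for n
    using us(6)[of n] \<sigma>[of n] by (simp add: power2_eq_square)
  then have "(\<lambda>n. us n - vs n) \<longlonglongrightarrow> 0"
    by (intro Lim_null_comparison[OF _ tendsto_eq_rhs[OF tendsto_mult[OF tendsto_const[of 2] \<sigma>0]]])
      (auto intro: always_eventually simp: dist_norm)
  then have "(\<lambda>n. us (r n) - (us (r n) - vs (r n))) \<longlonglongrightarrow> u - 0"
    using u(2) LIMSEQ_subseq_LIMSEQ[OF _ u(1)] by (intro tendsto_diff) (auto simp: o_def)
  then have v: "(\<lambda>n. vs (r n)) \<longlonglongrightarrow> u" by simp
  have "F u i = 0" for i
  proof -
    have "(\<lambda>n. F (vs (r n)) i) \<longlonglongrightarrow> F u i"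
      using F(1)[of i] v by (auto simp: continuous_on_eq_continuous_at intro: isCont_tendsto_compose[of u "\<lambda>u. F u i"])
    then show ?thesis by (simp add: us(2) LIMSEQ_const_iff)
  qed
  then show False using F(4)[of u] u by (auto simp: Z_def)
qed

end

text \<open>Nearly optimal sets lie in a sublevel one unit above the minimax value, so the gap is
  asked for only there. Uniform bounds on fibre extrema are available exactly on such
  sublevels.\<close>

lemma minimax_strict_antimono:
  assumes "1 \<le> k" "genus_family K k \<noteq> {}" "continuous_on K J1" "continuous_on K J2"
    and "bdd_below (J2 ` (K \<inter> sphere 0 1))"
    and gap: "0 < \<delta>" "\<And>u. u \<in> K \<inter> sphere 0 1 \<Longrightarrow> J1 u \<le> minimax J1 K k + 1 \<Longrightarrow> J2 u + \<delta> \<le> J1 u"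
  shows "minimax J2 K k < minimax J1 K k"
proof -
  obtain M where M: "M \<in> genus_family K k" "\<And>u. u \<in> M \<Longrightarrow> J1 u < minimax J1 K k + min 1 (\<delta> / 2)"
    using minimax_less[OF assms(2,1,3), of "minimax J1 K k + min 1 (\<delta> / 2)"] gap(1) by auto
  have *: "J2 u \<le> minimax J1 K k - \<delta> / 2" if "u \<in> M" for u
  proof -
    have "u \<in> K \<inter> sphere 0 1" using M(1) that by (auto simp: genus_family_def)
    then show ?thesis using gap(2)[of u] M(2)[OF that] by linarith
  qed
  have "minimax J2 K k \<le> minimax J1 K k - \<delta> / 2" by (rule minimax_upper[OF M(1) assms(1,4,5) *])
  then show ?thesis using gap(1) by simp
qed

lemma minimax_le_add:
  assumes "1 \<le> k" "genus_family K k \<noteq> {}" "continuous_on K J1" "continuous_on K J2"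
    and "bdd_below (J1 ` (K \<inter> sphere 0 1))"
    and gap: "\<And>u. u \<in> K \<inter> sphere 0 1 \<Longrightarrow> J2 u \<le> minimax J2 K k + 1 \<Longrightarrow> J1 u \<le> J2 u + \<delta>"
  shows "minimax J1 K k \<le> minimax J2 K k + \<delta>"
proof (rule field_le_epsilon)
  fix e :: real assume e: "0 < e"
  obtain M where M: "M \<in> genus_family K k" "\<And>u. u \<in> M \<Longrightarrow> J2 u < minimax J2 K k + min 1 e"
    using minimax_less[OF assms(2,1,4), of "minimax J2 K k + min 1 e"] e by auto
  have *: "J1 u \<le> minimax J2 K k + \<delta> + e" if "u \<in> M" for u
  proof -
    have "u \<in> K \<inter> sphere 0 1" using M(1) that by (auto simp: genus_family_def)
    then show ?thesis using gap[of u] M(2)[OF that] by linarith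
  qed
  show "minimax J1 K k \<le> minimax J2 K k + \<delta> + e" by (rule minimax_upper[OF M(1) assms(1,3,5) *])
qed

section \<open>Fibre extrema\<close>

lemma dual_deriv_eq:
  "(F has_derivative blinfun_apply F') (at u) \<Longrightarrow> dual_deriv F u = F'"
  unfolding dual_deriv_def by (metis blinfun_apply_inverse frechet_derivative_at)

lemma isCont_tendsto_nhds: "isCont f x \<Longrightarrow> (f \<longlongrightarrow> f x) (nhds x)"
  using tendsto_at_iff_tendsto_nhds[of f x] by (simp add: isCont_def)

locale fibering_problem =
  fixes N A B :: "'a::banach \<Rightarrow> real" and N' A' B' :: "'a \<Rightarrow> 'a \<Rightarrow>\<^sub>L real" and \<alpha> \<eta> \<beta> C C' :: real
  assumes exponents: "1 < \<alpha>" "\<alpha> < \<eta>" "\<eta> < \<beta>"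
    and N_deriv: "(N has_derivative blinfun_apply (N' u)) (at u)" and N'_cont: "continuous_on UNIV N'"
    and A_deriv: "(A has_derivative blinfun_apply (A' u)) (at u)" and A'_cont: "continuous_on UNIV A'"
    and B_deriv: "(B has_derivative blinfun_apply (B' u)) (at u)" and B'_cont: "continuous_on UNIV B'"
    and even: "N (- u) = N u" "A (- u) = A u" "B (- u) = B u"
    and hom: "0 < t \<Longrightarrow> N (t *\<^sub>R u) = t powr \<eta> * N u" "0 < t \<Longrightarrow> A (t *\<^sub>R u) = t powr \<alpha> * A u"
      "0 < t \<Longrightarrow> B (t *\<^sub>R u) = t powr \<beta> * B u"
    and C_pos: "0 < C" "0 < C'"
    and N_upper: "N u \<le> C' * norm u powr \<eta>" and N_lower: "inverse C * norm u powr \<eta> \<le> N u"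
    and A_bound: "\<bar>A u\<bar> \<le> C * norm u powr \<alpha>" and B_bound: "\<bar>B u\<bar> \<le> C * norm u powr \<beta>"
    and compactness: "compactness_condition (Phi \<eta> \<alpha> \<beta> N A B)"
    and boundary: "range us \<subseteq> pos_cone A \<Longrightarrow> bounded (range us) \<Longrightarrow>
       (\<lambda>n. A (us n)) \<longlonglongrightarrow> 0 \<Longrightarrow> (\<lambda>n. B (us n)) \<longlonglongrightarrow> 0"
begin

abbreviation \<Phi> :: "real \<Rightarrow> 'a \<Rightarrow> real" where "\<Phi> \<equiv> Phi \<eta> \<alpha> \<beta> N A B"

text \<open>\<open>lam c v\<close> is the value of \<open>\<lambda>\<close> for which \<open>\<Phi>\<^sub>\<lambda>(v) = c\<close>; along the ray through \<open>u\<close> it is critical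
  exactly where \<open>P = c\<close>, and \<open>Q v\<close> is the radial derivative of \<open>P\<close> at \<open>v\<close>.\<close>

definition lam :: "real \<Rightarrow> 'a \<Rightarrow> real" where
  "lam c v = \<alpha> * (N v / \<eta> - B v / \<beta> - c) / A v"

definition lam' :: "real \<Rightarrow> 'a \<Rightarrow> 'a \<Rightarrow>\<^sub>L real" where
  "lam' c v = (\<alpha> / A v) *\<^sub>R ((1 / \<eta>) *\<^sub>R N' v - (1 / \<beta>) *\<^sub>R B' v - (lam c v / \<alpha>) *\<^sub>R A' v)"

definition P :: "'a \<Rightarrow> real" where
  "P v = (\<beta> - \<alpha>) / (\<alpha> * \<beta>) * B v - (\<eta> - \<alpha>) / (\<alpha> * \<eta>) * N v"

definition Q :: "'a \<Rightarrow> real" where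
  "Q v = (\<beta> - \<alpha>) / \<alpha> * B v - (\<eta> - \<alpha>) / \<alpha> * N v"

text \<open>The sign \<open>s = 1\<close> selects the fibre maximum (the branch \<open>\<lambda>\<^sup>-\<close>), \<open>s = -1\<close> the fibre minimum
  (the branch \<open>\<lambda>\<^sup>+\<close>).\<close>

definition branch :: "real \<Rightarrow> real \<Rightarrow> 'a \<Rightarrow> real \<Rightarrow> bool" where
  "branch s c u t \<longleftrightarrow> 0 < t \<and> 0 < s * Q (t *\<^sub>R u) \<and> P (t *\<^sub>R u) = c"

text \<open>The description is justified by \<open>branch_unique\<close>; \<open>T\<close> carries
  information only where a branch point exists.\<close>

definition T :: "real \<Rightarrow> real \<Rightarrow> 'a \<Rightarrow> real" where
  "T s c u = (THE t. branch s c u t)"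

definition val :: "real \<Rightarrow> real \<Rightarrow> 'a \<Rightarrow> real" where
  "val s c u = lam c (T s c u *\<^sub>R u)"

definition val' :: "real \<Rightarrow> real \<Rightarrow> 'a \<Rightarrow> 'a \<Rightarrow>\<^sub>L real" where
  "val' s c u = T s c u *\<^sub>R lam' c (T s c u *\<^sub>R u)"

lemma exponents_pos: "0 < \<alpha>" "0 < \<eta>" "0 < \<beta>" "0 < \<beta> - \<alpha>" "0 < \<eta> - \<alpha>" "0 < \<beta> - \<eta>"
  using exponents by auto

lemma N_cont: "continuous_on S N" and A_cont: "continuous_on S A" and B_cont: "continuous_on S B"
  using N_deriv A_deriv B_deriv
  by (meson has_derivative_continuous continuous_at_imp_continuous_on)+

lemma P_cont: "continuous_on S P" and Q_cont: "continuous_on S Q"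
  unfolding P_def Q_def by (intro continuous_intros N_cont B_cont)+

lemma zero_values: "N 0 = 0" "A 0 = 0" "B 0 = 0"
proof -
  have "2 powr p \<noteq> (1::real)" if "0 < p" for p :: real using that by (simp add: powr_eq_one_iff)
  then show "N 0 = 0" "A 0 = 0" "B 0 = 0"
    using hom[of 2 0] exponents_pos by (auto simp: scaleR_zero_right)
qed

lemma sphere_bounds:
  assumes "norm u = 1"
  shows "inverse C \<le> N u" "N u \<le> C'" "\<bar>A u\<bar> \<le> C" "\<bar>B u\<bar> \<le> C"
  using assms N_upper[of u] N_lower[of u] A_bound[of u] B_bound[of u] by auto

lemma N_pos: "u \<noteq> 0 \<Longrightarrow> 0 < N u"
  using N_lower[of u] C_pos by (meson less_le_trans mult_pos_pos positive_imp_inverse_positive powr_gt_zero zero_less_norm_iff norm_eq_zero)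

lemma ray_P: "0 < t \<Longrightarrow> P (t *\<^sub>R u) = (\<beta> - \<alpha>) / (\<alpha> * \<beta>) * B u * t powr \<beta> - (\<eta> - \<alpha>) / (\<alpha> * \<eta>) * N u * t powr \<eta>"
  and ray_Q: "0 < t \<Longrightarrow> Q (t *\<^sub>R u) = (\<beta> - \<alpha>) / \<alpha> * B u * t powr \<beta> - (\<eta> - \<alpha>) / \<alpha> * N u * t powr \<eta>"
  by (simp_all add: P_def Q_def hom mult_ac)

lemma ray_lam: "0 < t \<Longrightarrow> lam c (t *\<^sub>R u) = \<alpha> * (t powr \<eta> * N u / \<eta> - t powr \<beta> * B u / \<beta> - c) / (t powr \<alpha> * A u)"
  by (simp add: lam_def hom)

lemma ray_Q_factor:
  "0 < t \<Longrightarrow> Q (t *\<^sub>R u) = t powr \<eta> * ((\<beta> - \<alpha>) / \<alpha> * B u * t powr (\<beta> - \<eta>) - (\<eta> - \<alpha>) / \<alpha> * N u)"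
  using powr_add[of t \<eta> "\<beta> - \<eta>"] by (simp add: ray_Q right_diff_distrib mult_ac)

lemma P_ray_deriv:
  assumes "0 < t"
  shows "((\<lambda>t. P (t *\<^sub>R u)) has_real_derivative Q (t *\<^sub>R u) / t) (at t)"
proof (rule has_field_derivative_transform_within_open[where S="{0<..}"])
  show "((\<lambda>t. (\<beta> - \<alpha>) / (\<alpha> * \<beta>) * B u * t powr \<beta> - (\<eta> - \<alpha>) / (\<alpha> * \<eta>) * N u * t powr \<eta>)
      has_real_derivative Q (t *\<^sub>R u) / t) (at t)"
    using assms exponents_pos
    by (auto intro!: derivative_eq_intros simp: ray_Q powr_diff field_simps)
qed (use assms in \<open>auto simp: ray_P\<close>)

lemma lam_ray_deriv:
  assumes "0 < t" "0 < A u"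
  shows "((\<lambda>t. lam c (t *\<^sub>R u)) has_real_derivative \<alpha>\<^sup>2 / (t * A (t *\<^sub>R u)) * (c - P (t *\<^sub>R u))) (at t)"
proof (rule has_field_derivative_transform_within_open[where S="{0<..}"])
  let ?X = "t powr \<alpha> * A u"
  have X: "?X > 0" using assms by simp
  show "((\<lambda>t. \<alpha> * (t powr \<eta> * N u / \<eta> - t powr \<beta> * B u / \<beta> - c) / (t powr \<alpha> * A u))
      has_real_derivative \<alpha>\<^sup>2 / (t * A (t *\<^sub>R u)) * (c - P (t *\<^sub>R u))) (at t)"
    using assms exponents_pos X
    by (auto intro!: derivative_eq_intros simp: ray_P hom powr_diff field_simps power2_eq_square)
qed (use assms in \<open>auto simp: ray_lam\<close>)

text \<open>After division by \<open>t powr \<eta>\<close> the function \<open>s * Q\<close> is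
  affine in the monotone quantity \<open>t powr (\<beta> - \<eta>)\<close>, so its positivity set on
  a ray is an interval.\<close>

lemma Q_sign_convex:
  assumes "0 < t1" "t1 \<le> t" "t \<le> t2" "0 < s * Q (t1 *\<^sub>R u)" "0 < s * Q (t2 *\<^sub>R u)"
  shows "0 < s * Q (t *\<^sub>R u)"
proof -
  define x y where "x = s * ((\<beta> - \<alpha>) / \<alpha> * B u)" and "y = s * ((\<eta> - \<alpha>) / \<alpha> * N u)"
  have eq: "s * Q (\<tau> *\<^sub>R u) = \<tau> powr \<eta> * (x * \<tau> powr (\<beta> - \<eta>) - y)" if "0 < \<tau>" for \<tau>
    unfolding ray_Q_factor[OF that] x_def y_def by (simp add: right_diff_distrib mult_ac)
  have pos: "0 < t" "0 < t2" using assms by auto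
  have 1: "0 < x * t1 powr (\<beta> - \<eta>) - y" "0 < x * t2 powr (\<beta> - \<eta>) - y"
    using assms(4,5) assms(1) pos by (auto simp: eq zero_less_mult_iff)
  have "t1 powr (\<beta> - \<eta>) \<le> t powr (\<beta> - \<eta>)" "t powr (\<beta> - \<eta>) \<le> t2 powr (\<beta> - \<eta>)"
    using assms(1-3) exponents_pos by (auto intro!: powr_mono2)
  then have "x * t1 powr (\<beta> - \<eta>) \<le> x * t powr (\<beta> - \<eta>) \<or> x * t2 powr (\<beta> - \<eta>) \<le> x * t powr (\<beta> - \<eta>)"
    by (cases "0 \<le> x") (auto intro: mult_left_mono mult_left_mono_neg)
  then have "0 < x * t powr (\<beta> - \<eta>) - y" using 1 by linarith
  then show ?thesis using pos by (simp add: eq)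
qed

lemma P_ray_strict_mono:
  assumes "0 < t1" "t1 < t2" "0 < s * Q (t1 *\<^sub>R u)" "0 < s * Q (t2 *\<^sub>R u)"
  shows "s * P (t1 *\<^sub>R u) < s * P (t2 *\<^sub>R u)"
proof (rule DERIV_pos_imp_increasing[OF assms(2)])
  fix t assume t: "t1 \<le> t" "t \<le> t2"
  then have t0: "0 < t" using assms by simp
  have "((\<lambda>t. s * P (t *\<^sub>R u)) has_real_derivative s * (Q (t *\<^sub>R u) / t)) (at t)"
    by (intro DERIV_cmult P_ray_deriv t0)
  moreover have "0 < s * (Q (t *\<^sub>R u) / t)"
    using Q_sign_convex[OF assms(1) t assms(3,4)] t0 by simp
  ultimately show "\<exists>y. ((\<lambda>t. s * P (t *\<^sub>R u)) has_real_derivative y) (at t) \<and> 0 < y" by blast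
qed

lemma branch_unique:
  assumes "branch s c u t1" "branch s c u t2" shows "t1 = t2"
  using assms P_ray_strict_mono[of t1 t2 s u] P_ray_strict_mono[of t2 t1 s u]
  unfolding branch_def by (metis less_irrefl linorder_neqE_linordered_idom)

lemma T_eq: "branch s c u t \<Longrightarrow> T s c u = t"
  unfolding T_def using branch_unique by blast

text \<open>The derivative of \<open>lam c\<close> along the ray has the sign of
  \<open>c - P\<close>. Where \<open>s * Q\<close> is positive, \<open>s * P\<close> increases
  strictly through \<open>s * c\<close> at \<open>t\<close>, so \<open>s * lam c\<close> rises
  before \<open>t\<close> and falls after it. The comparison is confined to this interval: the
  extremum is only local on the ray.\<close>

lemma branch_extremal:
  assumes t: "branch s c u t" and u: "0 < A u" and \<tau>: "0 < \<tau>" "0 < s * Q (\<tau> *\<^sub>R u)"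
  shows "s * lam c (\<tau> *\<^sub>R u) \<le> s * lam c (t *\<^sub>R u)"
proof -
  have t': "0 < t" "0 < s * Q (t *\<^sub>R u)" "P (t *\<^sub>R u) = c" using t by (auto simp: branch_def)
  have der: "((\<lambda>t. s * lam c (t *\<^sub>R u)) has_real_derivative
      s * (\<alpha>\<^sup>2 / (x * A (x *\<^sub>R u)) * (c - P (x *\<^sub>R u)))) (at x)" if "0 < x" for x
    by (intro DERIV_cmult lam_ray_deriv that u)
  have sign: "s * (\<alpha>\<^sup>2 / (x * A (x *\<^sub>R u)) * (c - P (x *\<^sub>R u))) =
     \<alpha>\<^sup>2 / (x * A (x *\<^sub>R u)) * (s * P (t *\<^sub>R u) - s * P (x *\<^sub>R u))" for x
  proof -
    have "s * (f * (c - p)) = f * (s * c - s * p)" for f p by (simp add: algebra_simps)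
    then show ?thesis unfolding t'(3) .
  qed
  have fac: "0 \<le> \<alpha>\<^sup>2 / (x * A (x *\<^sub>R u))" if "0 < x" for x using that u by (simp add: hom)
  show ?thesis
  proof (cases \<tau> t rule: linorder_cases)
    case less
    show ?thesis
    proof (rule DERIV_nonneg_imp_nondecreasing[OF less_imp_le[OF less]])
      fix x assume x: "\<tau> \<le> x" "x \<le> t"
      then have x0: "0 < x" using \<tau> by simp
      have "0 < s * Q (x *\<^sub>R u)" using Q_sign_convex[OF \<tau>(1) x \<tau>(2) t'(2)] .
      then have "s * P (x *\<^sub>R u) \<le> s * P (t *\<^sub>R u)"
        using P_ray_strict_mono[OF x0 _ _ t'(2)] x(2) by (cases "x = t") (auto intro: less_imp_le)
      then show "\<exists>y. ((\<lambda>t. s * lam c (t *\<^sub>R u)) has_real_derivative y) (at x) \<and> 0 \<le> y"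
        using der[OF x0] fac[OF x0] unfolding sign by (metis diff_ge_0_iff_ge mult_nonneg_nonneg)
    qed
  next
    case greater
    show ?thesis
    proof (rule DERIV_nonpos_imp_nonincreasing[OF less_imp_le[OF greater]])
      fix x assume x: "t \<le> x" "x \<le> \<tau>"
      then have x0: "0 < x" using t' by simp
      have "0 < s * Q (x *\<^sub>R u)" using Q_sign_convex[OF t'(1) x t'(2) \<tau>(2)] .
      then have "s * P (t *\<^sub>R u) \<le> s * P (x *\<^sub>R u)"
        using P_ray_strict_mono[OF t'(1) _ t'(2)] x(1) by (cases "x = t") (auto intro: less_imp_le)
      then show "\<exists>y. ((\<lambda>t. s * lam c (t *\<^sub>R u)) has_real_derivative y) (at x) \<and> y \<le> 0"
        using der[OF x0] fac[OF x0] unfolding sign by (metis diff_le_0_iff_le mult_nonneg_nonpos)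
    qed
  qed simp
qed

lemma branch_scale: "0 < r \<Longrightarrow> branch s c (r *\<^sub>R u) t \<longleftrightarrow> branch s c u (t * r)"
  by (simp add: branch_def zero_less_mult_iff)

lemma branch_minus: "branch s c (- u) t \<longleftrightarrow> branch s c u t"
  by (simp add: branch_def P_def Q_def even)

lemma lam_deriv:
  assumes "A v \<noteq> 0"
  shows "(lam c has_derivative blinfun_apply (lam' c v)) (at v)"
proof -
  have "((\<lambda>v. \<alpha> * (N v / \<eta> - B v / \<beta> - c) / A v) has_derivative
     (\<lambda>h. (\<alpha> * (N' v h / \<eta> - B' v h / \<beta>) * A v - \<alpha> * (N v / \<eta> - B v / \<beta> - c) * A' v h) / (A v * A v))) (at v)"
    using exponents_pos by (auto intro!: derivative_eq_intros has_derivative_divide' N_deriv A_deriv B_deriv assms)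
  moreover have "(\<lambda>h. (\<alpha> * (N' v h / \<eta> - B' v h / \<beta>) * A v - \<alpha> * (N v / \<eta> - B v / \<beta> - c) * A' v h) / (A v * A v))
      = blinfun_apply (lam' c v)"
  proof
    fix h
    have "(\<alpha> * (x / \<eta> - y / \<beta>) * a - \<alpha> * m * z) / (a * a) = \<alpha> / a * (1 / \<eta> * x - 1 / \<beta> * y - \<alpha> * m / a / \<alpha> * z)"
      if "a \<noteq> 0" for x y z m a :: real using that exponents_pos by (simp add: field_simps)
    from this[OF assms] show "(\<alpha> * (N' v h / \<eta> - B' v h / \<beta>) * A v - \<alpha> * (N v / \<eta> - B v / \<beta> - c) * A' v h) / (A v * A v)
        = lam' c v h"
      unfolding lam'_def blinfun.scaleR_left blinfun.diff_left lam_def real_scaleR_def .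
  qed
  ultimately show ?thesis by (simp add: lam_def[abs_def])
qed

lemma lam_cont: "continuous_on {v. A v \<noteq> 0} (lam c)"
  using lam_deriv has_derivative_continuous by (blast intro: continuous_at_imp_continuous_on)

lemma lam'_cont: "continuous_on {v. A v \<noteq> 0} (lam' c)"
  unfolding lam'_def
  by (intro continuous_intros A_cont lam_cont continuous_on_subset[OF N'_cont]
      continuous_on_subset[OF A'_cont] continuous_on_subset[OF B'_cont])
    (use exponents_pos in simp_all)

lemma Phi_deriv:
  assumes "A v \<noteq> 0"
  shows "dual_deriv (\<Phi> (lam c v)) v = (A v / \<alpha>) *\<^sub>R lam' c v"
proof (rule dual_deriv_eq)
  have "(\<Phi> l has_derivative (\<lambda>h. 1 / \<eta> * N' v h - l / \<alpha> * A' v h - 1 / \<beta> * B' v h)) (at v)" for l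
    unfolding Phi_def[abs_def] using exponents_pos
    by (auto intro!: derivative_eq_intros N_deriv A_deriv B_deriv)
  moreover have "(\<lambda>h. 1 / \<eta> * N' v h - lam c v / \<alpha> * A' v h - 1 / \<beta> * B' v h)
      = blinfun_apply ((A v / \<alpha>) *\<^sub>R lam' c v)"
  proof
    fix h show "1 / \<eta> * N' v h - lam c v / \<alpha> * A' v h - 1 / \<beta> * B' v h = ((A v / \<alpha>) *\<^sub>R lam' c v) h"
      unfolding lam'_def blinfun.scaleR_left blinfun.diff_left using assms exponents_pos by simp
  qed
  ultimately show "(\<Phi> (lam c v) has_derivative blinfun_apply ((A v / \<alpha>) *\<^sub>R lam' c v)) (at v)"
    by metis
qed

lemma Phi_value: "A v \<noteq> 0 \<Longrightarrow> \<Phi> (lam c v) v = c"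
  using exponents_pos by (simp add: Phi_def lam_def field_simps)

end

text \<open>What the two branches share. The cone and the sign vary, while
  \<open>branch_bounds\<close> and \<open>branch_closed\<close> express coercivity and closedness on
  sublevels of the fibre extremum; they supply the lower bound, the Palais-Smale condition and
  \<open>sublevel_closed\<close> for it.\<close>

locale fibering_branch = fibering_problem +
  fixes s c :: real and K :: "'a set"
  assumes sign: "s = 1 \<or> s = -1"
    and K_open: "open K" and K_A: "u \<in> K \<Longrightarrow> 0 < A u"
    and K_scale: "u \<in> K \<Longrightarrow> 0 < t \<Longrightarrow> t *\<^sub>R u \<in> K" and K_neg: "u \<in> K \<Longrightarrow> - u \<in> K"
    and ex_branch: "u \<in> K \<inter> sphere 0 1 \<Longrightarrow> \<exists>t. branch s c u t"
    and branch_bounds: "\<exists>\<tau>1>0. \<exists>\<tau>2. \<exists>a>0. \<forall>u\<in>K \<inter> sphere 0 1. \<forall>t. branch s c u t \<longrightarrow>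
        lam c (t *\<^sub>R u) \<le> b \<longrightarrow> \<tau>1 \<le> t \<and> t \<le> \<tau>2 \<and> a \<le> A u"
    and branch_closed: "range us \<subseteq> K \<inter> sphere 0 1 \<Longrightarrow> us \<longlonglongrightarrow> u \<Longrightarrow> (\<And>n. branch s c (us n) (ts n)) \<Longrightarrow>
        (\<And>n. lam c (ts n *\<^sub>R us n) \<le> b) \<Longrightarrow> u \<in> K"
begin

section \<open>Regularity and compactness of the fibre extremum\<close>

lemma K_nonzero: "u \<in> K \<Longrightarrow> u \<noteq> 0"
  using K_A zero_values by fastforce

lemma T_branch: assumes u: "u \<in> K" shows "branch s c u (T s c u)"
proof -
  have n: "0 < norm u" using K_nonzero[OF u] by simp
  have "(1 / norm u) *\<^sub>R u \<in> K \<inter> sphere 0 1" using K_scale[OF u, of "1 / norm u"] n by simp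
  then obtain t where "branch s c ((1 / norm u) *\<^sub>R u) t" using ex_branch by blast
  then have "branch s c u (t * (1 / norm u))" using branch_scale[of "1 / norm u"] n by simp
  then show ?thesis using T_eq by metis
qed

lemma T_pos: "u \<in> K \<Longrightarrow> 0 < T s c u" and T_Q: "u \<in> K \<Longrightarrow> 0 < s * Q (T s c u *\<^sub>R u)"
  and T_P: "u \<in> K \<Longrightarrow> P (T s c u *\<^sub>R u) = c"
  using T_branch by (auto simp: branch_def)

lemma T_scale: assumes "u \<in> K" "0 < r" shows "T s c (r *\<^sub>R u) = T s c u / r"
  using T_branch[OF assms(1)] assms(2) by (intro T_eq) (simp add: branch_scale)

lemma T_minus: "u \<in> K \<Longrightarrow> T s c (- u) = T s c u"
  using T_branch by (intro T_eq) (simp add: branch_minus)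

text \<open>On the ray through \<open>u\<close>, \<open>s * P\<close> passes strictly from below to
  above \<open>s * c\<close> between \<open>?t - r\<close> and \<open>?t + r\<close>. These strict
  inequalities and the sign of \<open>Q\<close> at both ends persist for nearby \<open>y\<close>,
  and monotonicity then traps \<open>T s c y\<close> between the same two numbers.\<close>

lemma T_isCont:
  assumes u: "u \<in> K" shows "isCont (T s c) u"
proof -
  let ?t = "T s c u"
  have cont: "isCont (\<lambda>x. f (g x)) y" if "continuous_on UNIV f" "isCont g y" for f :: "'a \<Rightarrow> real" and g and y :: "'c::t2_space"
    using that by (metis continuous_at_compose continuous_on_eq_continuous_at isCont_o2 open_UNIV UNIV_I)
  have "isCont (\<lambda>t. s * Q (t *\<^sub>R u)) ?t" by (intro continuous_intros cont Q_cont)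
  then have "((\<lambda>t. s * Q (t *\<^sub>R u)) \<longlongrightarrow> s * Q (?t *\<^sub>R u)) (nhds ?t)" by (rule isCont_tendsto_nhds)
  then have "\<forall>\<^sub>F t in nhds ?t. 0 < s * Q (t *\<^sub>R u)"
    using T_Q[OF u] by (rule order_tendstoD(1))
  then obtain d where d: "0 < d" "\<And>t. dist t ?t < d \<Longrightarrow> 0 < s * Q (t *\<^sub>R u)"
    unfolding eventually_nhds_metric by auto
  have "\<forall>\<^sub>F y in nhds u. dist (T s c y) ?t < e" if e: "0 < e" for e
  proof -
    define r where "r = min (min d e) ?t / 2"
    have r: "0 < r" "r < d" "r < e" "r < ?t" using d e T_pos[OF u] by (auto simp: r_def)
    define t1 t2 where "t1 = ?t - r" and "t2 = ?t + r"
    have t: "0 < t1" "t1 < ?t" "?t < t2" using r by (auto simp: t1_def t2_def)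
    have q: "0 < s * Q (t1 *\<^sub>R u)" "0 < s * Q (t2 *\<^sub>R u)"
      using r by (auto intro!: d simp: t1_def t2_def dist_real_def)
    have p: "s * P (t1 *\<^sub>R u) < s * c" "s * c < s * P (t2 *\<^sub>R u)"
      using P_ray_strict_mono[OF t(1,2) q(1) T_Q[OF u]] P_ray_strict_mono[OF T_pos[OF u] t(3) T_Q[OF u] q(2)] T_P[OF u]
      by auto
    have lim: "((\<lambda>y. s * Q (\<tau> *\<^sub>R y)) \<longlongrightarrow> s * Q (\<tau> *\<^sub>R u)) (nhds u)"
      "((\<lambda>y. s * P (\<tau> *\<^sub>R y)) \<longlongrightarrow> s * P (\<tau> *\<^sub>R u)) (nhds u)" for \<tau>
    proof -
      have "isCont (\<lambda>y. s * Q (\<tau> *\<^sub>R y)) u" "isCont (\<lambda>y. s * P (\<tau> *\<^sub>R y)) u"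
        by (intro continuous_intros cont Q_cont P_cont)+
      then show "((\<lambda>y. s * Q (\<tau> *\<^sub>R y)) \<longlongrightarrow> s * Q (\<tau> *\<^sub>R u)) (nhds u)"
        "((\<lambda>y. s * P (\<tau> *\<^sub>R y)) \<longlongrightarrow> s * P (\<tau> *\<^sub>R u)) (nhds u)"
        by (auto dest: isCont_tendsto_nhds)
    qed
    have "\<forall>\<^sub>F y in nhds u. y \<in> K" using K_open u eventually_nhds_in_open by blast
    with order_tendstoD(1)[OF lim(1) q(1)] order_tendstoD(1)[OF lim(1) q(2)]
      order_tendstoD(2)[OF lim(2) p(1)] order_tendstoD(1)[OF lim(2) p(2)]
    show ?thesis
    proof eventually_elim
      case (elim y)
      have b: "0 < T s c y" "0 < s * Q (T s c y *\<^sub>R y)" "P (T s c y *\<^sub>R y) = c"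
        using elim T_pos T_Q T_P by auto
      have "t1 < T s c y"
      proof (rule ccontr)
        assume "\<not> ?thesis"
        then have "T s c y < t1 \<or> T s c y = t1" by auto
        then show False using P_ray_strict_mono[OF b(1) _ b(2) elim(1)] elim b by auto
      qed
      moreover have "T s c y < t2"
      proof (rule ccontr)
        assume "\<not> ?thesis"
        then have "t2 < T s c y \<or> T s c y = t2" by auto
        then show False using P_ray_strict_mono[of t2 "T s c y" s y] t b elim by auto
      qed
      ultimately show ?case using r by (simp add: t1_def t2_def dist_real_def abs_less_iff)
    qed
  qed
  then have "(T s c \<longlongrightarrow> ?t) (nhds u)" by (rule tendstoI)
  then show ?thesis using tendsto_at_iff_tendsto_nhds[of "T s c" u] by (simp add: isCont_def)
qed

lemma val_extremal:
  assumes "u \<in> K" "0 < \<tau>" "0 < s * Q (\<tau> *\<^sub>R u)"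
  shows "s * lam c (\<tau> *\<^sub>R u) \<le> s * val s c u"
  unfolding val_def using branch_extremal[OF T_branch K_A] assms by blast

text \<open>Envelope argument without differentiating \<open>T\<close>. Testing the extremum at
  \<open>y\<close> with the position for \<open>u\<close>, and the one at \<open>u\<close> with the
  position for \<open>y\<close>, encloses \<open>val s c y - val s c u\<close> between two
  increments of \<open>lam c (\<tau> *\<^sub>R x)\<close> in \<open>x\<close> at fixed \<tau>. Both
  have the same linear part up to a small error, because \<open>T\<close> is continuous.\<close>

lemma val_deriv:
  assumes u: "u \<in> K"
  shows "(val s c has_derivative blinfun_apply (val' s c u)) (at u)"
proof -
  let ?t = "T s c u"
  define G where "G z = fst z *\<^sub>R lam' c (fst z *\<^sub>R snd z)" for z :: "real \<times> 'a"
  have Au: "0 < A (\<tau> *\<^sub>R y)" if "0 < \<tau>" "y \<in> K" for \<tau> y using that K_A by (simp add: hom)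
  have open_A: "open {v. A v \<noteq> 0}" using A_cont by (intro open_Collect_neq continuous_on_const)
  have cont_fs: "isCont (\<lambda>z. fst z *\<^sub>R snd z) z" for z :: "real \<times> 'a" by (intro continuous_intros)
  have isCont_lam': "isCont (lam' c) (?t *\<^sub>R u)"
    using lam'_cont[of c] open_A Au[OF T_pos[OF u] u] by (auto simp: continuous_on_eq_continuous_at)
  have G: "isCont G (?t, u)"
    unfolding G_def
    by (intro continuous_intros isCont_o2[OF cont_fs]) (use isCont_lam' in simp)
  have Qc: "isCont (\<lambda>z. s * Q (fst z *\<^sub>R snd z)) (?t, u)"
    using Q_cont[of UNIV]
    by (intro continuous_intros isCont_o2[OF cont_fs]) (auto simp: continuous_on_eq_continuous_at)
  show ?thesis
    unfolding has_derivative_at_alt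
  proof (intro conjI allI impI)
    show "bounded_linear (blinfun_apply (val' s c u))" by (rule blinfun.bounded_linear_right)
    fix e :: real assume e: "0 < e"
    have "\<forall>\<^sub>F z in nhds (?t, u). dist (G z) (G (?t, u)) < e"
      by (rule tendstoD[OF isCont_tendsto_nhds[OF G] e])
    moreover have "\<forall>\<^sub>F z in nhds (?t, u). 0 < s * Q (fst z *\<^sub>R snd z)"
    proof (rule order_tendstoD(1))
      show "((\<lambda>z. s * Q (fst z *\<^sub>R snd z)) \<longlongrightarrow> s * Q (fst (?t, u) *\<^sub>R snd (?t, u))) (nhds (?t, u))"
        by (rule isCont_tendsto_nhds[OF Qc])
    qed (use T_Q[OF u] in simp)
    moreover have "\<forall>\<^sub>F z in nhds (?t, u). z \<in> {0<..} \<times> K"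
      by (rule eventually_nhds_in_open) (use T_pos[OF u] u K_open in \<open>simp_all add: open_Times\<close>)
    ultimately have "\<forall>\<^sub>F z in nhds (?t, u). dist (G z) (G (?t, u)) < e \<and> 0 < s * Q (fst z *\<^sub>R snd z) \<and> z \<in> {0<..} \<times> K"
      by eventually_elim simp
    then obtain d where d: "0 < d" "\<And>z. dist z (?t, u) < d \<Longrightarrow>
       dist (G z) (G (?t, u)) < e \<and> 0 < s * Q (fst z *\<^sub>R snd z) \<and> z \<in> {0<..} \<times> K"
      unfolding eventually_nhds_metric by blast
    have near: "dist (G (\<tau>, x)) (G (?t, u)) < e \<and> 0 < s * Q (\<tau> *\<^sub>R x) \<and> 0 < \<tau> \<and> x \<in> K"
      if "\<bar>\<tau> - ?t\<bar> < d / 2" "norm (x - u) < d / 2" for \<tau> x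
    proof -
      have "dist (\<tau>, x) (?t, u) \<le> \<bar>\<tau> - ?t\<bar> + norm (x - u)"
        using sqrt_sum_squares_le_sum_abs[of "dist \<tau> ?t" "dist x u"]
        by (simp add: dist_Pair_Pair dist_real_def dist_norm[of x u])
      then show ?thesis using d(2)[of "(\<tau>, x)"] that by simp
    qed
    \<comment> \<open>Mean value inequality in \<open>x\<close> at fixed \<tau>. \<open>G\<close> is
      the derivative of \<open>lam c (\<tau> *\<^sub>R x)\<close> in \<open>x\<close>, and its joint
      continuity makes the error uniform in \<tau> near \<open>?t\<close>.\<close>
    have diff: "\<bar>lam c (\<tau> *\<^sub>R y) - lam c (\<tau> *\<^sub>R u) - val' s c u (y - u)\<bar> \<le> e * norm (y - u)"
      if \<tau>: "\<bar>\<tau> - ?t\<bar> < d / 2" and y: "norm (y - u) < d / 2" for \<tau> y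
    proof -
      define g where "g x = lam c (\<tau> *\<^sub>R x) - val' s c u x" for x
      have "norm (g y - g u) \<le> e * norm (y - u)"
      proof (rule differentiable_bound[of "ball u (d / 2)" g "\<lambda>x. blinfun_apply (G (\<tau>, x) - val' s c u)"])
        fix x assume "x \<in> ball u (d / 2)"
        then have x: "norm (x - u) < d / 2" by (simp add: dist_norm norm_minus_commute)
        have n: "0 < \<tau>" "x \<in> K" "dist (G (\<tau>, x)) (G (?t, u)) < e" using near[OF \<tau> x] by auto
        have "((\<lambda>x. lam c (\<tau> *\<^sub>R x)) has_derivative (\<lambda>h. lam' c (\<tau> *\<^sub>R x) (\<tau> *\<^sub>R h))) (at x)"
          using Au[OF n(1,2)] lam_deriv[of "\<tau> *\<^sub>R x" c]
          by (intro has_derivative_compose[of "\<lambda>x. \<tau> *\<^sub>R x" _ x UNIV "lam c"]) (auto intro!: derivative_eq_intros)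
        then have "(g has_derivative (\<lambda>h. lam' c (\<tau> *\<^sub>R x) (\<tau> *\<^sub>R h) - val' s c u h)) (at x)"
          unfolding g_def by (intro derivative_intros bounded_linear_imp_has_derivative blinfun.bounded_linear_right)
        moreover have "(\<lambda>h. lam' c (\<tau> *\<^sub>R x) (\<tau> *\<^sub>R h) - val' s c u h) = blinfun_apply (G (\<tau>, x) - val' s c u)"
          by (auto simp: fun_eq_iff G_def blinfun.diff_left blinfun.scaleR_left blinfun.scaleR_right)
        ultimately show "(g has_derivative blinfun_apply (G (\<tau>, x) - val' s c u)) (at x within ball u (d / 2))"
          using has_derivative_at_withinI by metis
        show "onorm (blinfun_apply (G (\<tau>, x) - val' s c u)) \<le> e"
          using n(3) by (simp add: norm_blinfun.rep_eq[symmetric] dist_norm G_def val'_def)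
      qed (use d(1) y in \<open>auto simp: dist_norm norm_minus_commute\<close>)
      then show ?thesis by (simp add: g_def blinfun.diff_right algebra_simps)
    qed
    have "\<forall>\<^sub>F y in nhds u. dist (T s c y) ?t < d / 2"
      using d(1) by (intro tendstoD[OF isCont_tendsto_nhds[OF T_isCont[OF u]]]) simp
    then obtain d' where d': "0 < d'" "\<And>y. dist y u < d' \<Longrightarrow> dist (T s c y) ?t < d / 2"
      unfolding eventually_nhds_metric by blast
    show "\<exists>d>0. \<forall>y. norm (y - u) < d \<longrightarrow> norm (val s c y - val s c u - val' s c u (y - u)) \<le> e * norm (y - u)"
    proof (intro exI[of _ "min d' (d / 2)"] conjI allI impI)
      show "0 < min d' (d / 2)" using d d' by simp
      fix y assume "norm (y - u) < min d' (d / 2)"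
      then have y: "norm (y - u) < d / 2" "\<bar>T s c y - ?t\<bar> < d / 2"
        using d'(2)[of y] by (auto simp: dist_norm)
      have t0: "\<bar>?t - ?t\<bar> < d / 2" "norm (u - u) < d / 2" using d by auto
      have 1: "s * lam c (?t *\<^sub>R y) \<le> s * val s c y" using near[OF t0(1) y(1)] by (intro val_extremal) auto
      have 2: "s * lam c (T s c y *\<^sub>R u) \<le> s * val s c u" using near[OF y(2) t0(2)] by (intro val_extremal) auto
      have 3: "val s c y = lam c (T s c y *\<^sub>R y)" "val s c u = lam c (?t *\<^sub>R u)" by (simp_all add: val_def)
      show "norm (val s c y - val s c u - val' s c u (y - u)) \<le> e * norm (y - u)"
        using sign diff[OF t0(1) y(1)] diff[OF y(2) y(1)] 1 2 3 unfolding real_norm_def abs_le_iff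
        by (elim disjE) (auto intro: order_trans)
    qed
  qed
qed

lemma val'_cont: "continuous_on K (val' s c)"
proof -
  have Tc: "continuous_on K (T s c)" using T_isCont by (blast intro: continuous_at_imp_continuous_on)
  have "0 < A (T s c u *\<^sub>R u)" if "u \<in> K" for u using K_A[OF that] T_pos[OF that] by (simp add: hom)
  then show ?thesis
    unfolding val'_def
    by (intro continuous_intros Tc continuous_on_compose2[OF lam'_cont]) force+
qed

text \<open>Only points with nonpositive value matter, and on that sublevel
  \<open>branch_bounds\<close> controls both the position on the ray and the denominator
  \<open>A\<close>.\<close>

lemma val_lower: "bdd_below (val s c ` (K \<inter> sphere 0 1))"
proof -
  obtain \<tau>1 \<tau>2 a where b: "0 < \<tau>1" "0 < a" "\<And>u t. u \<in> K \<inter> sphere 0 1 \<Longrightarrow> branch s c u t \<Longrightarrow>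
      lam c (t *\<^sub>R u) \<le> 0 \<Longrightarrow> \<tau>1 \<le> t \<and> t \<le> \<tau>2 \<and> a \<le> A u"
    using branch_bounds[of 0] by blast
  define X where "X = \<tau>2 powr \<beta> * C / \<beta> + \<bar>c\<bar>"
  define Y where "Y = \<tau>1 powr \<alpha> * a"
  have X: "0 \<le> X" unfolding X_def using C_pos exponents_pos by (intro add_nonneg_nonneg divide_nonneg_pos mult_nonneg_nonneg) auto
  have Y: "0 < Y" using b by (simp add: Y_def)
  have "- (\<alpha> * X / Y) \<le> val s c u" if u: "u \<in> K \<inter> sphere 0 1" for u
  proof (cases "val s c u \<le> 0")
    case False
    have "0 \<le> \<alpha> * X / Y" using X Y exponents_pos by simp
    then show ?thesis using False by simp
  next
    case True
    let ?t = "T s c u"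
    have t: "\<tau>1 \<le> ?t" "?t \<le> \<tau>2" "a \<le> A u" "0 < ?t"
      using b(3)[OF u T_branch] True u T_pos by (auto simp: val_def)
    have n: "0 \<le> ?t powr \<eta> * N u / \<eta>" using N_pos[of u] u exponents_pos K_nonzero by (auto intro!: divide_nonneg_pos mult_nonneg_nonneg less_imp_le)
    have "?t powr \<beta> * B u \<le> \<tau>2 powr \<beta> * C"
      using t sphere_bounds(4)[of u] u exponents_pos C_pos
      by (intro order_trans[OF mult_left_mono[of "B u" C] mult_right_mono]) (auto intro: powr_mono2)
    then have "?t powr \<beta> * B u / \<beta> \<le> \<tau>2 powr \<beta> * C / \<beta>" using exponents_pos by (simp add: divide_right_mono)
    then have num: "- X \<le> ?t powr \<eta> * N u / \<eta> - ?t powr \<beta> * B u / \<beta> - c" using n unfolding X_def by linarith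
    have den: "Y \<le> ?t powr \<alpha> * A u" unfolding Y_def using t b exponents_pos by (intro mult_mono powr_mono2) auto
    have "val s c u = \<alpha> * (?t powr \<eta> * N u / \<eta> - ?t powr \<beta> * B u / \<beta> - c) / (?t powr \<alpha> * A u)"
      unfolding val_def by (rule ray_lam[OF t(4)])
    also have "\<dots> \<ge> \<alpha> * (- X) / (?t powr \<alpha> * A u)"
      using num den Y exponents_pos by (intro divide_right_mono mult_left_mono) auto
    also have "\<alpha> * (- X) / (?t powr \<alpha> * A u) \<ge> \<alpha> * (- X) / Y"
      using den Y X exponents_pos by (simp add: frac_le)
    finally show ?thesis by simp
  qed
  then show ?thesis by (rule bdd_belowI2)
qed

text \<open>At the points \<open>vs n = ts n *\<^sub>R us n\<close> the level of
  \<open>\<Phi>\<close> is exactly \<open>c\<close>, and its derivative is a bounded multiple of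
  \<open>val'\<close>. The assumed compactness therefore applies to \<open>vs\<close> with the
  varying parameters \<open>ls n\<close>.\<close>

lemma val_palais_smale:
  assumes us: "range us \<subseteq> K \<inter> sphere 0 1" and bdd: "bounded (range (\<lambda>n. val s c (us n)))"
    and crit: "(\<lambda>n. val' s c (us n)) \<longlonglongrightarrow> 0"
  shows "\<exists>r :: nat \<Rightarrow> nat. strict_mono r \<and> convergent (us \<circ> r)"
proof -
  define ts where "ts n = T s c (us n)" for n
  define vs where "vs n = ts n *\<^sub>R us n" for n
  define ls where "ls n = val s c (us n)" for n
  have usK: "us n \<in> K" "norm (us n) = 1" for n using us by (auto simp: image_subset_iff)
  obtain b where b: "\<And>n. ls n \<le> b" using bdd unfolding bounded_iff ls_def
    by (metis abs_le_D1 rangeI real_norm_def)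
  obtain \<tau>1 \<tau>2 a where \<tau>: "0 < \<tau>1" "\<And>u t. u \<in> K \<inter> sphere 0 1 \<Longrightarrow> branch s c u t \<Longrightarrow>
      lam c (t *\<^sub>R u) \<le> b \<Longrightarrow> \<tau>1 \<le> t \<and> t \<le> \<tau>2 \<and> a \<le> A u"
    using branch_bounds[of b] by blast
  have ts: "\<tau>1 \<le> ts n" "ts n \<le> \<tau>2" for n
    using \<tau>(2)[OF _ T_branch[OF usK(1)[of n]]] usK[of n] b[of n] by (auto simp: ts_def ls_def val_def)
  have ts0: "0 < ts n" for n using ts(1)[of n] \<tau>(1) by simp
  have nv: "norm (vs n) = ts n" for n using usK ts0[of n] by (simp add: vs_def)
  have Av: "0 < A (vs n)" for n using K_A[OF usK(1)[of n]] ts0[of n] by (simp add: vs_def hom)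
  have ls: "ls n = lam c (vs n)" for n by (simp add: ls_def val_def vs_def ts_def)
  have "\<exists>r :: nat \<Rightarrow> nat. strict_mono r \<and> convergent (vs \<circ> r)"
  proof (rule compactness[unfolded compactness_condition_def, rule_format])
    show "bounded (range ls)" using bdd by (simp add: ls_def)
    show "bounded (range vs)" unfolding bounded_iff using nv ts(2) by auto
    have "\<Phi> (ls n) (vs n) = c" for n unfolding ls using Av[of n] by (simp add: Phi_value)
    then show "bounded (range (\<lambda>n. \<Phi> (ls n) (vs n)))" by simp
    have eq: "dual_deriv (\<Phi> (ls n)) (vs n) = (A (vs n) / (\<alpha> * ts n)) *\<^sub>R val' s c (us n)" for n
      unfolding ls using Av[of n] ts0[of n] by (subst Phi_deriv) (auto simp: val'_def vs_def ts_def)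
    have "norm (dual_deriv (\<Phi> (ls n)) (vs n)) \<le> C * \<tau>2 powr \<alpha> / (\<alpha> * \<tau>1) * norm (val' s c (us n))" for n
    proof -
      have "ts n powr \<alpha> \<le> \<tau>2 powr \<alpha>" using ts[of n] ts0[of n] exponents_pos by (intro powr_mono2) auto
      then have "C * ts n powr \<alpha> \<le> C * \<tau>2 powr \<alpha>" using C_pos by simp
      then have "A (vs n) \<le> C * \<tau>2 powr \<alpha>" using A_bound[of "vs n"] unfolding nv by linarith
      then have "A (vs n) / (\<alpha> * ts n) \<le> C * \<tau>2 powr \<alpha> / (\<alpha> * \<tau>1)"
        using Av[of n] ts[of n] \<tau>(1) exponents_pos C_pos by (intro frac_le mult_left_mono) auto
      then show ?thesis unfolding eq norm_scaleR using Av[of n] ts0[of n] exponents_pos by (intro mult_right_mono) auto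
    qed
    then show "(\<lambda>n. dual_deriv (\<Phi> (ls n)) (vs n)) \<longlonglongrightarrow> 0"
      by (intro Lim_null_comparison[OF always_eventually tendsto_mult_right_zero[OF tendsto_norm_zero[OF crit]]]) blast
  qed
  then obtain r v where r: "strict_mono (r :: nat \<Rightarrow> nat)" "(\<lambda>n. vs (r n)) \<longlonglongrightarrow> v" by (auto simp: convergent_def o_def)
  \<comment> \<open>Since \<open>us n\<close> is a unit vector, \<open>ts n\<close> is the norm of
    \<open>vs n\<close>; its limit is at least \<open>\<tau>1 > 0\<close>, so convergence passes
    back to the directions.\<close>
  have "(\<lambda>n. ts (r n)) \<longlonglongrightarrow> norm v" using tendsto_norm[OF r(2)] by (simp add: nv)
  moreover from this have "\<tau>1 \<le> norm v" using ts by (intro LIMSEQ_le_const) auto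
  ultimately have "(\<lambda>n. inverse (ts (r n)) *\<^sub>R vs (r n)) \<longlonglongrightarrow> inverse (norm v) *\<^sub>R v"
    using \<tau>(1) r(2) by (intro tendsto_intros) auto
  moreover have "inverse (ts (r n)) *\<^sub>R vs (r n) = us (r n)" for n using ts0[of "r n"] by (simp add: vs_def)
  ultimately show ?thesis using r(1) by (auto simp: convergent_def o_def)
qed

lemma even_cone_functional: "even_cone_functional K (val s c) (val' s c)"
proof
  show "0 \<notin> K" using K_nonzero by blast
  show "val s c (t *\<^sub>R u) = val s c u" if "u \<in> K" "0 < t" for u t
    using that by (simp add: val_def T_scale)
  show "val s c (- u) = val s c u" if "u \<in> K" for u
    using that by (simp add: val_def T_minus lam_def even)
  show "u \<in> K" if "range us \<subseteq> K \<inter> sphere 0 1" "us \<longlonglongrightarrow> u" "\<And>n. val s c (us n) \<le> b" for us u b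
    using that(3) T_branch that(1)
    by (intro branch_closed[OF that(1,2), of "\<lambda>n. T s c (us n)" b]) (auto simp: val_def image_subset_iff)
qed (use K_open K_scale K_neg val_deriv val'_cont val_lower val_palais_smale in blast)+

lemma critical_point:
  assumes u: "u \<in> K" and crit: "val' s c u = 0"
  obtains v where "v = T s c u *\<^sub>R u" "v \<in> K" "0 < s * Q v" "P v = c"
    "\<Phi> (val s c u) v = c" "dual_deriv (\<Phi> (val s c u)) v = 0"
proof -
  let ?v = "T s c u *\<^sub>R u"
  have v: "?v \<in> K" by (rule K_scale[OF u T_pos[OF u]])
  then have A: "A ?v \<noteq> 0" using K_A[OF v] by simp
  have "lam' c ?v = 0" using crit T_pos[OF u] by (simp add: val'_def)
  then have "dual_deriv (\<Phi> (val s c u)) ?v = 0"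
    unfolding val_def by (simp add: Phi_deriv[OF A])
  then show ?thesis
    using that[OF refl v T_Q[OF u] T_P[OF u]] Phi_value[OF A] by (simp add: val_def)
qed

end

section \<open>A priori bounds on the two branches\<close>

context fibering_problem
begin

abbreviation KAB :: "'a set" where "KAB \<equiv> pos_cone A \<inter> pos_cone B"

text \<open>The coefficient in the splitting \<open>P = Q / \<beta> - \<kappa> * N\<close> of
  \<open>P_eq_Q\<close>, which turns nonpositivity of \<open>Q\<close> into a negative upper bound
  for \<open>P\<close>.\<close>

definition \<kappa> :: real where "\<kappa> = (\<eta> - \<alpha>) * (\<beta> - \<eta>) / (\<alpha> * \<eta> * \<beta>)"

text \<open>On unit vectors \<open>Q (t u) < 0\<close> for all \<open>t \<le> \<tau>\<close>.\<close>

definition \<tau> :: real where "\<tau> = ((\<eta> - \<alpha>) / (2 * C\<^sup>2 * (\<beta> - \<alpha>))) powr (1 / (\<beta> - \<eta>))"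

text \<open>The bound \<open>- \<kappa> * N\<close> at unit directions and
  \<open>t = \<tau> / 2\<close>, with \<open>N\<close> replaced by its least possible value. Taking
  \<tau>/2 instead of \<tau> leaves the interval between them, on which \<open>P\<close> is at most
  \<open>cs\<close>; the strict inequality between the two families is gained there.\<close>

definition cs :: real where "cs = - (\<kappa> * inverse C * (\<tau> / 2) powr \<eta>)"

lemma \<kappa>_pos: "0 < \<kappa>" and \<tau>_pos: "0 < \<tau>" and cs_neg: "cs < 0"
proof -
  show "0 < \<kappa>" using exponents_pos by (simp add: \<kappa>_def)
  moreover show "0 < \<tau>" using exponents_pos C_pos by (simp add: \<tau>_def)
  ultimately show "cs < 0" using C_pos by (simp add: cs_def)
qed

lemma P_eq_Q: "P v = Q v / \<beta> - \<kappa> * N v"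
proof -
  have "(\<eta> - \<alpha>) / (\<alpha> * \<eta>) = (\<eta> - \<alpha>) / \<alpha> / \<beta> + \<kappa>"
    using exponents_pos by (simp add: \<kappa>_def field_simps)
  moreover have "(\<beta> - \<alpha>) / (\<alpha> * \<beta>) = (\<beta> - \<alpha>) / \<alpha> / \<beta>" by simp
  moreover have "z / \<beta> * b - (w / \<beta> + \<kappa>) * n = (z * b - w * n) / \<beta> - \<kappa> * n" for z w b n
    by (simp add: diff_divide_distrib distrib_right)
  ultimately show ?thesis unfolding P_def Q_def by metis
qed

lemma P_le_of_Q_nonpos: "Q v \<le> 0 \<Longrightarrow> P v \<le> - \<kappa> * N v"
  using exponents_pos by (simp add: P_eq_Q divide_nonpos_pos)

lemma lam_eq_quotient:
  assumes "P v = c" shows "lam c v = (N v - B v) / A v"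
proof -
  have "\<alpha> * (N v / \<eta> - B v / \<beta> - P v) = N v - B v"
    unfolding P_def using exponents_pos by (simp add: field_simps)
  then show ?thesis using assms by (simp add: lam_def)
qed

text \<open>On the level set the term \<open>B\<close> is eliminated in favour of \<open>N\<close>
  and \<open>c\<close>. For \<open>c < 0\<close> both remaining terms are positive, and for general
  \<open>c\<close> the growth in \<open>N\<close> gives coercivity.\<close>

lemma lam_eq_level:
  assumes "P v = c"
  shows "lam c v = \<alpha> / (\<beta> - \<alpha>) * ((\<beta> - \<eta>) / \<eta> * N v - \<beta> * c) / A v"
proof -
  have "N v - B v = \<alpha> / (\<beta> - \<alpha>) * ((\<beta> - \<eta>) / \<eta> * N v - \<beta> * P v)"
    unfolding P_def using exponents_pos by (simp add: field_simps)
  then show ?thesis using assms by (simp add: lam_eq_quotient)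
qed

lemma Q_neg:
  assumes u: "norm u = 1" and t: "0 < t" "t \<le> \<tau>"
  shows "Q (t *\<^sub>R u) < 0"
proof -
  \<comment> \<open>On a unit ray \<open>N\<close> is at least 1/C and \<open>B\<close> at most C,
    so a zero of \<open>Q\<close> satisfies \<open>t powr (\<beta> - \<eta>) \<ge> (\<eta> -
    \<alpha>) / (C\<^sup>2 * (\<beta> - \<alpha>))\<close>. The additional factor 2 in \<tau> makes
    the inequality strict.\<close>
  have "t powr (\<beta> - \<eta>) \<le> \<tau> powr (\<beta> - \<eta>)" using t exponents_pos by (intro powr_mono2) auto
  also have "\<dots> = (\<eta> - \<alpha>) / (2 * C\<^sup>2 * (\<beta> - \<alpha>))"
    using exponents_pos C_pos by (simp add: \<tau>_def powr_powr)
  finally have "(\<beta> - \<alpha>) * (C * t powr (\<beta> - \<eta>)) \<le> (\<beta> - \<alpha>) * (C * ((\<eta> - \<alpha>) / (2 * C\<^sup>2 * (\<beta> - \<alpha>))))"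
    using exponents_pos C_pos by (intro mult_left_mono) auto
  also have "\<dots> = (\<eta> - \<alpha>) * inverse C / 2"
    using exponents_pos C_pos by (simp add: field_simps power2_eq_square)
  also have "\<dots> < (\<eta> - \<alpha>) * inverse C" using exponents_pos C_pos by simp
  also have "\<dots> \<le> (\<eta> - \<alpha>) * N u" using sphere_bounds[OF u] exponents_pos by (intro mult_left_mono) auto
  finally have 1: "(\<beta> - \<alpha>) * (C * t powr (\<beta> - \<eta>)) < (\<eta> - \<alpha>) * N u" .
  have "B u * t powr (\<beta> - \<eta>) \<le> C * t powr (\<beta> - \<eta>)"
    using sphere_bounds(4)[OF u] by (intro mult_right_mono) auto
  then have "(\<beta> - \<alpha>) * (B u * t powr (\<beta> - \<eta>)) \<le> (\<beta> - \<alpha>) * (C * t powr (\<beta> - \<eta>))"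
    using exponents_pos by (intro mult_left_mono) auto
  then have "(\<beta> - \<alpha>) * (B u * t powr (\<beta> - \<eta>)) < (\<eta> - \<alpha>) * N u" using 1 by linarith
  then have "((\<beta> - \<alpha>) * (B u * t powr (\<beta> - \<eta>)) - (\<eta> - \<alpha>) * N u) / \<alpha> < 0"
    using exponents_pos by (intro divide_neg_pos) auto
  then have "(\<beta> - \<alpha>) / \<alpha> * B u * t powr (\<beta> - \<eta>) - (\<eta> - \<alpha>) / \<alpha> * N u < 0"
    by (simp only: diff_divide_distrib[of "_ * _" "_ * _"] times_divide_eq_left mult.assoc)
  then show ?thesis unfolding ray_Q_factor[OF t(1)] using t(1) by (simp add: mult_less_0_iff)
qed

lemma P_le_cs:
  assumes u: "norm u = 1" and t: "\<tau> / 2 \<le> t" "Q (t *\<^sub>R u) \<le> 0"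
  shows "P (t *\<^sub>R u) \<le> cs"
proof -
  have t0: "0 < t" using t \<tau>_pos by linarith
  have "inverse C * (\<tau> / 2) powr \<eta> \<le> N u * t powr \<eta>"
    using sphere_bounds[OF u] N_pos[of u] u t \<tau>_pos exponents_pos by (intro mult_mono powr_mono2) force+
  then have "\<kappa> * (inverse C * (\<tau> / 2) powr \<eta>) \<le> \<kappa> * N (t *\<^sub>R u)"
    using \<kappa>_pos t0 by (simp add: hom mult.commute)
  then show ?thesis using P_le_of_Q_nonpos[OF t(2)] by (simp add: cs_def mult.assoc)
qed

lemma P_ray_cont: "continuous_on S (\<lambda>t. P (t *\<^sub>R u))"
  by (rule continuous_on_compose2[OF P_cont[of UNIV]]) (auto intro!: continuous_intros)

text \<open>\<open>P\<close> starts at 0, above \<open>c\<close>, and has reached at most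
  \<open>cs\<close>, below \<open>c\<close>, at \<tau>; the whole interval lies in the region of
  negative \<open>Q\<close>. The sign of \<open>B u\<close> is irrelevant for this.\<close>

lemma ex_plus_branch:
  assumes u: "norm u = 1" and c: "cs < c" "c < 0"
  obtains t where "branch (-1) c u t" "t \<le> \<tau>"
proof -
  have "P (\<tau> *\<^sub>R u) \<le> c" using P_le_cs[OF u, of \<tau>] Q_neg[OF u \<tau>_pos] \<tau>_pos c by force
  moreover have "P (0 *\<^sub>R u) = 0" by (simp add: P_def zero_values)
  ultimately obtain t where t: "0 \<le> t" "t \<le> \<tau>" "P (t *\<^sub>R u) = c"
    using IVT2'[of "\<lambda>t. P (t *\<^sub>R u)" \<tau> c 0] c \<tau>_pos P_ray_cont by auto
  moreover have "t \<noteq> 0" using t c by (auto simp: P_def zero_values)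
  ultimately have "branch (-1) c u t" using Q_neg[OF u, of t] by (auto simp: branch_def)
  then show ?thesis using t(2) by (rule that)
qed

lemma plus_branch_le:
  assumes "norm u = 1" "cs < c" "c < 0" "branch (-1) c u t" shows "t \<le> \<tau>"
  using ex_plus_branch[OF assms(1-3)] branch_unique[OF assms(4)] by metis

lemma minus_branch_ge:
  assumes "norm u = 1" "branch 1 c u t" shows "\<tau> \<le> t"
  using Q_neg[OF assms(1), of t] assms(2) by (force simp: branch_def)

text \<open>The zero \<open>t0\<close> of \<open>Q\<close> on the ray lies beyond \<tau>, so
  \<open>P\<close> is at most \<open>cs\<close> there. After \<open>t0\<close> it increases to
  infinity because \<open>B u > 0\<close>, and it meets every level \<open>c > cs\<close>.\<close>

lemma ex_minus_branch:
  assumes u: "norm u = 1" and B: "0 < B u" and c: "cs < c"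
  shows "\<exists>t. branch 1 c u t"
proof -
  define x y where "x = (\<beta> - \<alpha>) / \<alpha> * B u" and "y = (\<eta> - \<alpha>) / \<alpha> * N u"
  have N: "0 < N u" using u N_pos[of u] by force
  have xy: "0 < x" "0 < y" using exponents_pos N B by (simp_all add: x_def y_def)
  have Q_eq: "Q (t *\<^sub>R u) = t powr \<eta> * (x * t powr (\<beta> - \<eta>) - y)" if "0 < t" for t
    using ray_Q_factor[OF that] by (simp add: x_def y_def)
  define t0 where "t0 = (y / x) powr (1 / (\<beta> - \<eta>))"
  have t0: "0 < t0" "t0 powr (\<beta> - \<eta>) = y / x" using xy exponents_pos by (simp_all add: t0_def powr_powr)
  have Qt0: "Q (t0 *\<^sub>R u) = 0" using xy t0 by (simp add: Q_eq)
  then have "\<tau> < t0" using Q_neg[OF u t0(1)] by force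
  then have low: "P (t0 *\<^sub>R u) < c" using P_le_cs[OF u, of t0] Qt0 \<tau>_pos c by force
  \<comment> \<open>The three entries ensure in turn \<open>R \<ge> 1\<close>,
    \<open>R \<ge> t0\<close>, and that the bracket left after factoring
    \<open>R powr \<eta>\<close> out of \<open>P (R *\<^sub>R u)\<close> is at least
    \<open>\<bar>c\<bar>\<close>.\<close>
  define w where "w = max (max 1 (y / x)) ((y / \<eta> + \<bar>c\<bar>) / (x / \<beta>))"
  define R where "R = w powr (1 / (\<beta> - \<eta>))"
  have w: "1 \<le> w" "y / x \<le> w" "(y / \<eta> + \<bar>c\<bar>) / (x / \<beta>) \<le> w" by (auto simp: w_def)
  have R: "1 \<le> R" "R powr (\<beta> - \<eta>) = w" using w exponents_pos by (simp_all add: R_def powr_powr ge_one_powr_ge_zero)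
  have "t0 \<le> R" unfolding t0_def R_def using w xy exponents_pos by (intro powr_mono2) auto
  have "P (R *\<^sub>R u) = R powr \<eta> * (x / \<beta> * R powr (\<beta> - \<eta>) - y / \<eta>)"
    using R(1) exponents_pos powr_add[of R \<eta> "\<beta> - \<eta>"] by (simp add: ray_P x_def y_def right_diff_distrib mult_ac)
  moreover have "\<bar>c\<bar> \<le> x / \<beta> * R powr (\<beta> - \<eta>) - y / \<eta>"
    using w(3) xy exponents_pos unfolding R(2) by (simp add: field_simps)
  moreover have "1 \<le> R powr \<eta>" using R(1) exponents_pos by (simp add: ge_one_powr_ge_zero)
  ultimately have "1 * \<bar>c\<bar> \<le> P (R *\<^sub>R u)" by (simp only:) (intro mult_mono, auto)
  then have "c \<le> P (R *\<^sub>R u)" by linarith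
  then obtain t where t: "t0 \<le> t" "t \<le> R" "P (t *\<^sub>R u) = c"
    using IVT'[of "\<lambda>t. P (t *\<^sub>R u)" t0 c R] low \<open>t0 \<le> R\<close> P_ray_cont by auto
  then have "t0 < t" using low by (cases "t = t0") auto
  then have "t0 powr (\<beta> - \<eta>) < t powr (\<beta> - \<eta>)" using t0 exponents_pos by (intro powr_less_mono2) auto
  then have "0 < Q (t *\<^sub>R u)" using \<open>t0 < t\<close> t0 xy by (simp add: Q_eq field_simps)
  then show ?thesis using t \<open>t0 < t\<close> t0 by (intro exI[of _ t]) (auto simp: branch_def)
qed

text \<open>For \<open>t\<close> up to \<tau> the level obeys
  \<open>- P (t *\<^sub>R u) \<le> M * t powr \<eta>\<close>, so a level below \<open>c2 < 0\<close>
  forces \<open>t\<close> away from 0. The numerator in \<open>lam_eq_level\<close> is then bounded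
  below by a positive constant, and \<open>lam \<le> b\<close> keeps \<open>A u\<close> away from 0.
  Uniformity in \<open>c\<close> serves the Lipschitz estimate.\<close>

lemma plus_bounds:
  assumes c2: "c2 < 0"
  obtains \<tau>1 a where "0 < \<tau>1" "0 < a"
    "\<And>c u t. cs < c \<Longrightarrow> c \<le> c2 \<Longrightarrow> norm u = 1 \<Longrightarrow> 0 < A u \<Longrightarrow> branch (-1) c u t \<Longrightarrow>
       lam c (t *\<^sub>R u) \<le> b \<Longrightarrow> \<tau>1 \<le> t \<and> t \<le> \<tau> \<and> a \<le> A u"
proof -
  define M where "M = (\<beta> - \<alpha>) / (\<alpha> * \<beta>) * C * \<tau> powr (\<beta> - \<eta>) + (\<eta> - \<alpha>) / (\<alpha> * \<eta>) * C'"
  define \<tau>1 where "\<tau>1 = (- c2 / M) powr (1 / \<eta>)"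
  define a where "a = \<alpha> / (\<beta> - \<alpha>) * (\<beta> * - c2) / (\<tau> powr \<alpha> * max b 1)"
  have M: "0 < M" using exponents_pos C_pos \<tau>_pos by (auto simp: M_def intro!: add_pos_pos)
  show ?thesis
  proof (rule that[of \<tau>1 a])
    show "0 < \<tau>1" using M c2 by (simp add: \<tau>1_def)
    show "0 < a" using exponents_pos c2 \<tau>_pos unfolding a_def by (intro divide_pos_pos mult_pos_pos) auto
    fix c u t assume c: "cs < c" "c \<le> c2" and u: "norm u = 1" "0 < A u" and br: "branch (-1) c u t"
      and b: "lam c (t *\<^sub>R u) \<le> b"
    have t: "0 < t" "P (t *\<^sub>R u) = c" using br by (auto simp: branch_def)
    have t\<tau>: "t \<le> \<tau>" using plus_branch_le[OF u(1) c(1) _ br] c c2 by simp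
    have 1: "t powr \<beta> \<le> \<tau> powr (\<beta> - \<eta>) * t powr \<eta>"
    proof -
      have "t powr (\<beta> - \<eta>) \<le> \<tau> powr (\<beta> - \<eta>)" using t t\<tau> exponents_pos by (intro powr_mono2) auto
      then have "t powr (\<beta> - \<eta>) * t powr \<eta> \<le> \<tau> powr (\<beta> - \<eta>) * t powr \<eta>" by (intro mult_right_mono) auto
      then show ?thesis by (simp add: powr_add[symmetric])
    qed
    have "- B u * t powr \<beta> \<le> C * (\<tau> powr (\<beta> - \<eta>) * t powr \<eta>)"
      using sphere_bounds(4)[OF u(1)] 1 C_pos by (intro mult_mono) auto
    then have 2: "(\<beta> - \<alpha>) / (\<alpha> * \<beta>) * (- B u * t powr \<beta>) \<le> (\<beta> - \<alpha>) / (\<alpha> * \<beta>) * (C * (\<tau> powr (\<beta> - \<eta>) * t powr \<eta>))"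
      using exponents_pos by (intro mult_left_mono) auto
    have "N u * t powr \<eta> \<le> C' * t powr \<eta>"
      using sphere_bounds(2)[OF u(1)] by (intro mult_right_mono) auto
    then have 3: "(\<eta> - \<alpha>) / (\<alpha> * \<eta>) * (N u * t powr \<eta>) \<le> (\<eta> - \<alpha>) / (\<alpha> * \<eta>) * (C' * t powr \<eta>)"
      using exponents_pos by (intro mult_left_mono) auto
    have "- c = (\<beta> - \<alpha>) / (\<alpha> * \<beta>) * (- B u * t powr \<beta>) + (\<eta> - \<alpha>) / (\<alpha> * \<eta>) * (N u * t powr \<eta>)"
      using ray_P[OF t(1), of u] t(2) by (simp add: mult.assoc)
    also have "\<dots> \<le> M * t powr \<eta>" using 2 3 by (simp add: M_def distrib_right mult.assoc)
    finally have "- c2 \<le> t powr \<eta> * M" using c(2) by (simp add: mult.commute)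
    then have "- c2 / M \<le> t powr \<eta>" by (simp only: pos_divide_le_eq[OF M])
    then have "\<tau>1 \<le> (t powr \<eta>) powr (1 / \<eta>)"
      unfolding \<tau>1_def using M c2 exponents_pos by (intro powr_mono2) (auto intro: divide_nonpos_pos)
    then have t1: "\<tau>1 \<le> t" using t exponents_pos by (simp add: powr_powr)
    have Av: "0 < A (t *\<^sub>R u)" "A (t *\<^sub>R u) \<le> \<tau> powr \<alpha> * A u"
      using t u t\<tau> exponents_pos by (auto simp: hom intro!: mult_right_mono powr_mono2)
    have Nv: "0 \<le> (\<beta> - \<eta>) / \<eta> * N (t *\<^sub>R u)"
      using N_pos[of "t *\<^sub>R u"] u t exponents_pos by (cases "u = 0") auto
    have "\<beta> * - c2 \<le> \<beta> * - c" using c exponents_pos by simp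
    then have "\<beta> * - c2 \<le> (\<beta> - \<eta>) / \<eta> * N (t *\<^sub>R u) - \<beta> * c" using Nv by linarith
    then have "\<alpha> / (\<beta> - \<alpha>) * (\<beta> * - c2) / A (t *\<^sub>R u) \<le> lam c (t *\<^sub>R u)"
      unfolding lam_eq_level[OF t(2)] using Av exponents_pos by (intro divide_right_mono mult_left_mono) auto
    \<comment> \<open>\<open>b\<close> is arbitrary and may be nonpositive; a positive substitute is
      needed to divide by it.\<close>
    also have "\<dots> \<le> max b 1" using b by simp
    finally have "\<alpha> / (\<beta> - \<alpha>) * (\<beta> * - c2) \<le> max b 1 * A (t *\<^sub>R u)"
      unfolding pos_divide_le_eq[OF Av(1)] .
    also have "\<dots> \<le> max b 1 * (\<tau> powr \<alpha> * A u)" using Av by (intro mult_left_mono) auto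
    finally have "a \<le> A u" unfolding a_def using \<tau>_pos by (subst divide_le_eq) (auto simp: mult_ac)
    then show "\<tau>1 \<le> t \<and> t \<le> \<tau> \<and> a \<le> A u" using t1 t\<tau> by simp
  qed
qed

text \<open>A sequence of unit vectors with \<open>A\<close> tending to 0 would have
  \<open>B\<close> tending to 0 by the hypothesis on the boundary of the cone, against
  \<open>b0 \<le> B\<close>.\<close>

lemma A_lower_bound:
  assumes b0: "0 < b0"
  obtains a where "0 < a" "\<And>u. norm u = 1 \<Longrightarrow> 0 < A u \<Longrightarrow> b0 \<le> B u \<Longrightarrow> a \<le> A u"
proof (rule ccontr)
  assume "\<not> thesis"
  then have "\<exists>u. norm u = 1 \<and> 0 < A u \<and> b0 \<le> B u \<and> A u < inverse (real (Suc n))" for n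
    using that[of "inverse (real (Suc n))"] by force
  then obtain us where us: "\<And>n. norm (us n) = 1" "\<And>n. 0 < A (us n)" "\<And>n. b0 \<le> B (us n)"
    "\<And>n. A (us n) < inverse (real (Suc n))" by metis
  have "(\<lambda>n. A (us n)) \<longlonglongrightarrow> 0"
    by (rule tendsto_sandwich[OF _ _ tendsto_const LIMSEQ_inverse_real_of_nat])
      (use us(2,4) in \<open>auto intro!: always_eventually less_imp_le\<close>)
  moreover have "bounded (range us)" unfolding bounded_iff using us(1) by auto
  moreover have "range us \<subseteq> pos_cone A" using us(2) by (auto simp: pos_cone_def)
  ultimately have "(\<lambda>n. B (us n)) \<longlonglongrightarrow> 0" by (intro boundary)
  then have "b0 \<le> 0" using us(3) by (intro LIMSEQ_le_const) auto
  then show False using b0 by simp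
qed

text \<open>By \<open>lam_eq_level\<close>, \<open>lam \<le> b\<close> yields
  \<open>p * t powr \<eta> \<le> q + r * t powr \<alpha>\<close>, which bounds \<open>t\<close>
  since \<alpha> < \<eta>. Positivity of \<open>Q\<close> at a bounded \<open>t\<close> then bounds
  \<open>B u\<close> from below, and this in turn bounds \<open>A u\<close>.\<close>

lemma minus_bounds:
  obtains \<tau>2 a b0 where "0 < a" "0 < b0"
    "\<And>c u t. c \<le> c2 \<Longrightarrow> norm u = 1 \<Longrightarrow> 0 < A u \<Longrightarrow> 0 < B u \<Longrightarrow> branch 1 c u t \<Longrightarrow>
       lam c (t *\<^sub>R u) \<le> b \<Longrightarrow> \<tau> \<le> t \<and> t \<le> \<tau>2 \<and> a \<le> A u \<and> b0 \<le> B u"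
proof -
  define p q r where "p = (\<beta> - \<eta>) / \<eta> * inverse C" and "q = \<beta> * \<bar>c2\<bar>"
    and "r = (\<beta> - \<alpha>) / \<alpha> * (\<bar>b\<bar> * C)"
  define \<tau>2 where "\<tau>2 = max 1 (((q + r) / p) powr (1 / (\<eta> - \<alpha>)))"
  define b0 where "b0 = (\<eta> - \<alpha>) * inverse C / ((\<beta> - \<alpha>) * \<tau>2 powr (\<beta> - \<eta>))"
  have p: "0 < p" using exponents_pos C_pos by (simp add: p_def)
  have qr: "0 \<le> q" "0 \<le> r" using exponents_pos C_pos by (simp_all add: q_def r_def)
  have \<tau>2: "1 \<le> \<tau>2" by (simp add: \<tau>2_def)
  have b0: "0 < b0" using exponents_pos C_pos \<tau>2 by (auto simp: b0_def)
  obtain a where a: "0 < a" "\<And>u. norm u = 1 \<Longrightarrow> 0 < A u \<Longrightarrow> b0 \<le> B u \<Longrightarrow> a \<le> A u"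
    by (rule A_lower_bound[OF b0]) blast
  show ?thesis
  proof (rule that[OF a(1) b0, of \<tau>2])
    fix c u t assume c: "c \<le> c2" and u: "norm u = 1" "0 < A u" "0 < B u" and br: "branch 1 c u t"
      and b: "lam c (t *\<^sub>R u) \<le> b"
    have t: "0 < t" "P (t *\<^sub>R u) = c" "0 < Q (t *\<^sub>R u)" using br by (auto simp: branch_def)
    have Av: "0 < A (t *\<^sub>R u)" "A (t *\<^sub>R u) \<le> C * t powr \<alpha>"
      using t u sphere_bounds(3)[OF u(1)] by (auto simp: hom mult.commute)
    have "\<alpha> / (\<beta> - \<alpha>) * ((\<beta> - \<eta>) / \<eta> * N (t *\<^sub>R u) - \<beta> * c) \<le> b * A (t *\<^sub>R u)"
      using b unfolding lam_eq_level[OF t(2)] pos_divide_le_eq[OF Av(1)] .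
    also have "\<dots> \<le> \<bar>b\<bar> * (C * t powr \<alpha>)" using Av by (intro mult_mono) auto
    finally have "(\<beta> - \<eta>) / \<eta> * N (t *\<^sub>R u) - \<beta> * c \<le> r * t powr \<alpha>"
      using exponents_pos by (simp add: r_def field_simps)
    moreover have "p * t powr \<eta> \<le> (\<beta> - \<eta>) / \<eta> * N (t *\<^sub>R u)"
    proof -
      have "inverse C * t powr \<eta> \<le> N u * t powr \<eta>" using sphere_bounds(1)[OF u(1)] by (intro mult_right_mono) auto
      then show ?thesis
        unfolding p_def hom(1)[OF t(1)] mult.assoc using exponents_pos by (intro mult_left_mono) (auto simp: mult.commute)
    qed
    moreover have "\<beta> * c \<le> q" using c exponents_pos by (auto simp: q_def)
    ultimately have main: "p * t powr \<eta> \<le> q + r * t powr \<alpha>" by linarith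
    have t2: "t \<le> \<tau>2"
    proof (cases "t \<le> 1")
      case False
      then have "1 \<le> t powr \<alpha>" using exponents_pos by (simp add: ge_one_powr_ge_zero)
      then have "q \<le> q * t powr \<alpha>" using qr by (simp add: mult_le_cancel_left1)
      then have "p * t powr \<eta> \<le> (q + r) * t powr \<alpha>" using main by (simp add: distrib_right)
      then have "t powr (\<eta> - \<alpha>) \<le> (q + r) / p" using p t by (simp add: powr_diff field_simps)
      then have "(t powr (\<eta> - \<alpha>)) powr (1 / (\<eta> - \<alpha>)) \<le> ((q + r) / p) powr (1 / (\<eta> - \<alpha>))"
        using exponents_pos by (intro powr_mono2) auto
      then show ?thesis using t exponents_pos by (simp add: powr_powr \<tau>2_def)
    qed (use \<tau>2 in simp)
    have "t powr (\<beta> - \<eta>) \<le> \<tau>2 powr (\<beta> - \<eta>)" using t t2 exponents_pos by (intro powr_mono2) auto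
    then have 1: "(\<beta> - \<alpha>) * (B u * t powr (\<beta> - \<eta>)) \<le> (\<beta> - \<alpha>) * (B u * \<tau>2 powr (\<beta> - \<eta>))"
      using u exponents_pos by (intro mult_left_mono) auto
    \<comment> \<open>In a point with positive \<open>Q\<close> the \<open>B\<close>-term dominates
      the \<open>N\<close>-term, and the latter is at least a constant on unit directions.\<close>
    have "0 < (\<beta> - \<alpha>) / \<alpha> * B u * t powr (\<beta> - \<eta>) - (\<eta> - \<alpha>) / \<alpha> * N u"
      using t(3) t(1) unfolding ray_Q_factor[OF t(1)] by (simp add: zero_less_mult_iff)
    then have "0 < ((\<beta> - \<alpha>) * (B u * t powr (\<beta> - \<eta>)) - (\<eta> - \<alpha>) * N u) / \<alpha>"
      by (simp only: diff_divide_distrib[of "_ * _" "_ * _"] times_divide_eq_left mult.assoc)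
    then have "(\<eta> - \<alpha>) * N u < (\<beta> - \<alpha>) * (B u * t powr (\<beta> - \<eta>))"
      using exponents_pos by (simp add: zero_less_divide_iff)
    moreover have "(\<eta> - \<alpha>) * inverse C \<le> (\<eta> - \<alpha>) * N u"
      using sphere_bounds(1)[OF u(1)] exponents_pos by (intro mult_left_mono) auto
    ultimately have "(\<eta> - \<alpha>) * inverse C \<le> B u * ((\<beta> - \<alpha>) * \<tau>2 powr (\<beta> - \<eta>))" using 1 by (simp add: mult_ac)
    then have B: "b0 \<le> B u" unfolding b0_def using exponents_pos \<tau>2 by (subst divide_le_eq) auto
    show "\<tau> \<le> t \<and> t \<le> \<tau>2 \<and> a \<le> A u \<and> b0 \<le> B u"
      using t2 B a(2)[OF u(1,2) B] minus_branch_ge[OF u(1) br] by simp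
  qed
qed

section \<open>The two branches on their cones\<close>

lemma pos_cone_A_props:
  "open (pos_cone A)" "u \<in> pos_cone A \<Longrightarrow> 0 < t \<Longrightarrow> t *\<^sub>R u \<in> pos_cone A" "u \<in> pos_cone A \<Longrightarrow> - u \<in> pos_cone A"
  "0 \<notin> pos_cone A"
  using open_Collect_less[of "\<lambda>_. 0" A] A_cont by (auto simp: pos_cone_def hom even zero_values)

lemma pos_cone_B_props:
  "open (pos_cone B)" "u \<in> pos_cone B \<Longrightarrow> 0 < t \<Longrightarrow> t *\<^sub>R u \<in> pos_cone B" "u \<in> pos_cone B \<Longrightarrow> - u \<in> pos_cone B"
  using open_Collect_less[of "\<lambda>_. 0" B] B_cont by (auto simp: pos_cone_def hom even)

lemma seq_limit_ge:
  fixes f :: "'a \<Rightarrow> real"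
  assumes "continuous_on UNIV f" "us \<longlonglongrightarrow> u" "\<And>n. a \<le> f (us n)" shows "a \<le> f u"
proof (rule LIMSEQ_le_const)
  show "(\<lambda>n. f (us n)) \<longlonglongrightarrow> f u" using continuous_on_tendsto_compose[OF assms(1,2)] by simp
qed (use assms in auto)

lemma plus_fibering_branch:
  assumes c: "cs < c" "c < 0"
  shows "fibering_branch N A B N' A' B' \<alpha> \<eta> \<beta> C C' (-1) c (pos_cone A)"
proof
  show "\<exists>t. branch (-1) c u t" if "u \<in> pos_cone A \<inter> sphere 0 1" for u
    using ex_plus_branch[OF _ c, of u] that by auto
  show "\<exists>\<tau>1>0. \<exists>\<tau>2. \<exists>a>0. \<forall>u\<in>pos_cone A \<inter> sphere 0 1. \<forall>t. branch (-1) c u t \<longrightarrow>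
        lam c (t *\<^sub>R u) \<le> b \<longrightarrow> \<tau>1 \<le> t \<and> t \<le> \<tau>2 \<and> a \<le> A u" for b
  proof -
    obtain \<tau>1 a where *: "0 < \<tau>1" "0 < a" "\<And>c' u t. cs < c' \<Longrightarrow> c' \<le> c \<Longrightarrow> norm u = 1 \<Longrightarrow> 0 < A u \<Longrightarrow> branch (-1) c' u t \<Longrightarrow>
       lam c' (t *\<^sub>R u) \<le> b \<Longrightarrow> \<tau>1 \<le> t \<and> t \<le> \<tau> \<and> a \<le> A u"
      by (rule plus_bounds[OF c(2), of b]) blast
    have "\<tau>1 \<le> t \<and> t \<le> \<tau> \<and> a \<le> A u"
      if "u \<in> pos_cone A \<inter> sphere 0 1" "branch (-1) c u t" "lam c (t *\<^sub>R u) \<le> b" for u t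
      using *(3)[OF c(1) order_refl _ _ that(2,3)] that(1) by (simp add: pos_cone_def)
    then show ?thesis using *(1,2) by blast
  qed
  fix us :: "nat \<Rightarrow> 'a" and u ts b
  assume *: "range us \<subseteq> pos_cone A \<inter> sphere 0 1" "us \<longlonglongrightarrow> u" "\<And>n. branch (-1) c (us n) (ts n)"
    "\<And>n. lam c (ts n *\<^sub>R us n) \<le> b"
  obtain \<tau>1 a where a: "0 < a" "\<And>c' u t. cs < c' \<Longrightarrow> c' \<le> c \<Longrightarrow> norm u = 1 \<Longrightarrow> 0 < A u \<Longrightarrow> branch (-1) c' u t \<Longrightarrow>
       lam c' (t *\<^sub>R u) \<le> b \<Longrightarrow> \<tau>1 \<le> t \<and> t \<le> \<tau> \<and> a \<le> A u"
    by (rule plus_bounds[OF c(2), of b]) blast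
  have "norm (us n) = 1" "0 < A (us n)" for n using *(1) by (auto simp: pos_cone_def image_subset_iff)
  then have "a \<le> A (us n)" for n using a(2)[OF c(1) order_refl _ _ *(3) *(4)] by blast
  then have "a \<le> A u" by (rule seq_limit_ge[OF A_cont *(2)])
  then show "u \<in> pos_cone A" using a by (simp add: pos_cone_def)
next
  show "open (pos_cone A)" by (rule pos_cone_A_props)
qed (auto simp: pos_cone_def hom even)

lemma minus_fibering_branch:
  assumes c: "cs < c"
  shows "fibering_branch N A B N' A' B' \<alpha> \<eta> \<beta> C C' 1 c KAB"
proof
  show "\<exists>t. branch 1 c u t" if "u \<in> KAB \<inter> sphere 0 1" for u
    using ex_minus_branch[OF _ _ c, of u] that by (auto simp: pos_cone_def)
  show "\<exists>\<tau>1>0. \<exists>\<tau>2. \<exists>a>0. \<forall>u\<in>KAB \<inter> sphere 0 1. \<forall>t. branch 1 c u t \<longrightarrow>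
        lam c (t *\<^sub>R u) \<le> b \<longrightarrow> \<tau>1 \<le> t \<and> t \<le> \<tau>2 \<and> a \<le> A u" for b
  proof -
    obtain \<tau>2 a b0 where *: "0 < a" "\<And>c' u t. c' \<le> c \<Longrightarrow> norm u = 1 \<Longrightarrow> 0 < A u \<Longrightarrow> 0 < B u \<Longrightarrow> branch 1 c' u t \<Longrightarrow>
       lam c' (t *\<^sub>R u) \<le> b \<Longrightarrow> \<tau> \<le> t \<and> t \<le> \<tau>2 \<and> a \<le> A u \<and> b0 \<le> B u"
      by (rule minus_bounds[of c b]) blast
    have "\<tau> \<le> t \<and> t \<le> \<tau>2 \<and> a \<le> A u"
      if "u \<in> KAB \<inter> sphere 0 1" "branch 1 c u t" "lam c (t *\<^sub>R u) \<le> b" for u t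
      using *(2)[OF order_refl _ _ _ that(2,3)] that(1) by (simp add: pos_cone_def)
    then show ?thesis using *(1) \<tau>_pos by blast
  qed
  fix us :: "nat \<Rightarrow> 'a" and u ts b
  assume *: "range us \<subseteq> KAB \<inter> sphere 0 1" "us \<longlonglongrightarrow> u" "\<And>n. branch 1 c (us n) (ts n)"
    "\<And>n. lam c (ts n *\<^sub>R us n) \<le> b"
  obtain \<tau>2 a b0 where a: "0 < a" "0 < b0" "\<And>c' u t. c' \<le> c \<Longrightarrow> norm u = 1 \<Longrightarrow> 0 < A u \<Longrightarrow> 0 < B u \<Longrightarrow> branch 1 c' u t \<Longrightarrow>
       lam c' (t *\<^sub>R u) \<le> b \<Longrightarrow> \<tau> \<le> t \<and> t \<le> \<tau>2 \<and> a \<le> A u \<and> b0 \<le> B u"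
    by (rule minus_bounds[of c b]) blast
  have "norm (us n) = 1" "0 < A (us n)" "0 < B (us n)" for n using *(1) by (auto simp: pos_cone_def image_subset_iff)
  then have ab: "a \<le> A (us n)" "b0 \<le> B (us n)" for n using a(3)[OF order_refl _ _ _ *(3) *(4)] by blast+
  have "a \<le> A u" by (rule seq_limit_ge[OF A_cont *(2) ab(1)])
  moreover have "b0 \<le> B u" by (rule seq_limit_ge[OF B_cont *(2) ab(2)])
  ultimately show "u \<in> KAB" using a by (simp add: pos_cone_def)
next
  show "open KAB" by (intro open_Int pos_cone_A_props pos_cone_B_props)
qed (auto simp: pos_cone_def hom even)

end

section \<open>Dependence on the level\<close>

text \<open>Antitonicity bounds the increment from one side, so a one-sided Lipschitz estimate on
  compact subintervals suffices.\<close>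

lemma antimono_locally_lipschitz_continuous:
  fixes f :: "real \<Rightarrow> real"
  assumes I: "open I" and I_Icc: "\<And>x y. x \<in> I \<Longrightarrow> y \<in> I \<Longrightarrow> {x..y} \<subseteq> I"
    and anti: "\<And>x y. x \<in> I \<Longrightarrow> y \<in> I \<Longrightarrow> x \<le> y \<Longrightarrow> f y \<le> f x"
    and lip: "\<And>a b. a \<in> I \<Longrightarrow> b \<in> I \<Longrightarrow> \<exists>L. \<forall>x y. a \<le> x \<longrightarrow> x \<le> y \<longrightarrow> y \<le> b \<longrightarrow> f x \<le> f y + L * (y - x)"
  shows "continuous_on I f"
proof (rule continuous_at_imp_continuous_on, rule ballI)
  fix x assume "x \<in> I"
  then obtain e where e: "0 < e" "cball x e \<subseteq> I" using I open_contains_cball by blast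
  define a b where "a = x - e" and "b = x + e"
  have ab: "a \<in> I" "b \<in> I" using e by (auto simp: a_def b_def dist_real_def intro!: subsetD[OF e(2)])
  then obtain L where L: "\<And>x y. a \<le> x \<Longrightarrow> x \<le> y \<Longrightarrow> y \<le> b \<Longrightarrow> f x \<le> f y + L * (y - x)" using lip by blast
  have key: "\<bar>f x' - f y'\<bar> \<le> \<bar>L\<bar> * \<bar>x' - y'\<bar>" if "a \<le> x'" "x' \<le> y'" "y' \<le> b" for x' y'
  proof -
    have "x' \<in> I" "y' \<in> I" using that I_Icc[OF ab] by auto
    then have "f y' \<le> f x'" using anti that by blast
    moreover have "L * (y' - x') \<le> \<bar>L\<bar> * (y' - x')" using that by (intro mult_right_mono) auto
    ultimately show ?thesis using L[OF that] that(2) by simp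
  qed
  have "\<bar>L\<bar>-lipschitz_on {a..b} f"
  proof (rule lipschitz_onI)
    fix x' y' assume "x' \<in> {a..b}" "y' \<in> {a..b}"
    then show "dist (f x') (f y') \<le> \<bar>L\<bar> * dist x' y'"
      using key[of x' y'] key[of y' x'] by (cases "x' \<le> y'") (auto simp: dist_real_def abs_minus_commute)
  qed simp
  then have "continuous_on {a..b} f" by (rule lipschitz_on_continuous_on)
  moreover have "x \<in> interior {a..b}" using e by (simp add: a_def b_def)
  ultimately show "isCont f x" using continuous_on_interior by blast
qed

section \<open>Monotonicity and continuity of the minimax values in the level\<close>

context fibering_problem
begin

definition lam_plus :: "real \<Rightarrow> nat \<Rightarrow> real" where
  "lam_plus c k = minimax (val (-1) c) (pos_cone A) k"

definition lam_minus :: "real \<Rightarrow> nat \<Rightarrow> real" where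
  "lam_minus c k = minimax (val 1 c) KAB k"

lemmas plus_functional = fibering_branch.even_cone_functional[OF plus_fibering_branch]
  and minus_functional = fibering_branch.even_cone_functional[OF minus_fibering_branch]

lemmas val_plus_cont = even_cone_functional.J_cont[OF plus_functional]
  and val_plus_lower = even_cone_functional.J_lower[OF plus_functional]
  and val_minus_cont = even_cone_functional.J_cont[OF minus_functional]
  and val_minus_lower = even_cone_functional.J_lower[OF minus_functional]

lemma plus_T: "cs < c \<Longrightarrow> c < 0 \<Longrightarrow> 0 < A u \<Longrightarrow> branch (-1) c u (T (-1) c u)"
  using fibering_branch.T_branch[OF plus_fibering_branch, of c u] by (simp add: pos_cone_def)

lemma minus_T: "cs < c \<Longrightarrow> 0 < A u \<Longrightarrow> 0 < B u \<Longrightarrow> branch 1 c u (T 1 c u)"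
  using fibering_branch.T_branch[OF minus_fibering_branch, of c u] by (simp add: pos_cone_def)

lemma lam_shift: "lam c v = lam c' v + \<alpha> * (c' - c) / A v"
  unfolding lam_def by (simp add: add_divide_distrib[symmetric] right_diff_distrib)

text \<open>Testing the fibre extremum at level \<open>c\<close> with the extremal point of level \<open>c'\<close>: for fixed \<open>v\<close> the
  function \<open>lam\<close> is affine in \<open>c\<close>, so no differentiability in \<open>c\<close> is needed.\<close>

lemma val_compare:
  assumes "branch s c u (T s c u)" "branch s c' u (T s c' u)" "0 < A u"
  shows "s * (val s c' u + \<alpha> * (c' - c) / A (T s c' u *\<^sub>R u)) \<le> s * val s c u"
  using branch_extremal[OF assms(1,3), of "T s c' u"] assms(2)
  unfolding val_def branch_def lam_shift[of c _ c'] by simp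

lemma A_ray_le:
  assumes "norm u = 1" "0 < t" "t \<le> t'" shows "A (t *\<^sub>R u) \<le> t' powr \<alpha> * C"
proof -
  have "t powr \<alpha> * A u \<le> t' powr \<alpha> * C"
    using assms sphere_bounds(3)[OF assms(1)] exponents_pos C_pos
    by (intro order_trans[OF mult_left_mono[of "A u" C] mult_right_mono]) (auto intro: powr_mono2)
  then show ?thesis using assms by (simp add: hom)
qed

lemma A_ray_ge:
  assumes "0 < t" "t \<le> t'" "0 < a" "a \<le> A u" shows "t powr \<alpha> * a \<le> A (t' *\<^sub>R u)"
proof -
  have "t powr \<alpha> * a \<le> t' powr \<alpha> * A u"
    using assms exponents_pos by (intro mult_mono powr_mono2) auto
  then show ?thesis using assms by (simp add: hom)
qed

text \<open>The minimum at the higher level \<open>c'\<close> is tested with the minimiser of level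
  \<open>c\<close>, whose position is at most \<tau>. Hence \<open>A\<close> there is at most
  \<open>\<tau> powr \<alpha> * C\<close>, and the gap is uniform on the whole cone.\<close>

lemma lam_plus_strict:
  assumes c: "cs < c" "c < c'" "c' < 0" and k: "1 \<le> k" "genus_family (pos_cone A) k \<noteq> {}"
  shows "lam_plus c' k < lam_plus c k"
proof -
  have c': "c < 0" "cs < c'" using c by auto
  show ?thesis
    unfolding lam_plus_def
  proof (rule minimax_strict_antimono[OF k val_plus_cont[OF c(1) c'(1)] val_plus_cont[OF c'(2) c(3)]
        val_plus_lower[OF c'(2) c(3)]])
    show "0 < \<alpha> * (c' - c) / (\<tau> powr \<alpha> * C)" using c exponents_pos C_pos \<tau>_pos by simp
    fix u assume "u \<in> pos_cone A \<inter> sphere 0 1"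
    then have u: "0 < A u" "norm u = 1" by (auto simp: pos_cone_def)
    have b: "branch (-1) c u (T (-1) c u)" "branch (-1) c' u (T (-1) c' u)" using plus_T u c by auto
    have t: "0 < T (-1) c u" "T (-1) c u \<le> \<tau>" using b(1) plus_branch_le[OF u(2) _ _ b(1)] c by (auto simp: branch_def)
    have "0 < A (T (-1) c u *\<^sub>R u)" using t u by (simp add: hom)
    then have "\<alpha> * (c' - c) / (\<tau> powr \<alpha> * C) \<le> \<alpha> * (c' - c) / A (T (-1) c u *\<^sub>R u)"
      using A_ray_le[OF u(2) t] c exponents_pos by (intro divide_left_mono) auto
    moreover have "val (-1) c' u \<le> val (-1) c u + \<alpha> * (c - c') / A (T (-1) c u *\<^sub>R u)"
      using val_compare[OF b(2,1) u(1)] by simp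
    moreover have "\<alpha> * (c - c') / A (T (-1) c u *\<^sub>R u) = - (\<alpha> * (c' - c) / A (T (-1) c u *\<^sub>R u))"
      by (simp add: minus_divide_left right_diff_distrib)
    ultimately show "val (-1) c' u + \<alpha> * (c' - c) / (\<tau> powr \<alpha> * C) \<le> val (-1) c u" by linarith
  qed
qed

text \<open>For a maximum the roles are exchanged: level \<open>c\<close> is tested with the
  maximiser of level \<open>c'\<close>. Its position is bounded only on sublevels, and a bound on
  \<open>val 1 c u\<close> passes to \<open>val 1 c' u\<close> through the same comparison.\<close>

lemma lam_minus_strict:
  assumes c: "cs < c" "c < c'" and k: "1 \<le> k" "genus_family KAB k \<noteq> {}"
  shows "lam_minus c' k < lam_minus c k"
proof -
  have c': "cs < c'" using c by simp
  define b where "b = minimax (val 1 c) KAB k + 1"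
  obtain \<tau>2 a b0 where bd: "0 < a" "\<And>c u t. c \<le> c' \<Longrightarrow> norm u = 1 \<Longrightarrow> 0 < A u \<Longrightarrow> 0 < B u \<Longrightarrow> branch 1 c u t \<Longrightarrow>
       lam c (t *\<^sub>R u) \<le> b \<Longrightarrow> \<tau> \<le> t \<and> t \<le> \<tau>2 \<and> a \<le> A u \<and> b0 \<le> B u"
    by (rule minus_bounds[of c' b]) blast
  \<comment> \<open>\<open>minus_bounds\<close> does not assert that \<open>\<tau>2\<close> is
    positive, since its conclusion may be vacuous; the maximum with \<tau> makes the denominator
    positive.\<close>
  define M where "M = max \<tau>2 \<tau>"
  have M: "0 < M" using \<tau>_pos by (simp add: M_def)
  show ?thesis
    unfolding lam_minus_def
  proof (rule minimax_strict_antimono[OF k val_minus_cont[OF c(1)] val_minus_cont[OF c']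
        val_minus_lower[OF c']])
    show "0 < \<alpha> * (c' - c) / (M powr \<alpha> * C)" using c exponents_pos C_pos M by simp
    fix u assume "u \<in> KAB \<inter> sphere 0 1"
      and le: "val 1 c u \<le> minimax (val 1 c) KAB k + 1"
    then have u: "0 < A u" "0 < B u" "norm u = 1" by (auto simp: pos_cone_def)
    have b: "branch 1 c u (T 1 c u)" "branch 1 c' u (T 1 c' u)" using minus_T u c by auto
    let ?t = "T 1 c' u"
    have t: "0 < ?t" using b(2) by (auto simp: branch_def)
    have Av: "0 < A (?t *\<^sub>R u)" using t u by (simp add: hom)
    have cmp: "val 1 c' u + \<alpha> * (c' - c) / A (?t *\<^sub>R u) \<le> val 1 c u" using val_compare[OF b u(1)] by simp
    have "0 \<le> \<alpha> * (c' - c) / A (?t *\<^sub>R u)" using Av c exponents_pos by simp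
    then have "lam c' (?t *\<^sub>R u) \<le> b" using cmp le unfolding b_def val_def[of _ c'] by linarith
    then have "?t \<le> M" using bd(2)[OF order_refl u(3,1,2) b(2)] by (simp add: M_def)
    then have "\<alpha> * (c' - c) / (M powr \<alpha> * C) \<le> \<alpha> * (c' - c) / A (?t *\<^sub>R u)"
      using A_ray_le[OF u(3) t] Av c exponents_pos M C_pos by (intro divide_left_mono mult_pos_pos) auto
    then show "val 1 c' u + \<alpha> * (c' - c) / (M powr \<alpha> * C) \<le> val 1 c u" using cmp by linarith
  qed
qed

text \<open>Level \<open>c\<close> is tested with the minimiser of \<open>c'\<close>. Since
  \<open>lam_plus\<close> decreases, \<open>lam_plus c1 k + 1\<close> is a common sublevel bound for
  all \<open>c'\<close> in the interval, so \<open>plus_bounds\<close> gives one lower bound for the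
  denominator \<open>A\<close>.\<close>

lemma lam_plus_lipschitz:
  assumes c: "cs < c1" "c2 < 0" and k: "1 \<le> k" "genus_family (pos_cone A) k \<noteq> {}"
  shows "\<exists>L. \<forall>c c'. c1 \<le> c \<longrightarrow> c \<le> c' \<longrightarrow> c' \<le> c2 \<longrightarrow> lam_plus c k \<le> lam_plus c' k + L * (c' - c)"
proof -
  define b where "b = lam_plus c1 k + 1"
  obtain \<tau>1 a where bd: "0 < \<tau>1" "0 < a" "\<And>c u t. cs < c \<Longrightarrow> c \<le> c2 \<Longrightarrow> norm u = 1 \<Longrightarrow> 0 < A u \<Longrightarrow>
      branch (-1) c u t \<Longrightarrow> lam c (t *\<^sub>R u) \<le> b \<Longrightarrow> \<tau>1 \<le> t \<and> t \<le> \<tau> \<and> a \<le> A u"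
    by (rule plus_bounds[OF c(2), of b]) blast
  have "lam_plus c k \<le> lam_plus c' k + \<alpha> / (\<tau>1 powr \<alpha> * a) * (c' - c)"
    if cc: "c1 \<le> c" "c \<le> c'" "c' \<le> c2" for c c'
  proof -
    have c': "cs < c" "c < 0" "cs < c'" "c' < 0" using cc c by auto
    have mono: "lam_plus c' k \<le> lam_plus c1 k"
      using lam_plus_strict[OF c(1) _ c'(4) k] cc by (cases "c1 = c'") (auto intro: less_imp_le)
    show ?thesis
      unfolding lam_plus_def
    proof (rule minimax_le_add[OF k val_plus_cont[OF c'(1,2)] val_plus_cont[OF c'(3,4)]
          val_plus_lower[OF c'(1,2)]])
      fix u assume "u \<in> pos_cone A \<inter> sphere 0 1" and le: "val (-1) c' u \<le> minimax (val (-1) c') (pos_cone A) k + 1"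
      then have u: "0 < A u" "norm u = 1" by (auto simp: pos_cone_def)
      have br: "branch (-1) c u (T (-1) c u)" "branch (-1) c' u (T (-1) c' u)" using plus_T u c' by auto
      let ?t = "T (-1) c' u"
      have "lam c' (?t *\<^sub>R u) \<le> b" using le mono unfolding b_def lam_plus_def val_def[of _ c'] by linarith
      then have t: "\<tau>1 \<le> ?t" "a \<le> A u" using bd(3)[OF c'(3) cc(3) u(2,1) br(2)] by auto
      have "\<alpha> * (c' - c) / A (?t *\<^sub>R u) \<le> \<alpha> * (c' - c) / (\<tau>1 powr \<alpha> * a)"
      proof (rule divide_left_mono)
        show ge: "\<tau>1 powr \<alpha> * a \<le> A (?t *\<^sub>R u)" by (rule A_ray_ge[OF bd(1) t(1) bd(2) t(2)])
        have "0 < \<tau>1 powr \<alpha> * a" using bd(1,2) by simp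
        then show "0 < A (?t *\<^sub>R u) * (\<tau>1 powr \<alpha> * a)" using ge by simp
      qed (use cc exponents_pos in simp)
      moreover have "val (-1) c u \<le> val (-1) c' u + \<alpha> * (c' - c) / A (?t *\<^sub>R u)"
        using val_compare[OF br u(1)] by simp
      ultimately show "val (-1) c u \<le> val (-1) c' u + \<alpha> / (\<tau>1 powr \<alpha> * a) * (c' - c)" by simp
    qed
  qed
  then show ?thesis by blast
qed

text \<open>Level \<open>c'\<close> is tested with the maximiser of \<open>c\<close>. Its position
  is always at least \<tau>, while the lower bound on \<open>A u\<close> is taken from the sublevel
  at \<open>c'\<close>.\<close>

lemma lam_minus_lipschitz:
  assumes c: "cs < c1" and k: "1 \<le> k" "genus_family KAB k \<noteq> {}"
  shows "\<exists>L. \<forall>c c'. c1 \<le> c \<longrightarrow> c \<le> c' \<longrightarrow> c' \<le> c2 \<longrightarrow> lam_minus c k \<le> lam_minus c' k + L * (c' - c)"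
proof -
  define b where "b = lam_minus c1 k + 1"
  obtain \<tau>2 a b0 where bd: "0 < a" "\<And>c u t. c \<le> c2 \<Longrightarrow> norm u = 1 \<Longrightarrow> 0 < A u \<Longrightarrow> 0 < B u \<Longrightarrow> branch 1 c u t \<Longrightarrow>
       lam c (t *\<^sub>R u) \<le> b \<Longrightarrow> \<tau> \<le> t \<and> t \<le> \<tau>2 \<and> a \<le> A u \<and> b0 \<le> B u"
    by (rule minus_bounds[of c2 b]) blast
  have "lam_minus c k \<le> lam_minus c' k + \<alpha> / (\<tau> powr \<alpha> * a) * (c' - c)"
    if cc: "c1 \<le> c" "c \<le> c'" "c' \<le> c2" for c c'
  proof -
    have c': "cs < c" "cs < c'" using cc c by auto
    have mono: "lam_minus c' k \<le> lam_minus c1 k"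
      using lam_minus_strict[OF c(1) _ k] cc by (cases "c1 = c'") (auto intro: less_imp_le)
    show ?thesis
      unfolding lam_minus_def
    proof (rule minimax_le_add[OF k val_minus_cont[OF c'(1)] val_minus_cont[OF c'(2)]
          val_minus_lower[OF c'(1)]])
      fix u assume "u \<in> KAB \<inter> sphere 0 1"
        and le: "val 1 c' u \<le> minimax (val 1 c') KAB k + 1"
      then have u: "0 < A u" "0 < B u" "norm u = 1" by (auto simp: pos_cone_def)
      have br: "branch 1 c u (T 1 c u)" "branch 1 c' u (T 1 c' u)" using minus_T u c' by auto
      let ?t = "T 1 c u"
      have t: "\<tau> \<le> ?t" by (rule minus_branch_ge[OF u(3) br(1)])
      have "lam c' (T 1 c' u *\<^sub>R u) \<le> b" using le mono unfolding b_def lam_minus_def val_def[of _ c'] by linarith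
      then have "a \<le> A u" using bd(2)[OF cc(3) u(3,1,2) br(2)] by auto
      have "\<alpha> * (c' - c) / A (?t *\<^sub>R u) \<le> \<alpha> * (c' - c) / (\<tau> powr \<alpha> * a)"
      proof (intro divide_left_mono)
        show ge: "\<tau> powr \<alpha> * a \<le> A (?t *\<^sub>R u)" using A_ray_ge[OF \<tau>_pos t bd(1)] \<open>a \<le> A u\<close> .
        have "0 < \<tau> powr \<alpha> * a" using bd(1) \<tau>_pos by simp
        then show "0 < A (?t *\<^sub>R u) * (\<tau> powr \<alpha> * a)" using ge by simp
      qed (use cc exponents_pos in simp)
      moreover have "val 1 c u + \<alpha> * (c - c') / A (?t *\<^sub>R u) \<le> val 1 c' u"
        using val_compare[OF br(2,1) u(1)] by simp
      moreover have "\<alpha> * (c - c') / A (?t *\<^sub>R u) = - (\<alpha> * (c' - c) / A (?t *\<^sub>R u))"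
        by (simp add: minus_divide_left right_diff_distrib)
      ultimately show "val 1 c u \<le> val 1 c' u + \<alpha> / (\<tau> powr \<alpha> * a) * (c' - c)" by simp
    qed
  qed
  then show ?thesis by blast
qed

lemma lam_plus_continuous:
  assumes k: "1 \<le> k" "genus_family (pos_cone A) k \<noteq> {}"
  shows "continuous_on {cs<..<0} (\<lambda>c. lam_plus c k)"
proof (rule antimono_locally_lipschitz_continuous)
  show "lam_plus y k \<le> lam_plus x k" if "x \<in> {cs<..<0}" "y \<in> {cs<..<0}" "x \<le> y" for x y
    using lam_plus_strict[OF _ _ _ k, of x y] that by (cases "x = y") auto
qed (use lam_plus_lipschitz[OF _ _ k] in auto)

lemma lam_minus_continuous:
  assumes k: "1 \<le> k" "genus_family KAB k \<noteq> {}"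
  shows "continuous_on {cs<..} (\<lambda>c. lam_minus c k)"
proof (rule antimono_locally_lipschitz_continuous)
  show "lam_minus y k \<le> lam_minus x k" if "x \<in> {cs<..}" "y \<in> {cs<..}" "x \<le> y" for x y
    using lam_minus_strict[OF _ _ k, of x y] that by (cases "x = y") auto
qed (use lam_minus_lipschitz[OF _ k] in auto)

text \<open>Positivity is read off \<open>lam_eq_level\<close>, where both terms of the numerator
  are positive for \<open>c < 0\<close>. The facts \<open>Q v < 0\<close> and \<open>P v = c\<close>
  are retained because they bound the norm of \<open>v\<close> by its level.\<close>

lemma lam_plus_critical:
  assumes c: "cs < c" "c < 0" and k: "1 \<le> k" "genus_family (pos_cone A) k \<noteq> {}"
  shows "0 < lam_plus c k"
    and "\<exists>v\<in>pos_cone A. Q v < 0 \<and> P v = c \<and> \<Phi> (lam_plus c k) v = c \<and>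
       dual_deriv (\<Phi> (lam_plus c k)) v = 0"
proof -
  obtain u where u: "u \<in> pos_cone A \<inter> sphere 0 1" "val (-1) c u = lam_plus c k" "val' (-1) c u = 0"
    using even_cone_functional.minimax_critical[OF plus_functional[OF c] k] unfolding lam_plus_def by metis
  obtain v where v: "v = T (-1) c u *\<^sub>R u" "v \<in> pos_cone A" "0 < -1 * Q v" "P v = c"
    "\<Phi> (val (-1) c u) v = c" "dual_deriv (\<Phi> (val (-1) c u)) v = 0"
    using fibering_branch.critical_point[OF plus_fibering_branch[OF c] _ u(3)] u(1) by blast
  show "\<exists>v\<in>pos_cone A. Q v < 0 \<and> P v = c \<and> \<Phi> (lam_plus c k) v = c \<and>
       dual_deriv (\<Phi> (lam_plus c k)) v = 0"
    using v u(2) by auto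
  have A: "0 < A v" using v(2) by (simp add: pos_cone_def)
  then have N: "0 < N v" using N_pos[of v] zero_values by fastforce
  have "lam_plus c k = lam c v" using u(2) v(1) by (simp add: val_def)
  also have "\<dots> = \<alpha> / (\<beta> - \<alpha>) * ((\<beta> - \<eta>) / \<eta> * N v - \<beta> * c) / A v" by (rule lam_eq_level[OF v(4)])
  also have "\<dots> > 0"
  proof -
    have "0 < (\<beta> - \<eta>) / \<eta> * N v" "0 < - (\<beta> * c)"
      using N c exponents_pos by (auto simp: mult_pos_neg)
    then have "0 < (\<beta> - \<eta>) / \<eta> * N v - \<beta> * c" by linarith
    then show ?thesis using A exponents_pos by (intro divide_pos_pos mult_pos_pos) auto
  qed
  finally show "0 < lam_plus c k" .
qed

lemma lam_minus_critical:
  assumes c: "cs < c" and k: "1 \<le> k" "genus_family KAB k \<noteq> {}"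
  obtains u v where "u \<in> KAB" "val 1 c u = lam_minus c k" "v \<in> KAB"
    "P v = c" "\<Phi> (lam_minus c k) v = c" "dual_deriv (\<Phi> (lam_minus c k)) v = 0"
proof -
  obtain u where u: "u \<in> KAB \<inter> sphere 0 1" "val 1 c u = lam_minus c k" "val' 1 c u = 0"
    using even_cone_functional.minimax_critical[OF minus_functional[OF c] k] unfolding lam_minus_def by metis
  have uK: "u \<in> KAB" using u(1) by blast
  obtain v where v: "v \<in> KAB" "P v = c"
    "\<Phi> (val 1 c u) v = c" "dual_deriv (\<Phi> (val 1 c u)) v = 0"
    using fibering_branch.critical_point[OF minus_fibering_branch[OF c] uK u(3)] by metis
  show ?thesis using that[OF uK u(2) v(1,2)] v(3,4) unfolding u(2) by blast
qed

text \<open>Each ray is traversed from the minimum through \<tau>/2 and \<tau> to the maximum.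
  \<open>lam c\<close> does not decrease on the outer pieces and rises by at least
  \<open>g * (\<tau> / 2)\<close> on the middle one, uniformly in \<open>u\<close>. The uniform gap
  survives the passage to minimax values.\<close>

lemma lam_plus_less_lam_minus:
  assumes c: "cs < c" "c < 0" and k: "1 \<le> k" "genus_family KAB k \<noteq> {}"
  shows "lam_plus c k < lam_minus c k"
proof -
  define g where "g = \<alpha>\<^sup>2 / (\<tau> * (\<tau> powr \<alpha> * C)) * (c - cs)"
  have g: "0 < g" using c exponents_pos C_pos \<tau>_pos by (simp add: g_def)
  have gap: "val (-1) c u + g * (\<tau> / 2) \<le> val 1 c u"
    if "u \<in> KAB \<inter> sphere 0 1" for u
  proof -
    have u: "0 < A u" "0 < B u" "norm u = 1" using that by (auto simp: pos_cone_def)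
    let ?f = "\<lambda>t. lam c (t *\<^sub>R u)"
    have b: "branch (-1) c u (T (-1) c u)" "branch 1 c u (T 1 c u)" using plus_T minus_T u c by auto
    have "val (-1) c u \<le> ?f (\<tau> / 2)"
      using branch_extremal[OF b(1) u(1), of "\<tau> / 2"] Q_neg[OF u(3), of "\<tau> / 2"] \<tau>_pos by (simp add: val_def)
    moreover have "?f (\<tau> / 2) + g * (\<tau> / 2) \<le> ?f \<tau>"
    proof -
      obtain t where t: "\<tau> / 2 < t" "t < \<tau>"
        "?f \<tau> - ?f (\<tau> / 2) = (\<tau> - \<tau> / 2) * (\<alpha>\<^sup>2 / (t * A (t *\<^sub>R u)) * (c - P (t *\<^sub>R u)))"
        using MVT2[of "\<tau> / 2" \<tau> ?f "\<lambda>t. \<alpha>\<^sup>2 / (t * A (t *\<^sub>R u)) * (c - P (t *\<^sub>R u))"] lam_ray_deriv[OF _ u(1)] \<tau>_pos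
        by auto
      have t0: "0 < t" using t \<tau>_pos by linarith
      \<comment> \<open>Between \<tau>/2 and \<tau> the factor \<open>c - P\<close> is at least
        \<open>c - cs\<close>, and \<open>t\<close> and \<open>A\<close> are bounded above;
        \<open>g\<close> is the resulting lower bound for the slope.\<close>
      have "P (t *\<^sub>R u) \<le> cs" using P_le_cs[OF u(3), of t] Q_neg[OF u(3) t0] t by auto
      moreover have "\<alpha>\<^sup>2 / (\<tau> * (\<tau> powr \<alpha> * C)) \<le> \<alpha>\<^sup>2 / (t * A (t *\<^sub>R u))"
        using A_ray_le[OF u(3) t0, of \<tau>] t t0 u \<tau>_pos C_pos
        by (intro divide_left_mono mult_mono) (auto simp: hom)
      ultimately have "g \<le> \<alpha>\<^sup>2 / (t * A (t *\<^sub>R u)) * (c - P (t *\<^sub>R u))"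
        unfolding g_def using c u t0 by (intro mult_mono) (auto simp: hom)
      then have "g * (\<tau> / 2) \<le> (\<alpha>\<^sup>2 / (t * A (t *\<^sub>R u)) * (c - P (t *\<^sub>R u))) * (\<tau> / 2)"
        using \<tau>_pos by (intro mult_right_mono) auto
      moreover have "\<tau> - \<tau> / 2 = \<tau> / 2" by simp
      ultimately show ?thesis using t(3) by (simp only: mult.commute[of "\<tau> / 2"])
    qed
    moreover have "?f \<tau> \<le> val 1 c u"
      unfolding val_def
    proof (rule DERIV_nonneg_imp_nondecreasing[of _ _ ?f])
      show "\<tau> \<le> T 1 c u" by (rule minus_branch_ge[OF u(3) b(2)])
      fix t assume t: "\<tau> \<le> t" "t \<le> T 1 c u"
      have t0: "0 < t" using t \<tau>_pos by linarith
      \<comment> \<open>Beyond \<tau>, \<open>P\<close> is below \<open>cs\<close> as long as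
        \<open>Q\<close> is nonpositive, and afterwards it increases to the value \<open>c\<close>,
        reached at the maximum.\<close>
      have "P (t *\<^sub>R u) \<le> c"
      proof (cases "Q (t *\<^sub>R u) \<le> 0")
        case True
        then show ?thesis using P_le_cs[OF u(3), of t] t \<tau>_pos c by linarith
      next
        case False
        then show ?thesis
          using P_ray_strict_mono[of t "T 1 c u" 1 u] t t0 b(2) by (cases "t = T 1 c u") (auto simp: branch_def)
      qed
      then have "0 \<le> \<alpha>\<^sup>2 / (t * A (t *\<^sub>R u)) * (c - P (t *\<^sub>R u))" using t0 u by (simp add: hom)
      then show "\<exists>y. (?f has_real_derivative y) (at t) \<and> 0 \<le> y" using lam_ray_deriv[OF t0 u(1)] by blast
    qed
    ultimately show ?thesis by linarith
  qed
  define e where "e = g * (\<tau> / 2)"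
  have e: "0 < e" using g \<tau>_pos by (simp add: e_def)
  obtain M where M: "M \<in> genus_family KAB k" "\<And>u. u \<in> M \<Longrightarrow> val 1 c u < lam_minus c k + e / 2"
    using minimax_less[OF k(2,1) val_minus_cont[OF c(1)], of "lam_minus c k + e / 2"] e
    unfolding lam_minus_def by auto
  \<comment> \<open>A nearly optimal set for the maxima lies in the smaller cone and is therefore
    also a competitor for the minima.\<close>
  have M': "M \<in> genus_family (pos_cone A) k" using genus_family_mono[of "KAB" "pos_cone A"] M(1) by blast
  have "lam_plus c k \<le> lam_minus c k - e / 2"
    unfolding lam_plus_def
  proof (rule minimax_upper[OF M' k(1) val_plus_cont[OF c] val_plus_lower[OF c]])
    fix u assume u: "u \<in> M"
    then have "u \<in> KAB \<inter> sphere 0 1" using M(1) by (auto simp: genus_family_def)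
    then show "val (-1) c u \<le> lam_minus c k - e / 2" using gap[of u] M(2)[OF u] unfolding e_def by linarith
  qed
  then show ?thesis using e by linarith
qed

lemma compact_pos_lower_bound:
  fixes f :: "'a \<Rightarrow> real"
  assumes "compact M" "continuous_on UNIV f" "\<And>u. u \<in> M \<Longrightarrow> 0 < f u"
  obtains a where "0 < a" "\<And>u. u \<in> M \<Longrightarrow> a \<le> f u"
proof (cases "M = {}")
  case False
  then obtain x where "x \<in> M" "\<And>u. u \<in> M \<Longrightarrow> f x \<le> f u"
    using continuous_attains_inf[OF assms(1), of f] continuous_on_subset[OF assms(2)] by auto
  then show ?thesis using that[of "f x"] assms(3) by blast
qed (use that[of 1] in auto)

text \<open>A single admissible set \<open>M\<close> is used for all levels. The minimum is tested
  at \<open>t = (- c) powr (1 / \<eta>)\<close>, where \<open>t powr \<eta>\<close> balances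
  \<open>- c\<close>; dividing by \<open>A\<close>, of order \<open>t powr \<alpha>\<close>, leaves
  a positive power of \<open>- c\<close>.\<close>

lemma lam_plus_tendsto_0:
  assumes k: "1 \<le> k" "genus_family (pos_cone A) k \<noteq> {}"
  shows "((\<lambda>c. lam_plus c k) \<longlongrightarrow> 0) (at_left 0)"
proof -
  obtain M where M: "M \<in> genus_family (pos_cone A) k" using k by auto
  have Mu: "norm u = 1" "0 < A u" if "u \<in> M" for u using M that by (auto simp: genus_family_def pos_cone_def)
  obtain a where a: "0 < a" "\<And>u. u \<in> M \<Longrightarrow> a \<le> A u"
    using compact_pos_lower_bound[of M A] M Mu A_cont by (auto simp: genus_family_def)
  define D where "D = \<alpha> * (C' / \<eta> + \<tau> powr (\<beta> - \<eta>) * C / \<beta> + 1) / a"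
  \<comment> \<open>For levels above \<open>c0\<close> the test position does not exceed \<tau>, so
    it lies in the interval on which the fibre minimum may be compared.\<close>
  define c0 where "c0 = max cs (- (\<tau> powr \<eta>))"
  have c0: "c0 < 0" using cs_neg \<tau>_pos by (simp add: c0_def)
  have bound: "0 \<le> lam_plus c k \<and> lam_plus c k \<le> D * (- c) powr ((\<eta> - \<alpha>) / \<eta>)" if c: "c0 < c" "c < 0" for c
  proof
    have cs: "cs < c" "- c < \<tau> powr \<eta>" using c by (auto simp: c0_def)
    show "0 \<le> lam_plus c k" using lam_plus_critical(1)[OF cs(1) c(2) k] by simp
    define t where "t = (- c) powr (1 / \<eta>)"
    have t: "0 < t" "t powr \<eta> = - c" using c exponents_pos by (simp_all add: t_def powr_powr)
    have "t \<le> (\<tau> powr \<eta>) powr (1 / \<eta>)" unfolding t_def using c cs exponents_pos by (intro powr_mono2) auto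
    then have t\<tau>: "t \<le> \<tau>" using \<tau>_pos exponents_pos by (simp add: powr_powr)
    show "lam_plus c k \<le> D * (- c) powr ((\<eta> - \<alpha>) / \<eta>)"
      unfolding lam_plus_def
    proof (rule minimax_upper[OF M k(1) val_plus_cont[OF cs(1) c(2)] val_plus_lower[OF cs(1) c(2)]])
      fix u assume uM: "u \<in> M"
      note u = Mu[OF uM]
      have "val (-1) c u \<le> lam c (t *\<^sub>R u)"
        using branch_extremal[OF plus_T[OF cs(1) c(2) u(2)] u(2) t(1)] Q_neg[OF u(1) t(1) t\<tau>] by (simp add: val_def)
      also have "\<dots> = \<alpha> * (t powr \<eta> * (N u / \<eta> + t powr (\<beta> - \<eta>) * - B u / \<beta> + 1)) / (t powr \<alpha> * A u)"
      proof -
        have "t powr \<beta> = t powr \<eta> * t powr (\<beta> - \<eta>)" by (simp add: powr_add[symmetric])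
        then show ?thesis unfolding ray_lam[OF t(1)] using t(2) by (simp add: distrib_left right_diff_distrib)
      qed
      also have "\<dots> \<le> \<alpha> * (t powr \<eta> * (C' / \<eta> + \<tau> powr (\<beta> - \<eta>) * C / \<beta> + 1)) / (t powr \<alpha> * a)"
      proof (rule frac_le)
        have "t powr (\<beta> - \<eta>) * - B u \<le> \<tau> powr (\<beta> - \<eta>) * C"
        proof -
          have "t powr (\<beta> - \<eta>) * - B u \<le> t powr (\<beta> - \<eta>) * C"
            using sphere_bounds(4)[OF u(1)] by (intro mult_left_mono) auto
          also have "\<dots> \<le> \<tau> powr (\<beta> - \<eta>) * C"
            using t t\<tau> exponents_pos C_pos by (intro mult_right_mono powr_mono2) auto
          finally show ?thesis .
        qed
        then have "t powr (\<beta> - \<eta>) * - B u / \<beta> \<le> \<tau> powr (\<beta> - \<eta>) * C / \<beta>"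
          using exponents_pos by (intro divide_right_mono) auto
        moreover have "N u / \<eta> \<le> C' / \<eta>"
          using sphere_bounds(2)[OF u(1)] exponents_pos by (intro divide_right_mono) auto
        ultimately show "\<alpha> * (t powr \<eta> * (N u / \<eta> + t powr (\<beta> - \<eta>) * - B u / \<beta> + 1))
            \<le> \<alpha> * (t powr \<eta> * (C' / \<eta> + \<tau> powr (\<beta> - \<eta>) * C / \<beta> + 1))"
          using exponents_pos by (intro mult_left_mono) auto
        show "t powr \<alpha> * a \<le> t powr \<alpha> * A u" using a(2)[OF uM] by (intro mult_left_mono) auto
        show "0 < t powr \<alpha> * a" using a t by simp
        show "0 \<le> \<alpha> * (t powr \<eta> * (C' / \<eta> + \<tau> powr (\<beta> - \<eta>) * C / \<beta> + 1))"
          using exponents_pos C_pos by (intro mult_nonneg_nonneg add_nonneg_nonneg divide_nonneg_pos) auto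
      qed
      also have "\<dots> = D * t powr (\<eta> - \<alpha>)" using t(1) a(1) by (simp add: D_def powr_diff mult_ac)
      also have "t powr (\<eta> - \<alpha>) = (- c) powr ((\<eta> - \<alpha>) / \<eta>)" by (simp add: t_def powr_powr)
      finally show "val (-1) c u \<le> D * (- c) powr ((\<eta> - \<alpha>) / \<eta>)" .
    qed
  qed
  have ev: "\<forall>\<^sub>F c in at_left 0. c0 < c \<and> c < 0"
    using eventually_at_left_real[OF c0] by eventually_elim auto
  have "((\<lambda>c. (- c) powr ((\<eta> - \<alpha>) / \<eta>)) \<longlongrightarrow> 0) (at_left (0::real))"
  proof (rule tendsto_zero_powrI[OF _ tendsto_const])
    show "((\<lambda>c. - c) \<longlongrightarrow> 0) (at_left (0::real))" by (auto intro!: tendsto_eq_intros)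
    show "\<forall>\<^sub>F c in at_left (0::real). 0 \<le> - c" using ev by eventually_elim simp
  qed (use exponents_pos in simp)
  then have lim: "((\<lambda>c. D * (- c) powr ((\<eta> - \<alpha>) / \<eta>)) \<longlongrightarrow> 0) (at_left (0::real))"
    by (rule tendsto_mult_right_zero)
  show ?thesis
    by (rule tendsto_sandwich[OF _ _ tendsto_const lim]) (use ev in \<open>eventually_elim, use bound in blast\<close>)+
qed

text \<open>A fixed admissible set has \<open>B\<close> bounded below. A large level pushes the
  maximiser far out on every ray of this set, where \<open>(N - B) / A\<close> is dominated by the
  negative \<open>B\<close>-term.\<close>

lemma lam_minus_at_bot:
  assumes k: "1 \<le> k" "genus_family KAB k \<noteq> {}"
  shows "filterlim (\<lambda>c. lam_minus c k) at_bot at_top"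
proof -
  obtain M where M: "M \<in> genus_family KAB k" using k by auto
  have Mu: "norm u = 1" "0 < A u" "0 < B u" if "u \<in> M" for u
    using M that by (auto simp: genus_family_def pos_cone_def)
  obtain b where b: "0 < b" "\<And>u. u \<in> M \<Longrightarrow> b \<le> B u"
    using compact_pos_lower_bound[of M B] M Mu B_cont by (auto simp: genus_family_def)
  show ?thesis
    unfolding filterlim_at_bot
  proof
    fix Z :: real
    \<comment> \<open>From \<open>R\<close> on, the second entry gives
      \<open>B u * t powr (\<beta> - \<eta>) - N u \<ge> 1\<close>, and the third gives
      \<open>t powr (\<eta> - \<alpha>) \<ge> C * \<bar>Z\<bar>\<close>. The next constant
      \<open>c0\<close> exceeds every value of \<open>P\<close> at positions up to
      \<open>R\<close>.\<close>
    define R where "R = max 1 (max (((C' + 1) / b) powr (1 / (\<beta> - \<eta>))) ((C * \<bar>Z\<bar>) powr (1 / (\<eta> - \<alpha>))))"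
    define c0 where "c0 = max 1 ((\<beta> - \<alpha>) / (\<alpha> * \<beta>) * C * R powr \<beta>)"
    have R: "1 \<le> R" by (simp add: R_def)
    have "lam_minus c k \<le> Z" if c: "c0 < c" for c
    proof -
      have cs: "cs < c" using c cs_neg by (simp add: c0_def)
      show ?thesis
        unfolding lam_minus_def
      proof (rule minimax_upper[OF M k(1) val_minus_cont[OF cs] val_minus_lower[OF cs]])
        fix u assume uM: "u \<in> M"
        note u = Mu[OF uM]
        define t where "t = T 1 c u"
        have t: "0 < t" "P (t *\<^sub>R u) = c" using minus_T[OF cs u(2,3)] by (auto simp: t_def branch_def)
        have tR: "R \<le> t"
        proof (rule ccontr)
          assume "\<not> R \<le> t"
          then have "t powr \<beta> \<le> R powr \<beta>" using t exponents_pos by (intro powr_mono2) auto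
          then have "B u * t powr \<beta> \<le> C * R powr \<beta>"
            using sphere_bounds(4)[OF u(1)] u C_pos by (intro mult_mono) auto
          then have "(\<beta> - \<alpha>) / (\<alpha> * \<beta>) * (B u * t powr \<beta>) \<le> (\<beta> - \<alpha>) / (\<alpha> * \<beta>) * (C * R powr \<beta>)"
            using exponents_pos by (intro mult_left_mono) auto
          moreover have "0 \<le> (\<eta> - \<alpha>) / (\<alpha> * \<eta>) * N u * t powr \<eta>"
            using N_pos[of u] u exponents_pos by (cases "u = 0") auto
          ultimately have "P (t *\<^sub>R u) \<le> c0" unfolding ray_P[OF t(1)] c0_def by (simp add: mult.assoc)
          then show False using t c by simp
        qed
        have "(C' + 1) / b \<le> t powr (\<beta> - \<eta>)"
        proof -
          have "((C' + 1) / b) powr (1 / (\<beta> - \<eta>)) \<le> t" using tR by (simp add: R_def)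
          then have "(((C' + 1) / b) powr (1 / (\<beta> - \<eta>))) powr (\<beta> - \<eta>) \<le> t powr (\<beta> - \<eta>)"
            using exponents_pos by (intro powr_mono2) auto
          then show ?thesis using b C_pos exponents_pos by (simp add: powr_powr)
        qed
        then have "C' + 1 \<le> b * t powr (\<beta> - \<eta>)" using b by (simp add: divide_le_eq mult.commute)
        also have "\<dots> \<le> B u * t powr (\<beta> - \<eta>)" using b(2)[OF uM] by (intro mult_right_mono) auto
        finally have "t powr \<eta> * 1 \<le> t powr \<eta> * (B u * t powr (\<beta> - \<eta>) - N u)"
          using sphere_bounds(2)[OF u(1)] by (intro mult_left_mono) auto
        then have NB: "t powr \<eta> \<le> B (t *\<^sub>R u) - N (t *\<^sub>R u)"
          using powr_add[of t \<eta> "\<beta> - \<eta>"] t by (simp add: hom right_diff_distrib mult_ac)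
        have "C * \<bar>Z\<bar> \<le> t powr (\<eta> - \<alpha>)"
        proof -
          have "(C * \<bar>Z\<bar>) powr (1 / (\<eta> - \<alpha>)) \<le> t" using tR by (simp add: R_def)
          then have "((C * \<bar>Z\<bar>) powr (1 / (\<eta> - \<alpha>))) powr (\<eta> - \<alpha>) \<le> t powr (\<eta> - \<alpha>)"
            using exponents_pos by (intro powr_mono2) auto
          then show ?thesis using C_pos exponents_pos by (simp add: powr_powr)
        qed
        then have "(C * \<bar>Z\<bar>) * t powr \<alpha> \<le> t powr (\<eta> - \<alpha>) * t powr \<alpha>" by (intro mult_right_mono) auto
        then have "\<bar>Z\<bar> * (t powr \<alpha> * C) \<le> t powr \<eta>" by (simp add: powr_add[symmetric] mult_ac)
        moreover have "\<bar>Z\<bar> * A (t *\<^sub>R u) \<le> \<bar>Z\<bar> * (t powr \<alpha> * C)"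
          using A_ray_le[OF u(1) t(1) order_refl] by (intro mult_left_mono) auto
        ultimately have "\<bar>Z\<bar> * A (t *\<^sub>R u) \<le> B (t *\<^sub>R u) - N (t *\<^sub>R u)" using NB by linarith
        moreover have Av: "0 < A (t *\<^sub>R u)" using t u by (simp add: hom)
        moreover have "- Z * A (t *\<^sub>R u) \<le> \<bar>Z\<bar> * A (t *\<^sub>R u)" using Av by (intro mult_right_mono) auto
        ultimately have "N (t *\<^sub>R u) - B (t *\<^sub>R u) \<le> Z * A (t *\<^sub>R u)" by linarith
        then show "val 1 c u \<le> Z"
          unfolding val_def t_def[symmetric] lam_eq_quotient[OF t(2)] using Av by (simp add: pos_divide_le_eq)
      qed
    qed
    then show "\<forall>\<^sub>F c in at_top. lam_minus c k \<le> Z" unfolding eventually_at_top_dense by blast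
  qed
qed

text \<open>The expression under the infimum in \<open>c_star_star\<close> is the maximum over the
  ray of \<open>N / \<eta> - B / \<beta>\<close>, attained where
  \<open>t powr (\<beta> - \<eta>) = N u / B u\<close>. That point has positive \<open>Q\<close>, so
  it may be compared with the fibre maximum, and for \<open>c\<close> below the expression the
  numerator of \<open>lam\<close> is positive there.\<close>

lemma lam_minus_pos:
  assumes c: "cs < c" "ereal c < c_star_star \<eta> \<beta> N A B"
    and k: "1 \<le> k" "genus_family KAB k \<noteq> {}"
  shows "0 < lam_minus c k"
proof -
  obtain u where u: "u \<in> KAB" "val 1 c u = lam_minus c k"
    using lam_minus_critical[OF c(1) k] by metis
  have AB: "0 < A u" "0 < B u" using u by (auto simp: pos_cone_def)
  then have N: "0 < N u" using N_pos[of u] zero_values by fastforce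
  have "ereal c < ereal ((\<beta> - \<eta>) / (\<eta> * \<beta>) * (N u powr (\<beta> / (\<beta> - \<eta>)) / B u powr (\<eta> / (\<beta> - \<eta>))))"
    using less_INF_D[OF c(2)[unfolded c_star_star_def] u(1)] .
  then have c_less: "c < (\<beta> - \<eta>) / (\<eta> * \<beta>) * (N u powr (\<beta> / (\<beta> - \<eta>)) / B u powr (\<eta> / (\<beta> - \<eta>)))" by simp
  define t where "t = (N u / B u) powr (1 / (\<beta> - \<eta>))"
  have t: "0 < t" "t powr (\<beta> - \<eta>) = N u / B u" using N AB exponents_pos by (simp_all add: t_def powr_powr)
  have "t powr \<eta> = N u powr (\<eta> / (\<beta> - \<eta>)) / B u powr (\<eta> / (\<beta> - \<eta>))"
    using N AB by (simp add: t_def powr_powr powr_divide)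
  moreover have "N u powr (\<beta> / (\<beta> - \<eta>)) = N u powr (\<eta> / (\<beta> - \<eta>)) * N u"
  proof -
    have "\<beta> / (\<beta> - \<eta>) = \<eta> / (\<beta> - \<eta>) + 1" using exponents_pos by (simp add: field_simps)
    then show ?thesis using N by (simp add: powr_add)
  qed
  ultimately have c_less': "c < (\<beta> - \<eta>) / (\<eta> * \<beta>) * (t powr \<eta> * N u)" using c_less by simp
  have tb: "t powr \<beta> * B u = t powr \<eta> * N u"
    using powr_add[of t \<eta> "\<beta> - \<eta>"] t AB by simp
  have "0 < Q (t *\<^sub>R u)"
  proof -
    have "Q (t *\<^sub>R u) = (\<beta> - \<alpha>) / \<alpha> * (t powr \<beta> * B u) - (\<eta> - \<alpha>) / \<alpha> * (t powr \<eta> * N u)"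
      using t(1) by (simp add: Q_def hom)
    also have "\<dots> = (\<beta> - \<eta>) / \<alpha> * (t powr \<eta> * N u)"
      unfolding tb left_diff_distrib[symmetric] diff_divide_distrib[symmetric] by simp
    also have "\<dots> > 0" using t N exponents_pos by simp
    finally show ?thesis .
  qed
  then have "lam c (t *\<^sub>R u) \<le> val 1 c u"
    using branch_extremal[OF minus_T[OF c(1) AB] AB(1) t(1)] by (simp add: val_def)
  moreover have "0 < lam c (t *\<^sub>R u)"
  proof -
    have "t powr \<eta> * N u / \<eta> - t powr \<beta> * B u / \<beta> = (\<beta> - \<eta>) / (\<eta> * \<beta>) * (t powr \<eta> * N u)"
      unfolding tb using exponents_pos by (simp add: field_simps)
    then have "0 < t powr \<eta> * N u / \<eta> - t powr \<beta> * B u / \<beta> - c" using c_less' by linarith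
    then show ?thesis unfolding ray_lam[OF t(1)] using AB t exponents_pos by (intro divide_pos_pos mult_pos_pos) auto
  qed
  ultimately show ?thesis using u(2) by linarith
qed

text \<open>Since \<open>\<eta> * p = \<beta> * q\<close>, the norm cancels from the quotient once
  \<open>N\<close> and \<open>B\<close> are replaced by their power bounds. An empty index set
  causes no trouble in \<open>ereal\<close>.\<close>

lemma c_star_star_pos: "0 < c_star_star \<eta> \<beta> N A B"
proof -
  define p q where "p = \<beta> / (\<beta> - \<eta>)" and "q = \<eta> / (\<beta> - \<eta>)"
  define m where "m = (\<beta> - \<eta>) / (\<eta> * \<beta>) * (inverse C powr p / C powr q)"
  have m: "0 < m" using exponents_pos C_pos by (simp add: m_def)
  have pq: "0 < p" "0 < q" "\<eta> * p = \<beta> * q" using exponents_pos by (simp_all add: p_def q_def)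
  have "ereal m \<le> c_star_star \<eta> \<beta> N A B"
    unfolding c_star_star_def
  proof (rule INF_greatest)
    fix u assume "u \<in> KAB"
    then have AB: "0 < A u" "0 < B u" by (auto simp: pos_cone_def)
    then have u: "0 < norm u" using zero_values by force
    have "inverse C powr p / C powr q = (inverse C * norm u powr \<eta>) powr p / (C * norm u powr \<beta>) powr q"
      using u C_pos pq by (simp add: powr_mult powr_powr)
    also have "\<dots> \<le> N u powr p / B u powr q"
      using N_lower[of u] B_bound[of u] AB C_pos pq u
      by (intro frac_le powr_mono2) auto
    finally show "ereal m \<le> ereal ((\<beta> - \<eta>) / (\<eta> * \<beta>) * (N u powr (\<beta> / (\<beta> - \<eta>)) / B u powr (\<eta> / (\<beta> - \<eta>))))"
      unfolding m_def p_def[symmetric] q_def[symmetric] ereal_less_eq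
      using exponents_pos by (intro mult_left_mono) auto
  qed
  then show ?thesis using m by (metis ereal_less(2) less_le_trans)
qed

section \<open>Norm bounds from the level, and bifurcation sequences\<close>

lemma norm_le_of_plus_level:
  assumes "Q v < 0" "P v = c"
  shows "norm v \<le> (C * - c / \<kappa>) powr (1 / \<eta>)"
proof -
  have "\<kappa> * N v \<le> - c" using P_le_of_Q_nonpos[of v] assms by simp
  then have "N v \<le> - c / \<kappa>" unfolding pos_le_divide_eq[OF \<kappa>_pos] by (simp add: mult.commute)
  then have "inverse C * norm v powr \<eta> \<le> - c / \<kappa>" using N_lower[of v] by linarith
  then have "C * (inverse C * norm v powr \<eta>) \<le> C * (- c / \<kappa>)" using C_pos by (intro mult_left_mono) auto
  then have "norm v powr \<eta> \<le> C * - c / \<kappa>" using C_pos by (simp add: mult.assoc[symmetric])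
  then have "(norm v powr \<eta>) powr (1 / \<eta>) \<le> (C * - c / \<kappa>) powr (1 / \<eta>)"
    using exponents_pos by (intro powr_mono2) auto
  then show ?thesis using exponents_pos by (simp add: powr_powr)
qed

lemma norm_ge_of_level:
  assumes "P v = c"
  shows "c \<le> (\<beta> - \<alpha>) / (\<alpha> * \<beta>) * C * norm v powr \<beta>"
proof -
  have "0 \<le> N v" using N_pos[of v] zero_values by (cases "v = 0") auto
  then have "0 \<le> (\<eta> - \<alpha>) / (\<alpha> * \<eta>) * N v" using exponents_pos by simp
  then have "c \<le> (\<beta> - \<alpha>) / (\<alpha> * \<beta>) * B v" using assms unfolding P_def by linarith
  also have "\<dots> \<le> (\<beta> - \<alpha>) / (\<alpha> * \<beta>) * (C * norm v powr \<beta>)"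
    using B_bound[of v] exponents_pos by (intro mult_left_mono) auto
  finally show ?thesis by (simp add: mult.assoc)
qed

lemma lam_plus_mono_at_top:
  assumes c: "cs < c" "c < 0" and ne: "\<And>k. genus_family (pos_cone A) k \<noteq> {}"
  shows "1 \<le> k \<Longrightarrow> lam_plus c k \<le> lam_plus c (Suc k)" "filterlim (\<lambda>k. lam_plus c k) at_top sequentially"
proof -
  show "1 \<le> k \<Longrightarrow> lam_plus c k \<le> lam_plus c (Suc k)" "filterlim (\<lambda>k. lam_plus c k) at_top sequentially"
    unfolding lam_plus_def
    using even_cone_functional.minimax_mono[OF plus_functional[OF c] _ _ ne, of k "Suc k"]
      even_cone_functional.minimax_at_top[OF plus_functional[OF c] ne] by auto
qed

lemma lam_minus_mono_at_top:
  assumes c: "cs < c" and ne: "\<And>k. genus_family KAB k \<noteq> {}"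
  shows "1 \<le> k \<Longrightarrow> lam_minus c k \<le> lam_minus c (Suc k)" "filterlim (\<lambda>k. lam_minus c k) at_top sequentially"
proof -
  show "1 \<le> k \<Longrightarrow> lam_minus c k \<le> lam_minus c (Suc k)" "filterlim (\<lambda>k. lam_minus c k) at_top sequentially"
    unfolding lam_minus_def
    using even_cone_functional.minimax_mono[OF minus_functional[OF c] _ _ ne, of k "Suc k"]
      even_cone_functional.minimax_at_top[OF minus_functional[OF c] ne] by auto
qed

lemma filterlim_nat_ex_ge:
  fixes f :: "nat \<Rightarrow> real"
  assumes "filterlim f at_top sequentially"
  shows "\<exists>k\<ge>m. x \<le> f k"
  using assms unfolding filterlim_at_top eventually_sequentially by (metis nle_le)

text \<open>These levels tend to 0 inside the open interval; with \<open>n + 1\<close> in the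
  denominator the first one would be \<open>cs\<close> itself.\<close>

lemma cs_less_fraction: "cs < cs / (real n + 2)"
proof -
  have "(real n + 1) * cs < 0" using cs_neg by (intro mult_pos_neg) auto
  then have "cs * (real n + 2) < cs" by (simp add: algebra_simps)
  then show ?thesis by (subst pos_less_divide_eq) auto
qed

text \<open>At the level \<open>cs / (n + 2)\<close> some index \<open>k > n\<close> makes the
  minimax value at least \<open>l\<close>; for the same \<open>k\<close> it falls below
  \<open>l\<close> as the level tends to 0. Continuity in the level yields the exact value
  \<open>l\<close> in between, and \<open>norm_le_of_plus_level\<close> sends the critical points to
  0.\<close>

lemma plus_sequences:
  assumes ne: "\<And>k. genus_family (pos_cone A) k \<noteq> {}" and l: "0 < l"
  obtains v c k where "\<And>n. v n \<in> pos_cone A" "\<And>n. c n \<in> {cs<..<0}" "\<And>n. n + 1 \<le> k n" "\<And>n. l = lam_plus (c n) (k n)"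
    "\<And>n. \<Phi> l (v n) = c n" "\<And>n. dual_deriv (\<Phi> l) (v n) = 0"
    "c \<longlonglongrightarrow> 0" "v \<longlonglongrightarrow> 0"
proof -
  have "\<exists>c k v. cs / (real n + 2) \<le> c \<and> c < 0 \<and> n + 1 \<le> k \<and> l = lam_plus c k \<and> v \<in> pos_cone A \<and> Q v < 0 \<and> P v = c \<and>
    \<Phi> l v = c \<and> dual_deriv (\<Phi> l) v = 0" for n
  proof -
    define c1 where "c1 = cs / (real n + 2)"
    have c1: "cs < c1" "c1 < 0" using cs_neg cs_less_fraction by (auto simp: c1_def intro: divide_neg_pos)
    obtain k where k: "n + 1 \<le> k" "l \<le> lam_plus c1 k"
      using filterlim_nat_ex_ge[OF lam_plus_mono_at_top(2)[OF c1 ne]] by blast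
    have k1: "1 \<le> k" using k by simp
    have "\<forall>\<^sub>F c in at_left 0. lam_plus c k < l \<and> c \<in> {c1<..<0}"
      using order_tendstoD(2)[OF lam_plus_tendsto_0[OF k1 ne] l] eventually_at_left_real[OF c1(2)] by eventually_elim simp
    then obtain c2 where c2: "lam_plus c2 k < l" "c1 < c2" "c2 < 0"
      using eventually_happens'[of "at_left (0::real)"] by (auto simp: trivial_limit_at_left_real)
    have "continuous_on {c1..c2} (\<lambda>c. lam_plus c k)"
      by (rule continuous_on_subset[OF lam_plus_continuous[OF k1 ne]]) (use c1 c2 in auto)
    then obtain c where c: "c1 \<le> c" "c \<le> c2" "lam_plus c k = l"
      using IVT2'[of "\<lambda>c. lam_plus c k" c2 l c1] c2 k by auto
    have "cs < c" "c < 0" using c c1 c2 by auto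
    then show ?thesis using lam_plus_critical(2)[OF _ _ k1 ne, of c] c k unfolding c1_def by blast
  qed
  then obtain c k v where *: "\<And>n. cs / (real n + 2) \<le> c n" "\<And>n. c n < 0" "\<And>n. n + 1 \<le> k n"
    "\<And>n. l = lam_plus (c n) (k n)" "\<And>n. v n \<in> pos_cone A" "\<And>n. Q (v n) < 0" "\<And>n. P (v n) = c n"
    "\<And>n. \<Phi> l (v n) = c n" "\<And>n. dual_deriv (\<Phi> l) (v n) = 0" by metis
  have "(\<lambda>n. cs / (real n + 2)) \<longlonglongrightarrow> 0"
    by (rule tendsto_divide_0[OF tendsto_const])
      (rule filterlim_at_top_imp_at_infinity[OF filterlim_tendsto_add_at_top[OF tendsto_const[of 2] filterlim_real_sequentially, simplified add.commute[of 2]]])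
  from this tendsto_const have c0: "c \<longlonglongrightarrow> 0"
    by (rule tendsto_sandwich[rotated 2]) (use * in \<open>auto intro!: always_eventually less_imp_le\<close>)
  have "cs < c n" for n using *(1)[of n] cs_less_fraction[of n] by linarith
  then have "c n \<in> {cs<..<0}" for n using *(2) by simp
  moreover have "v \<longlonglongrightarrow> 0"
  proof (rule Lim_null_comparison)
    show "\<forall>\<^sub>F n in sequentially. norm (v n) \<le> (C * - c n / \<kappa>) powr (1 / \<eta>)"
      using norm_le_of_plus_level[OF *(6,7)] by simp
    show "(\<lambda>n. (C * - c n / \<kappa>) powr (1 / \<eta>)) \<longlonglongrightarrow> 0"
    proof (rule tendsto_zero_powrI[OF _ tendsto_const])
      show "(\<lambda>n. C * - c n / \<kappa>) \<longlonglongrightarrow> 0" using \<kappa>_pos by (auto intro!: tendsto_eq_intros c0)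
      show "\<forall>\<^sub>F n in sequentially. 0 \<le> C * - c n / \<kappa>"
        using *(2) C_pos \<kappa>_pos by (intro always_eventually allI divide_nonneg_pos mult_nonneg_nonneg) (auto intro: less_imp_le)
    qed (use exponents_pos in simp)
  qed
  ultimately show ?thesis using that * c0 by blast
qed

text \<open>The same intermediate value argument on levels from \<open>n\<close> upwards, now using
  that \<open>lam_minus\<close> tends to minus infinity in the level. A level
  \<open>P v \<ge> n\<close> is possible only for large \<open>norm v\<close>.\<close>

lemma minus_sequences:
  assumes ne: "\<And>k. genus_family KAB k \<noteq> {}"
  obtains u c k where "\<And>n. u n \<in> KAB" "\<And>n. real n \<le> c n" "\<And>n. n + 1 \<le> k n"
    "\<And>n. l = lam_minus (c n) (k n)" "\<And>n. \<Phi> l (u n) = c n"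
    "\<And>n. dual_deriv (\<Phi> l) (u n) = 0" "filterlim (\<lambda>n. norm (u n)) at_top sequentially"
proof -
  have "\<exists>c k v. real n \<le> c \<and> n + 1 \<le> k \<and> l = lam_minus c k \<and> v \<in> KAB \<and> P v = c \<and>
    \<Phi> l v = c \<and> dual_deriv (\<Phi> l) v = 0" for n
  proof -
    have c1: "cs < real n" using cs_neg by (rule less_le_trans) simp
    obtain k where k: "n + 1 \<le> k" "l \<le> lam_minus (real n) k"
      using filterlim_nat_ex_ge[OF lam_minus_mono_at_top(2)[OF c1 ne]] by blast
    have k1: "1 \<le> k" using k by simp
    have "\<forall>\<^sub>F c in at_top. lam_minus c k \<le> l \<and> real n \<le> c"
      using lam_minus_at_bot[OF k1 ne] eventually_ge_at_top[of "real n"]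
      unfolding filterlim_at_bot by (auto intro: eventually_conj)
    then obtain c2 where c2: "lam_minus c2 k \<le> l" "real n \<le> c2"
      using eventually_happens'[of "at_top :: real filter"] by auto
    have "continuous_on {real n..c2} (\<lambda>c. lam_minus c k)"
      by (rule continuous_on_subset[OF lam_minus_continuous[OF k1 ne]]) (use c1 in auto)
    then obtain c where c: "real n \<le> c" "lam_minus c k = l"
      using IVT2'[of "\<lambda>c. lam_minus c k" c2 l "real n"] c2 k by auto
    have "cs < c" using c c1 by auto
    then obtain v where "v \<in> KAB" "P v = c" "\<Phi> l v = c"
      "dual_deriv (\<Phi> l) v = 0"
      using lam_minus_critical[OF _ k1 ne, of c] c(2) by metis
    then show ?thesis using c k by blast
  qed
  then obtain c k u where *: "\<And>n. real n \<le> c n" "\<And>n. n + 1 \<le> k n"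
    "\<And>n. l = lam_minus (c n) (k n)" "\<And>n. u n \<in> KAB" "\<And>n. P (u n) = c n"
    "\<And>n. \<Phi> l (u n) = c n" "\<And>n. dual_deriv (\<Phi> l) (u n) = 0" by metis
  have "filterlim (\<lambda>n. norm (u n)) at_top sequentially"
    unfolding filterlim_at_top
  proof
    fix Z :: real
    define X where "X = (\<beta> - \<alpha>) / (\<alpha> * \<beta>) * C * \<bar>Z\<bar> powr \<beta>"
    obtain m where m: "X < real m" using reals_Archimedean2 by blast
    have "Z \<le> norm (u n)" if "m \<le> n" for n
    proof (rule ccontr)
      assume "\<not> ?thesis"
      then have "norm (u n) powr \<beta> \<le> \<bar>Z\<bar> powr \<beta>" using exponents_pos by (intro powr_mono2) auto
      then have "(\<beta> - \<alpha>) / (\<alpha> * \<beta>) * C * norm (u n) powr \<beta> \<le> X"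
        unfolding X_def using exponents_pos C_pos by (intro mult_left_mono) auto
      then have "c n \<le> X" using norm_ge_of_level[OF *(5)[of n]] by linarith
      then show False using *(1)[of n] m that by linarith
    qed
    then show "\<forall>\<^sub>F n in sequentially. Z \<le> norm (u n)" unfolding eventually_sequentially by blast
  qed
  then show ?thesis using that * by blast
qed

end

theorem theorem1p7:
  fixes N A B :: "'a::banach \<Rightarrow> real"
    and \<alpha> \<eta> \<beta> :: real
    and \<Phi> :: "real \<Rightarrow> 'a \<Rightarrow> real"
    and CA CAB :: "'a set"
  assumes "uniformly_convex_norm TYPE('a)"
    and "C1_on (- {0}) (norm :: 'a \<Rightarrow> real)"
    and "1 < \<alpha>" and "\<alpha> < \<eta>" and "\<eta> < \<beta>"
    and "C1_on UNIV N" and "C1_on UNIV A" and "C1_on UNIV B"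
    and "even_functional N" and "even_functional A" and "even_functional B"
    and "homogeneous \<eta> N" and "homogeneous \<alpha> A" and "homogeneous \<beta> B"
    and "\<Phi> = Phi \<eta> \<alpha> \<beta> N A B"
    and "\<exists>C>0. \<exists>C'>0. \<forall>u.
           N u \<le> C' * norm u powr \<eta> \<and> inverse C * norm u powr \<eta> \<le> N u \<and>
           \<bar>A u\<bar> \<le> C * norm u powr \<alpha> \<and> \<bar>B u\<bar> \<le> C * norm u powr \<beta>"
    and "compactness_condition \<Phi>"
    and "CA = pos_cone A" and "CAB = pos_cone A \<inter> pos_cone B"
    and "\<And>us :: nat \<Rightarrow> 'a. range us \<subseteq> CA \<Longrightarrow> bounded (range us) \<Longrightarrow>
           (\<lambda>n. A (us n)) \<longlonglongrightarrow> 0 \<Longrightarrow> (\<lambda>n. B (us n)) \<longlonglongrightarrow> 0"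
  shows "0 < c_star_star \<eta> \<beta> N A B \<and>
    (\<exists>cs<0. \<exists>lamp lamm :: real \<Rightarrow> nat \<Rightarrow> real.
      \<comment> \<open>i)\<close>
      (\<forall>k\<ge>1. enat k \<le> cone_genus CA \<longrightarrow>
         (\<forall>c\<in>{cs<..<0}. 0 < lamp c k \<and>
            (\<exists>v\<in>CA. \<Phi> (lamp c k) v = c \<and> dual_deriv (\<Phi> (lamp c k)) v = 0))) \<and>
      \<comment> \<open>ii)\<close>
      (\<forall>k\<ge>1. enat k \<le> cone_genus CA \<longrightarrow>
         continuous_on {cs<..<0} (\<lambda>c. lamp c k) \<and>
         strict_antimono_on {cs<..<0} (\<lambda>c. lamp c k) \<and>
         ((\<lambda>c. lamp c k) \<longlongrightarrow> 0) (at_left 0)) \<and>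
      \<comment> \<open>iii)\<close>
      (cone_genus CA = \<infinity> \<longrightarrow>
         (\<forall>c\<in>{cs<..<0}.
            (\<forall>k\<ge>1. 0 < lamp c k \<and> lamp c k \<le> lamp c (Suc k)) \<and>
            filterlim (\<lambda>k. lamp c k) at_top sequentially)) \<and>
      \<comment> \<open>iv)\<close>
      (cone_genus CA = \<infinity> \<longrightarrow>
         (\<forall>lam>0.
            (\<exists>(v :: nat \<Rightarrow> 'a) (c :: nat \<Rightarrow> real) (k :: nat \<Rightarrow> nat).
               (\<forall>n. v n \<in> CA \<and> c n \<in> {cs<..<0} \<and> 1 \<le> k n \<and>
                  lam = lamp (c n) (k n) \<and> \<Phi> (lamp (c n) (k n)) (v n) = c n \<and>
                  dual_deriv (\<Phi> (lamp (c n) (k n))) (v n) = 0) \<and>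
               c \<longlonglongrightarrow> 0 \<and> filterlim k at_top sequentially \<and> v \<longlonglongrightarrow> 0) \<and>
            bifurcation_from_zero \<Phi> lam)) \<and>
      \<comment> \<open>v)\<close>
      (\<forall>k\<ge>1. enat k \<le> cone_genus CAB \<longrightarrow>
         (\<forall>c>cs. \<exists>u\<in>CAB. \<Phi> (lamm c k) u = c \<and> dual_deriv (\<Phi> (lamm c k)) u = 0) \<and>
         (\<forall>c\<in>{cs<..<0}. lamp c k < lamm c k)) \<and>
      \<comment> \<open>vi)\<close>
      (\<forall>k\<ge>1. enat k \<le> cone_genus CAB \<longrightarrow>
         continuous_on {cs<..} (\<lambda>c. lamm c k) \<and>
         strict_antimono_on {cs<..} (\<lambda>c. lamm c k) \<and>
         filterlim (\<lambda>c. lamm c k) at_bot at_top) \<and>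
      \<comment> \<open>vii)\<close>
      (cone_genus CAB = \<infinity> \<longrightarrow>
         (\<forall>c. cs < c \<longrightarrow> ereal c < c_star_star \<eta> \<beta> N A B \<longrightarrow>
            (\<forall>k\<ge>1. 0 < lamm c k \<and> lamm c k \<le> lamm c (Suc k)) \<and>
            filterlim (\<lambda>k. lamm c k) at_top sequentially)) \<and>
      \<comment> \<open>viii)\<close>
      (cone_genus CAB = \<infinity> \<longrightarrow>
         (\<forall>lam.
            (\<exists>(u :: nat \<Rightarrow> 'a) (c :: nat \<Rightarrow> real) (k :: nat \<Rightarrow> nat).
               (\<forall>n. u n \<in> CAB \<and> cs < c n \<and> 1 \<le> k n \<and>
                  lam = lamm (c n) (k n) \<and> \<Phi> (lamm (c n) (k n)) (u n) = c n \<and>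
                  dual_deriv (\<Phi> (lamm (c n) (k n))) (u n) = 0) \<and>
               filterlim c at_top sequentially \<and> filterlim k at_top sequentially \<and>
               filterlim (\<lambda>n. norm (u n)) at_top sequentially) \<and>
            bifurcation_from_infinity \<Phi> lam)))"
proof -
  obtain N' where N': "\<And>u. (N has_derivative blinfun_apply (N' u)) (at u)" "continuous_on UNIV N'"
    using assms(6) unfolding C1_on_def by blast
  obtain A' where A': "\<And>u. (A has_derivative blinfun_apply (A' u)) (at u)" "continuous_on UNIV A'"
    using assms(7) unfolding C1_on_def by blast
  obtain B' where B': "\<And>u. (B has_derivative blinfun_apply (B' u)) (at u)" "continuous_on UNIV B'"
    using assms(8) unfolding C1_on_def by blast
  obtain C C' where C: "0 < C" "0 < C'"
    "\<And>u. N u \<le> C' * norm u powr \<eta> \<and> inverse C * norm u powr \<eta> \<le> N u \<and>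
       \<bar>A u\<bar> \<le> C * norm u powr \<alpha> \<and> \<bar>B u\<bar> \<le> C * norm u powr \<beta>"
    using assms(16) by blast
  interpret fibering_problem N A B N' A' B' \<alpha> \<eta> \<beta> C C'
  proof
    show "compactness_condition (Phi \<eta> \<alpha> \<beta> N A B)" using assms(15,17) by simp
    show "(\<lambda>n. B (us n)) \<longlonglongrightarrow> 0" if "range us \<subseteq> pos_cone A" "bounded (range us)" "(\<lambda>n. A (us n)) \<longlonglongrightarrow> 0"
      for us using assms(18,20) that by blast
  qed (use assms(3-5,9-14) N' A' B' C in \<open>auto simp: even_functional_def homogeneous_def\<close>)
  let ?CA = "pos_cone A" and ?CAB = "pos_cone A \<inter> pos_cone B" and ?\<Phi> = "Phi \<eta> \<alpha> \<beta> N A B"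
  have ne_A: "genus_family ?CA k \<noteq> {}" if "enat k \<le> cone_genus ?CA" for k
    by (rule genus_family_nonempty[OF pos_cone_A_props(2,4) that])
  have ne_AB: "genus_family ?CAB k \<noteq> {}" if "enat k \<le> cone_genus ?CAB" for k
    by (rule genus_family_nonempty[OF _ _ that]) (use pos_cone_A_props(2,4) pos_cone_B_props(2) in auto)
  have i: "\<forall>k\<ge>1. enat k \<le> cone_genus ?CA \<longrightarrow> (\<forall>c\<in>{cs<..<0}. 0 < lam_plus c k \<and>
      (\<exists>v\<in>?CA. ?\<Phi> (lam_plus c k) v = c \<and> dual_deriv (?\<Phi> (lam_plus c k)) v = 0))"
    using lam_plus_critical ne_A by (metis greaterThanLessThan_iff)
  have ii: "\<forall>k\<ge>1. enat k \<le> cone_genus ?CA \<longrightarrow> continuous_on {cs<..<0} (\<lambda>c. lam_plus c k) \<and>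
      strict_antimono_on {cs<..<0} (\<lambda>c. lam_plus c k) \<and> ((\<lambda>c. lam_plus c k) \<longlongrightarrow> 0) (at_left 0)"
    using lam_plus_continuous lam_plus_tendsto_0 lam_plus_strict ne_A by (auto intro!: monotone_onI)
  have iii: "\<forall>c\<in>{cs<..<0}. (\<forall>k\<ge>1. 0 < lam_plus c k \<and> lam_plus c k \<le> lam_plus c (Suc k)) \<and>
      filterlim (\<lambda>k. lam_plus c k) at_top sequentially" if "cone_genus ?CA = \<infinity>"
    using lam_plus_mono_at_top lam_plus_critical(1) ne_A that by auto
  have iv: "(\<exists>(v :: nat \<Rightarrow> 'a) (c :: nat \<Rightarrow> real) (k :: nat \<Rightarrow> nat).
      (\<forall>n. v n \<in> ?CA \<and> c n \<in> {cs<..<0} \<and> 1 \<le> k n \<and> lam = lam_plus (c n) (k n) \<and>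
         ?\<Phi> (lam_plus (c n) (k n)) (v n) = c n \<and> dual_deriv (?\<Phi> (lam_plus (c n) (k n))) (v n) = 0) \<and>
      c \<longlonglongrightarrow> 0 \<and> filterlim k at_top sequentially \<and> v \<longlonglongrightarrow> 0) \<and> bifurcation_from_zero ?\<Phi> lam"
    if inf: "cone_genus ?CA = \<infinity>" and pos: "0 < lam" for lam
  proof -
    obtain v c k where *: "\<And>n. v n \<in> ?CA" "\<And>n. c n \<in> {cs<..<0}" "\<And>n. n + 1 \<le> k n" "\<And>n. lam = lam_plus (c n) (k n)"
      "\<And>n. ?\<Phi> lam (v n) = c n" "\<And>n. dual_deriv (?\<Phi> lam) (v n) = 0" "c \<longlonglongrightarrow> 0" "v \<longlonglongrightarrow> 0"
      by (rule plus_sequences[OF ne_A pos]) (use inf in auto)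
    have "n \<le> k n" "1 \<le> k n" for n using *(3)[of n] by auto
    then have "filterlim k at_top sequentially"
      using filterlim_at_top_mono[OF filterlim_ident, of k] by auto
    moreover have "v n \<noteq> 0" for n using *(1)[of n] pos_cone_A_props(4) by metis
    \<comment> \<open>The parameters may be taken constant, since the critical points have been
      found for exactly the given \<lambda>.\<close>
    then have "bifurcation_from_zero ?\<Phi> lam"
      unfolding bifurcation_from_zero_def
      by (intro exI[of _ "\<lambda>_. lam"] exI[of _ v]) (simp add: *(6,8))
    ultimately show ?thesis
      using * \<open>\<And>n. 1 \<le> k n\<close> by (intro conjI exI[of _ v] exI[of _ c] exI[of _ k] allI) (simp_all flip: *(4))
  qed
  have v: "\<forall>k\<ge>1. enat k \<le> cone_genus ?CAB \<longrightarrow>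
      (\<forall>c>cs. \<exists>u\<in>?CAB. ?\<Phi> (lam_minus c k) u = c \<and> dual_deriv (?\<Phi> (lam_minus c k)) u = 0) \<and>
      (\<forall>c\<in>{cs<..<0}. lam_plus c k < lam_minus c k)"
  proof (intro allI impI conjI ballI)
    fix k c assume k: "1 \<le> k" "enat k \<le> cone_genus ?CAB"
    show "\<exists>u\<in>?CAB. ?\<Phi> (lam_minus c k) u = c \<and> dual_deriv (?\<Phi> (lam_minus c k)) u = 0" if "cs < c"
      by (rule lam_minus_critical[OF that k(1) ne_AB[OF k(2)]]) blast
    show "lam_plus c k < lam_minus c k" if "c \<in> {cs<..<0}"
      using lam_plus_less_lam_minus[OF _ _ k(1) ne_AB[OF k(2)]] that by simp
  qed
  have vi: "\<forall>k\<ge>1. enat k \<le> cone_genus ?CAB \<longrightarrow> continuous_on {cs<..} (\<lambda>c. lam_minus c k) \<and>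
      strict_antimono_on {cs<..} (\<lambda>c. lam_minus c k) \<and> filterlim (\<lambda>c. lam_minus c k) at_bot at_top"
    using lam_minus_continuous lam_minus_at_bot lam_minus_strict ne_AB by (auto intro!: monotone_onI)
  have vii: "\<forall>c. cs < c \<longrightarrow> ereal c < c_star_star \<eta> \<beta> N A B \<longrightarrow>
      (\<forall>k\<ge>1. 0 < lam_minus c k \<and> lam_minus c k \<le> lam_minus c (Suc k)) \<and>
      filterlim (\<lambda>k. lam_minus c k) at_top sequentially" if "cone_genus ?CAB = \<infinity>"
    using lam_minus_mono_at_top lam_minus_pos ne_AB that by auto
  have viii: "(\<exists>(u :: nat \<Rightarrow> 'a) (c :: nat \<Rightarrow> real) (k :: nat \<Rightarrow> nat).
      (\<forall>n. u n \<in> ?CAB \<and> cs < c n \<and> 1 \<le> k n \<and> lam = lam_minus (c n) (k n) \<and>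
         ?\<Phi> (lam_minus (c n) (k n)) (u n) = c n \<and> dual_deriv (?\<Phi> (lam_minus (c n) (k n))) (u n) = 0) \<and>
      filterlim c at_top sequentially \<and> filterlim k at_top sequentially \<and>
      filterlim (\<lambda>n. norm (u n)) at_top sequentially) \<and> bifurcation_from_infinity ?\<Phi> lam"
    if inf: "cone_genus ?CAB = \<infinity>" for lam
  proof -
    obtain u c k where *: "\<And>n. u n \<in> ?CAB" "\<And>n. real n \<le> c n" "\<And>n. n + 1 \<le> k n" "\<And>n. lam = lam_minus (c n) (k n)"
      "\<And>n. ?\<Phi> lam (u n) = c n" "\<And>n. dual_deriv (?\<Phi> lam) (u n) = 0" "filterlim (\<lambda>n. norm (u n)) at_top sequentially"
      by (rule minus_sequences[OF ne_AB, of lam]) (use inf in auto)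
    have k: "n \<le> k n" "1 \<le> k n" for n using *(3)[of n] by auto
    then have "filterlim k at_top sequentially"
      using filterlim_at_top_mono[OF filterlim_ident, of k] by auto
    moreover have "filterlim c at_top sequentially"
      using filterlim_at_top_mono[OF filterlim_real_sequentially, of c] *(2) by auto
    moreover have "cs < c n" for n using cs_neg *(2)[of n] by (meson less_le_trans of_nat_0_le_iff)
    moreover have "u n \<noteq> 0" for n using *(1)[of n] pos_cone_A_props(4) by (metis IntD1)
    then have "bifurcation_from_infinity ?\<Phi> lam"
      unfolding bifurcation_from_infinity_def
      by (intro exI[of _ "\<lambda>_. lam"] exI[of _ u]) (simp add: *(6,7))
    ultimately show ?thesis
      using * k by (intro conjI exI[of _ u] exI[of _ c] exI[of _ k] allI) (simp_all flip: *(4))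
  qed
  show ?thesis
    unfolding assms(15,18,19)
    by (intro conjI exI[of _ cs] exI[of _ lam_plus] exI[of _ lam_minus] c_star_star_pos cs_neg i ii v vi
        impI iii vii allI iv viii)
qed

end
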